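(* For all $\alpha>0$, every finitely generated subgroup of $\mathrm{Diff}_+^{1+\alpha}([0,1])$ which contains no free semi-group on two generators is almost nilpotent.
   Context: $\mathrm{Diff}_+^{1+\alpha}([0,1])$ is the group of orientation preserving $C^1$ diffeomorphisms of $[0,1]$ whose derivative is $\alpha$-H\"older continuous. A group is almost nilpotent if it contains a finite index nilpotent subgroup. A group contains a free semi-group on two generators if it contains two elements $f,g$ such that distinct words in non-negative powers of $f$ and $g$ represent distinct elements of the group. *)

theory Defs
  imports "HOL-Analysis.Analysis" "HOL-Algebra.Bij" "HOL-Algebra.Generated_Groups"
begin

definition deriv_on :: "real set \<Rightarrow> (real \<Rightarrow> real) \<Rightarrow> (real \<Rightarrow> real) \<Rightarrow> bool"
  where "deriv_on I f f' \<longleftrightarrow> (\<forall>x\<in>I. (f has_real_derivative f' x) (at x within I))"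

definition C1_on :: "real set \<Rightarrow> (real \<Rightarrow> real) \<Rightarrow> bool"
  where "C1_on I f \<longleftrightarrow> (\<exists>f'. deriv_on I f f' \<and> continuous_on I f')"

definition holder_on :: "real \<Rightarrow> real set \<Rightarrow> (real \<Rightarrow> real) \<Rightarrow> bool"
  where "holder_on \<alpha> I u \<longleftrightarrow> (\<exists>C. \<forall>x\<in>I. \<forall>y\<in>I. \<bar>u x - u y\<bar> \<le> C * \<bar>x - y\<bar> powr \<alpha>)"

text \<open>As in \<^const>\<open>BijGroup\<close>, a map of the interval is represented by the real function that
  agrees with it on the interval and is \<^const>\<open>undefined\<close> elsewhere.  Derivatives at the
  end points are therefore one-sided.\<close>

definition C1_diffeos :: "real set \<Rightarrow> (real \<Rightarrow> real) set"
  where "C1_diffeos I = {f \<in> Bij I. C1_on I f \<and> C1_on I (inv_into I f)}"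

definition Diff_plus :: "real \<Rightarrow> (real \<Rightarrow> real) monoid"
  where "Diff_plus \<alpha> = BijGroup {0..1}
    \<lparr>carrier := {f \<in> C1_diffeos {0..1}. strict_mono_on {0..1} f \<and>
                  (\<exists>f'. deriv_on {0..1} f f' \<and> holder_on \<alpha> {0..1} f')}\<rparr>"

definition finitely_generated :: "('a, 'b) monoid_scheme \<Rightarrow> bool"
  where "finitely_generated G \<longleftrightarrow>
    (\<exists>S. finite S \<and> S \<subseteq> carrier G \<and> generate G S = carrier G)"

primrec lower_central :: "('a, 'b) monoid_scheme \<Rightarrow> nat \<Rightarrow> 'a set"
  where
    "lower_central G 0 = carrier G"
  | "lower_central G (Suc n) = generate G
      (\<Union>h\<in>lower_central G n. \<Union>g\<in>carrier G. {h \<otimes>\<^bsub>G\<^esub> g \<otimes>\<^bsub>G\<^esub> inv\<^bsub>G\<^esub> h \<otimes>\<^bsub>G\<^esub> inv\<^bsub>G\<^esub> g})"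

definition nilpotent :: "('a, 'b) monoid_scheme \<Rightarrow> bool"
  where "nilpotent G \<longleftrightarrow> (\<exists>n. lower_central G n = {\<one>\<^bsub>G\<^esub>})"

definition almost_nilpotent :: "('a, 'b) monoid_scheme \<Rightarrow> bool"
  where "almost_nilpotent G \<longleftrightarrow>
    (\<exists>N. subgroup N G \<and> finite (rcosets\<^bsub>G\<^esub> N) \<and> nilpotent (G\<lparr>carrier := N\<rparr>))"

text \<open>Words are Boolean lists, \<^const>\<open>True\<close> standing for \<open>f\<close> and \<^const>\<open>False\<close> for \<open>g\<close>.
  Admitting the empty word changes nothing: if a nonempty word \<open>w\<close> represents
  the identity, then \<open>w\<close> and \<open>w @ w\<close> represent the same element.\<close>

definition eval_word :: "('a, 'b) monoid_scheme \<Rightarrow> 'a \<Rightarrow> 'a \<Rightarrow> bool list \<Rightarrow> 'a"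
  where "eval_word G f g w = foldr (\<lambda>b h. (if b then f else g) \<otimes>\<^bsub>G\<^esub> h) w \<one>\<^bsub>G\<^esub>"

definition contains_free_semigroup :: "('a, 'b) monoid_scheme \<Rightarrow> bool"
  where "contains_free_semigroup G \<longleftrightarrow>
    (\<exists>f\<in>carrier G. \<exists>g\<in>carrier G. inj (eval_word G f g))"


subsection \<open>\<^term>\<open>Diff_plus \<alpha>\<close> is a group\<close>

lemma deriv_on_compose:
  assumes "deriv_on I f f'" "deriv_on I g g'" "g \<in> I \<rightarrow> I"
  shows "deriv_on I (\<lambda>x. f (g x)) (\<lambda>x. f' (g x) * g' x)"
  unfolding deriv_on_def
proof
  fix x assume x: "x \<in> I"
  have "(f has_real_derivative f' (g x)) (at (g x) within g ` I)"
    by (rule DERIV_subset[of _ _ _ I]) (use assms x in \<open>auto simp: deriv_on_def\<close>)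
  from DERIV_image_chain[OF this, of "g' x"] show
    "((\<lambda>x. f (g x)) has_real_derivative f' (g x) * g' x) (at x within I)"
    using assms x by (auto simp: deriv_on_def o_def)
qed

lemma deriv_on_cong:
  assumes "\<And>x. x \<in> I \<Longrightarrow> f x = g x"
  shows "deriv_on I f f' \<longleftrightarrow> deriv_on I g f'"
  unfolding deriv_on_def
  by (intro ball_cong refl has_field_derivative_cong_eventually)
     (use assms in \<open>auto simp: eventually_at_filter\<close>)

lemma C1_on_cong:
  assumes "\<And>x. x \<in> I \<Longrightarrow> f x = g x"
  shows "C1_on I f \<longleftrightarrow> C1_on I g"
  unfolding C1_on_def using deriv_on_cong[OF assms] by simp

lemma deriv_on_continuous: "deriv_on I f f' \<Longrightarrow> continuous_on I f"
  by (auto simp: deriv_on_def continuous_on_eq_continuous_within intro: DERIV_continuous)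

lemma C1_on_compose:
  assumes "C1_on I f" "C1_on I g" "g \<in> I \<rightarrow> I"
  shows "C1_on I (\<lambda>x. f (g x))"
proof -
  obtain f' g' where d: "deriv_on I f f'" "continuous_on I f'" "deriv_on I g g'" "continuous_on I g'"
    using assms by (auto simp: C1_on_def)
  have "continuous_on I (\<lambda>x. f' (g x) * g' x)"
    by (intro continuous_on_mult d continuous_on_compose2[OF d(2) deriv_on_continuous[OF d(3)]])
       (use assms in auto)
  then show ?thesis
    using deriv_on_compose[OF d(1,3) assms(3)] by (auto simp: C1_on_def)
qed

lemma deriv_on_unique:
  assumes "deriv_on {0..1} f a" "deriv_on {0..1} f b" "x \<in> {0..1}"
  shows "a x = b x"
proof -
  have "at x within {0..1::real} \<noteq> bot"
    using assms(3) by (simp add: trivial_limit_within islimpt_Icc)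
  then show ?thesis
    using assms has_field_derivative_unique[of f "a x" x "{0..1}" "b x"]
    unfolding deriv_on_def by blast
qed

lemma continuous_bounded:
  assumes "continuous_on {0..1::real} (u :: real \<Rightarrow> real)"
  obtains M where "M > 0" "\<And>x. x \<in> {0..1} \<Longrightarrow> \<bar>u x\<bar> \<le> M"
proof -
  have "bounded (u ` {0..1})"
    by (intro compact_imp_bounded compact_continuous_image assms compact_Icc)
  then show ?thesis
    using that by (auto simp: bounded_pos)
qed

lemma C1_lipschitz:
  assumes "C1_on {0..1} f"
  obtains L where "L > 0" "\<And>x y. x \<in> {0..1} \<Longrightarrow> y \<in> {0..1} \<Longrightarrow> \<bar>f x - f y\<bar> \<le> L * \<bar>x - y\<bar>"
proof -
  obtain f' where d: "deriv_on {0..1} f f'" "continuous_on {0..1} f'"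
    using assms by (auto simp: C1_on_def)
  obtain M where M: "M > 0" "\<And>x. x \<in> {0..1} \<Longrightarrow> \<bar>f' x\<bar> \<le> M"
    using continuous_bounded[OF d(2)] by blast
  show ?thesis
  proof (rule that[OF M(1)])
    fix x y :: real assume "x \<in> {0..1}" "y \<in> {0..1}"
    then show "\<bar>f x - f y\<bar> \<le> M * \<bar>x - y\<bar>"
      using field_differentiable_bound[of "{0..1}" f f' M x y] d(1) M(2)
      by (auto simp: deriv_on_def)
  qed
qed

lemma holder_on_nonneg:
  assumes "holder_on \<alpha> I u"
  obtains C where "C \<ge> 0" "\<And>x y. x \<in> I \<Longrightarrow> y \<in> I \<Longrightarrow> \<bar>u x - u y\<bar> \<le> C * \<bar>x - y\<bar> powr \<alpha>"
proof -
  obtain C where C: "\<And>x y. x \<in> I \<Longrightarrow> y \<in> I \<Longrightarrow> \<bar>u x - u y\<bar> \<le> C * \<bar>x - y\<bar> powr \<alpha>"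
    using assms by (auto simp: holder_on_def)
  show ?thesis
  proof (rule that[of "max C 0"])
    fix x y assume "x \<in> I" "y \<in> I"
    then show "\<bar>u x - u y\<bar> \<le> max C 0 * \<bar>x - y\<bar> powr \<alpha>"
      using C[of x y] by (meson max.cobounded1 mult_right_mono order_trans powr_ge_zero)
  qed simp
qed

lemma holder_on_compose:
  assumes "\<alpha> > 0" "holder_on \<alpha> {0..1} u" "C1_on {0..1} g" "g \<in> {0..1} \<rightarrow> {0..1}"
  shows "holder_on \<alpha> {0..1} (\<lambda>x. u (g x))"
proof -
  obtain C where C: "C \<ge> 0"
    "\<And>x y. x \<in> {0..1} \<Longrightarrow> y \<in> {0..1} \<Longrightarrow> \<bar>u x - u y\<bar> \<le> C * \<bar>x - y\<bar> powr \<alpha>"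
    using holder_on_nonneg[OF assms(2)] by blast
  obtain L where L: "L > 0"
    "\<And>x y. x \<in> {0..1} \<Longrightarrow> y \<in> {0..1} \<Longrightarrow> \<bar>g x - g y\<bar> \<le> L * \<bar>x - y\<bar>"
    using C1_lipschitz[OF assms(3)] by blast
  show ?thesis
    unfolding holder_on_def
  proof (intro exI ballI)
    fix x y :: real assume xy: "x \<in> {0..1}" "y \<in> {0..1}"
    have "\<bar>u (g x) - u (g y)\<bar> \<le> C * \<bar>g x - g y\<bar> powr \<alpha>"
      using C(2) assms(4) xy by blast
    also have "\<dots> \<le> C * (L * \<bar>x - y\<bar>) powr \<alpha>"
      by (intro mult_left_mono powr_mono2 C L xy) (use assms in auto)
    also have "\<dots> = (C * L powr \<alpha>) * \<bar>x - y\<bar> powr \<alpha>"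
      using L(1) by (simp add: powr_mult)
    finally show "\<bar>u (g x) - u (g y)\<bar> \<le> (C * L powr \<alpha>) * \<bar>x - y\<bar> powr \<alpha>" .
  qed
qed

lemma holder_on_continuous:
  assumes "\<alpha> > 0" "holder_on \<alpha> I u"
  shows "continuous_on I u"
proof -
  obtain C where C: "C \<ge> 0" "\<And>x y. x \<in> I \<Longrightarrow> y \<in> I \<Longrightarrow> \<bar>u x - u y\<bar> \<le> C * \<bar>x - y\<bar> powr \<alpha>"
    using holder_on_nonneg[OF assms(2)] by blast
  show ?thesis
    unfolding continuous_on_def
  proof
    fix x assume x: "x \<in> I"
    have "((\<lambda>y. C * \<bar>y - x\<bar> powr \<alpha>) \<longlongrightarrow> C * \<bar>x - x\<bar> powr \<alpha>) (at x within I)"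
      using assms(1) by (intro tendsto_intros tendsto_powr') auto
    then have "((\<lambda>y. C * \<bar>y - x\<bar> powr \<alpha>) \<longlongrightarrow> 0) (at x within I)" by simp
    then have "((\<lambda>y. u y - u x) \<longlongrightarrow> 0) (at x within I)"
      by (rule Lim_null_comparison[rotated])
         (use C(2) x in \<open>auto simp: eventually_at_filter\<close>)
    then show "(u \<longlongrightarrow> u x) (at x within I)"
      using LIM_zero_iff by blast
  qed
qed

lemma holder_on_mult:
  assumes "\<alpha> > 0" "holder_on \<alpha> {0..1} u" "holder_on \<alpha> {0..1} v"
  shows "holder_on \<alpha> {0..1} (\<lambda>x. u x * v x)"
proof -
  obtain C where C: "C \<ge> 0"
    "\<And>x y. x \<in> {0..1} \<Longrightarrow> y \<in> {0..1} \<Longrightarrow> \<bar>u x - u y\<bar> \<le> C * \<bar>x - y\<bar> powr \<alpha>"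
    using holder_on_nonneg[OF assms(2)] by blast
  obtain D where D: "D \<ge> 0"
    "\<And>x y. x \<in> {0..1} \<Longrightarrow> y \<in> {0..1} \<Longrightarrow> \<bar>v x - v y\<bar> \<le> D * \<bar>x - y\<bar> powr \<alpha>"
    using holder_on_nonneg[OF assms(3)] by blast
  obtain M where M: "M > 0" "\<And>x. x \<in> {0..1} \<Longrightarrow> \<bar>u x\<bar> \<le> M"
    using continuous_bounded[OF holder_on_continuous[OF assms(1,2)]] by blast
  obtain N where N: "N > 0" "\<And>x. x \<in> {0..1} \<Longrightarrow> \<bar>v x\<bar> \<le> N"
    using continuous_bounded[OF holder_on_continuous[OF assms(1,3)]] by blast
  show ?thesis
    unfolding holder_on_def
  proof (intro exI ballI)
    fix x y :: real assume xy: "x \<in> {0..1}" "y \<in> {0..1}"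
    have "u x * v x - u y * v y = u x * (v x - v y) + (u x - u y) * v y"
      by (simp add: algebra_simps)
    then have "\<bar>u x * v x - u y * v y\<bar> \<le> \<bar>u x\<bar> * \<bar>v x - v y\<bar> + \<bar>u x - u y\<bar> * \<bar>v y\<bar>"
      by (metis abs_mult abs_triangle_ineq)
    also have "\<dots> \<le> M * (D * \<bar>x - y\<bar> powr \<alpha>) + (C * \<bar>x - y\<bar> powr \<alpha>) * N"
      by (intro add_mono mult_mono M N C D xy) (use C D M N in auto)
    also have "\<dots> = (M * D + C * N) * \<bar>x - y\<bar> powr \<alpha>"
      by (simp add: algebra_simps)
    finally show "\<bar>u x * v x - u y * v y\<bar> \<le> (M * D + C * N) * \<bar>x - y\<bar> powr \<alpha>" .
  qed
qed

lemma group_Diff_plus: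
  assumes "\<alpha> > 0"
  shows "group (Diff_plus \<alpha>)"
proof -
  interpret B: group "BijGroup {0..1::real}" by (rule group_BijGroup)
  let ?I = "{0..1::real}"
  let ?P = "\<lambda>f. \<exists>f'. deriv_on ?I f f' \<and> holder_on \<alpha> ?I f'"
  let ?H = "{f \<in> C1_diffeos ?I. strict_mono_on ?I f \<and> ?P f}"
  have "subgroup ?H (BijGroup ?I)"
  proof (rule B.subgroupI)
    show "?H \<subseteq> carrier (BijGroup ?I)"
      by (auto simp: BijGroup_def C1_diffeos_def)
  next
    let ?id = "\<lambda>x\<in>?I. x"
    have d: "deriv_on ?I (\<lambda>x. x) (\<lambda>_. 1)"
      by (auto simp: deriv_on_def)
    have d1: "deriv_on ?I ?id (\<lambda>_. 1)"
      using d deriv_on_cong[of ?I ?id "\<lambda>x. x"] by simp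
    have inv: "inv_into ?I ?id x = x" if "x \<in> ?I" for x
      using inv_into_f_f[of ?id ?I x] that by (auto simp: inj_on_def)
    have d2: "deriv_on ?I (inv_into ?I ?id) (\<lambda>_. 1)"
      using d deriv_on_cong[of ?I "inv_into ?I ?id" "\<lambda>x. x"] inv by simp
    have "holder_on \<alpha> ?I (\<lambda>_. 1)"
      by (auto simp: holder_on_def intro: exI[of _ 0])
    moreover have "C1_on ?I ?id" "C1_on ?I (inv_into ?I ?id)"
      unfolding C1_on_def using d1 d2 continuous_on_const by blast+
    moreover have "strict_mono_on ?I ?id"
      by (auto simp: strict_mono_on_def)
    ultimately have "?id \<in> ?H"
      using d1 id_Bij by (auto simp: C1_diffeos_def)
    then show "?H \<noteq> {}" by blast
  next
    fix f assume f: "f \<in> ?H"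
    then have fB: "f \<in> Bij ?I" by (auto simp: C1_diffeos_def)
    let ?g = "inv_into ?I f"
    let ?r = "\<lambda>x\<in>?I. ?g x"
    have bij: "bij_betw f ?I ?I" using fB by (auto simp: Bij_def)
    have gI: "?g \<in> ?I \<rightarrow> ?I" by (rule funcsetI, rule Bij_inv_into_mem[OF fB])
    have fg: "f (?g x) = x" if "x \<in> ?I" for x
      using bij that by (meson bij_betw_inv_into_right)
    have C1g: "C1_on ?I ?g" using f by (auto simp: C1_diffeos_def)
    then obtain g' where g': "deriv_on ?I ?g g'" "continuous_on ?I g'"
      by (auto simp: C1_on_def)
    obtain f' where f': "deriv_on ?I f f'" "holder_on \<alpha> ?I f'" using f by blast
    have prod: "f' (?g x) * g' x = 1" if "x \<in> ?I" for x
    proof -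
      have "deriv_on ?I (\<lambda>x. f (?g x)) (\<lambda>x. f' (?g x) * g' x)"
        by (rule deriv_on_compose[OF f'(1) g'(1) gI])
      then have "deriv_on ?I (\<lambda>x. x) (\<lambda>x. f' (?g x) * g' x)"
        using deriv_on_cong[of ?I "\<lambda>x. f (?g x)" "\<lambda>x. x"] fg by simp
      moreover have "deriv_on ?I (\<lambda>x. x) (\<lambda>_. 1)"
        by (auto simp: deriv_on_def)
      ultimately show ?thesis using deriv_on_unique that by blast
    qed
    have "holder_on \<alpha> ?I (\<lambda>x. f' (?g x))"
      by (rule holder_on_compose[OF assms f'(2) C1g gI])
    then obtain C where C: "C \<ge> 0"
      "\<And>x y. x \<in> ?I \<Longrightarrow> y \<in> ?I \<Longrightarrow> \<bar>f' (?g x) - f' (?g y)\<bar> \<le> C * \<bar>x - y\<bar> powr \<alpha>"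
      using holder_on_nonneg[of \<alpha> ?I "\<lambda>x. f' (?g x)"] by metis
    obtain M where M: "M > 0" "\<And>x. x \<in> ?I \<Longrightarrow> \<bar>g' x\<bar> \<le> M"
      using continuous_bounded[OF g'(2)] by blast
    have hol: "holder_on \<alpha> ?I g'"
      unfolding holder_on_def
    proof (intro exI ballI)
      fix x y :: real assume xy: "x \<in> ?I" "y \<in> ?I"
      have "g' x - g' y = g' x * (f' (?g y) * g' y) - (f' (?g x) * g' x) * g' y"
        using prod xy by simp
      also have "\<dots> = - ((g' x * g' y) * (f' (?g x) - f' (?g y)))"
        by (simp add: algebra_simps)
      finally have "\<bar>g' x - g' y\<bar> = (\<bar>g' x\<bar> * \<bar>g' y\<bar>) * \<bar>f' (?g x) - f' (?g y)\<bar>"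
        by (simp add: abs_mult)
      also have "\<dots> \<le> (M * M) * (C * \<bar>x - y\<bar> powr \<alpha>)"
        by (intro mult_mono M C xy) (use M C in auto)
      finally show "\<bar>g' x - g' y\<bar> \<le> (M * M * C) * \<bar>x - y\<bar> powr \<alpha>"
        by (simp add: algebra_simps)
    qed
    have d: "deriv_on ?I ?r g'"
      using g'(1) deriv_on_cong[of ?I ?r ?g] by simp
    have rB: "?r \<in> Bij ?I" by (rule restrict_inv_into_Bij[OF fB])
    have mono: "strict_mono_on ?I ?r"
    proof (rule strict_mono_onI)
      fix x y assume xy: "x \<in> ?I" "y \<in> ?I" "x < y"
      have "\<not> ?g y \<le> ?g x"
      proof
        assume "?g y \<le> ?g x"
        then have "f (?g y) \<le> f (?g x)"
          using f strict_mono_on_leD[of ?I f "?g y" "?g x"] funcset_mem[OF gI xy(1)]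
            funcset_mem[OF gI xy(2)] by auto
        then show False using fg xy by simp
      qed
      then show "?r x < ?r y" using xy by simp
    qed
    have "inv_into ?I ?r x = f x" if "x \<in> ?I" for x
    proof (rule inv_into_f_eq)
      show "inj_on ?r ?I" using rB by (auto simp: Bij_def bij_betw_def)
      show "f x \<in> ?I" using bij that by (meson bij_betwE)
      then show "?r (f x) = x" using bij that by (simp add: bij_betw_inv_into_left)
    qed
    then have "C1_on ?I (inv_into ?I ?r)"
      using f C1_on_cong[of ?I "inv_into ?I ?r" f] by (simp add: C1_diffeos_def)
    moreover have "C1_on ?I ?r"
      using d g'(2) by (auto simp: C1_on_def)
    ultimately have "?r \<in> ?H"
      using rB mono d hol by (auto simp: C1_diffeos_def)
    then show "inv\<^bsub>BijGroup ?I\<^esub> f \<in> ?H"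
      using inv_BijGroup[OF fB] by simp
  next
    fix f g assume f: "f \<in> ?H" and g: "g \<in> ?H"
    then have fB: "f \<in> Bij ?I" and gB: "g \<in> Bij ?I" by (auto simp: C1_diffeos_def)
    let ?c = "compose ?I f g"
    have bij: "bij_betw f ?I ?I" "bij_betw g ?I ?I" using fB gB by (auto simp: Bij_def)
    have cB: "?c \<in> Bij ?I" by (rule compose_Bij[OF fB gB])
    have gI: "g \<in> ?I \<rightarrow> ?I" using gB by (rule Bij_imp_funcset)
    have c: "?c x = f (g x)" if "x \<in> ?I" for x using that by (simp add: compose_def)
    have mono: "strict_mono_on ?I ?c"
    proof (rule strict_mono_onI)
      fix x y assume xy: "x \<in> ?I" "y \<in> ?I" "x < y"
      then have "g x < g y" using g strict_mono_onD[of ?I g x y] by blast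
      then have "f (g x) < f (g y)"
        using f strict_mono_onD[of ?I f "g x" "g y"] funcset_mem[OF gI xy(1)]
          funcset_mem[OF gI xy(2)] by blast
      then show "?c x < ?c y" using c xy by simp
    qed
    obtain f' where f': "deriv_on ?I f f'" "holder_on \<alpha> ?I f'" using f by blast
    obtain g' where g': "deriv_on ?I g g'" "holder_on \<alpha> ?I g'" using g by blast
    have C1g: "C1_on ?I g" using g by (auto simp: C1_diffeos_def)
    have "holder_on \<alpha> ?I (\<lambda>x. f' (g x) * g' x)"
      by (rule holder_on_mult[OF assms holder_on_compose[OF assms f'(2) C1g gI] g'(2)])
    moreover have "deriv_on ?I ?c (\<lambda>x. f' (g x) * g' x)"
      using deriv_on_compose[OF f'(1) g'(1) gI] deriv_on_cong[of ?I ?c "\<lambda>x. f (g x)"] c by simp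
    ultimately have P: "?P ?c" by blast
    have "C1_on ?I (\<lambda>x. f (g x))"
      by (rule C1_on_compose) (use f C1g gI in \<open>auto simp: C1_diffeos_def\<close>)
    then have C1: "C1_on ?I ?c"
      using C1_on_cong[of ?I ?c "\<lambda>x. f (g x)"] c by simp
    have fiI: "inv_into ?I f \<in> ?I \<rightarrow> ?I" by (rule funcsetI, rule Bij_inv_into_mem[OF fB])
    have giI: "inv_into ?I g \<in> ?I \<rightarrow> ?I" by (rule funcsetI, rule Bij_inv_into_mem[OF gB])
    have C1i: "C1_on ?I (\<lambda>x. inv_into ?I g (inv_into ?I f x))"
      by (rule C1_on_compose) (use f g fiI in \<open>auto simp: C1_diffeos_def\<close>)
    have "inv_into ?I ?c x = inv_into ?I g (inv_into ?I f x)" if "x \<in> ?I" for x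
    proof (rule inv_into_f_eq)
      show "inj_on ?c ?I" using cB by (auto simp: Bij_def bij_betw_def)
      have 1: "inv_into ?I f x \<in> ?I" using fiI that by blast
      then show 2: "inv_into ?I g (inv_into ?I f x) \<in> ?I" using giI by blast
      show "?c (inv_into ?I g (inv_into ?I f x)) = x"
        using c[OF 2] bij_betw_inv_into_right[OF bij(2) 1] bij_betw_inv_into_right[OF bij(1) that]
        by simp
    qed
    then have "C1_on ?I (inv_into ?I ?c)"
      using C1i C1_on_cong[of ?I "inv_into ?I ?c" "\<lambda>x. inv_into ?I g (inv_into ?I f x)"] by simp
    then have "?c \<in> ?H"
      using cB mono P C1 by (auto simp: C1_diffeos_def)
    then show "f \<otimes>\<^bsub>BijGroup ?I\<^esub> g \<in> ?H"
      using fB gB by (simp add: BijGroup_def)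
  qed
  then show ?thesis
    unfolding Diff_plus_def by (rule B.subgroup_imp_group)
qed

end

(* Let G be the group and let G_(i+1) be the common kernel of all homomorphisms from G_i to the
   integers.  By Milnor's argument each G_i is finitely generated.  Ping-pong shows that fixed
   intervals of elements do not cross; hence G_i acts on each component of the complement of its
   fixed point set with a translation number, and G_(i+1) has new fixed points in that component.
   A long series therefore gives a long chain of nested intervals, each much shorter than the
   previous one by the Hoelder condition, and a Kopell-type distortion argument produces a free
   semigroup.  So some G_n is trivial.

   Next let G act on the lattice L_i of homomorphisms from G_i to the integers.  Without free
   semigroups every g is annihilated, on each vector, by a polynomial with coefficients in
   {-1, 0, 1}, whose roots have modulus < 2.  If g is the identity modulo 4, then (g - 1)/4 is an
   integral operator with all eigenvalues of modulus < 3/4, so its powers tend to 0 and, being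
   integral, vanish.  The congruence subgroup modulo 4 thus acts unipotently on all L_i; it is
   soluble, so Kolchin's theorem makes it nilpotent. *)

theory Submission
  imports Defs "HOL-Computational_Algebra.Fundamental_Theorem_Algebra"
begin

section \<open>Groups and free sub-semigroups\<close>

text \<open>Below class C^2 the iterates of a map need not have bounded distortion on an interval
  with disjoint translates: the lengths of the translates are summable, but an \<alpha>-Hoelder
  derivative asks this of their \<alpha>-th powers. Depth makes up for the lost regularity. Each
  level of nesting raises the exponent by the factor 1 + \<alpha>, so the number of levels that can
  occur is bounded in terms of \<alpha> alone. The series is cut out by homomorphisms to the
  integers because Hoelder's theorem, which produces the new fixed points, only gives a homomorphism
  to the reals that is nonzero at some f; on a finitely generated group it can be made integral
  without vanishing at f. Finite generation also lets a single generator realise a whole gap and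
  makes the lattices L_i of finite rank. On these lattices no basis or matrix is chosen:
  homomorphisms are evaluated at group elements, and a relation between words in v g^(-1) and g^(-1)
  becomes a linear recurrence for the values at v of the iterated translates of a homomorphism.
  Eigenvalues enter only as roots of the polynomials of these recurrences.\<close>

class group_mult = monoid_mult + inverse +
  assumes linv: "inverse a * a = 1"
    and divide_gp: "divide a b = a * inverse b"
begin

lemma rinv: "a * inverse a = 1"
proof -
  have "a * inverse a = (inverse (inverse a) * inverse a) * (a * inverse a)"
    by (simp add: linv)
  also have "\<dots> = inverse (inverse a) * ((inverse a * a) * inverse a)"
    by (simp only: mult_assoc)
  finally show ?thesis by (simp add: linv)
qed

lemma linv_mult: "inverse a * (a * b) = b"
  using mult_assoc[of "inverse a" a b] by (simp add: linv)

lemma rinv_mult: "a * (inverse a * b) = b"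
  using mult_assoc[of a "inverse a" b] by (simp add: rinv)

lemma left_cancel: "a * b = a * c \<longleftrightarrow> b = c"
  by (metis linv_mult)

lemma right_cancel: "b * a = c * a \<longleftrightarrow> b = c"
  by (metis mult_assoc rinv mult_1_right)

lemma inv_unique: "a * b = 1 \<Longrightarrow> inverse a = b"
  by (metis linv_mult mult_1_right)

lemma inv_one: "inverse 1 = 1"
  by (rule inv_unique) simp

lemma inv_inv: "inverse (inverse a) = a"
  by (rule inv_unique) (rule linv)

lemma inv_mult: "inverse (a * b) = inverse b * inverse a"
  by (rule inv_unique) (simp add: mult_assoc rinv_mult rinv)

lemmas group_simps = mult_assoc linv rinv linv_mult rinv_mult inv_one inv_inv inv_mult

end

lemma powi_nat_gp: "(a :: 'a :: group_mult) powi (int n) = a ^ n"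
  by (simp add: power_int_def)

lemma inverse_power_gp: "inverse a ^ n = inverse ((a :: 'a :: group_mult) ^ n)"
  by (induction n) (simp_all add: inv_one inv_mult power_commutes[symmetric])

lemma powi_Suc_gp: "(a :: 'a :: group_mult) powi (k + 1) = a powi k * a"
proof (cases "k \<ge> 0")
  case True
  then have "nat (k + 1) = Suc (nat k)" by simp
  then show ?thesis using True by (simp add: power_int_def power_commutes del: power_Suc add: power_Suc2)
next
  case False
  then obtain n where k: "k = - int (Suc n)"
    by (metis linorder_not_le nonneg_int_cases nat_0_le not_less_eq_eq negD)
  then show ?thesis
    by (cases n) (simp_all add: power_int_def power_Suc2 group_simps inverse_power_gp[symmetric] nat_add_distrib del: power_Suc)
qed

lemma powi_pred_gp: "(a :: 'a :: group_mult) powi (k - 1) = a powi k * inverse a"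
  using powi_Suc_gp[of a "k - 1"] by (simp add: group_simps)

lemma powi_add_gp: "(a :: 'a :: group_mult) powi (j + k) = a powi j * a powi k"
proof (induction k rule: int_induct[of _ 0])
  case base
  show ?case by simp
next
  case (step1 i)
  have "a powi (j + (i + 1)) = a powi (j + i) * a"
    using powi_Suc_gp[of a "j + i"] by (simp only: add.assoc)
  then show ?case by (simp only: step1.IH powi_Suc_gp mult.assoc)
next
  case (step2 i)
  have "a powi (j + (i - 1)) = a powi (j + i) * inverse a"
    using powi_pred_gp[of a "j + i"] by (simp only: add_diff_eq)
  then show ?case by (simp only: step2.IH powi_pred_gp mult.assoc)
qed

lemma powi_minus_gp: "(a :: 'a :: group_mult) powi (- k) = inverse (a powi k)"
  by (rule inv_unique[symmetric]) (simp add: powi_add_gp[symmetric])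

definition subgp :: "'a :: group_mult set \<Rightarrow> bool"
  where "subgp A \<longleftrightarrow> 1 \<in> A \<and> (\<forall>a\<in>A. \<forall>b\<in>A. a * b \<in> A) \<and> (\<forall>a\<in>A. inverse a \<in> A)"

lemma subgpI:
  assumes "1 \<in> A" "\<And>a b. a \<in> A \<Longrightarrow> b \<in> A \<Longrightarrow> a * b \<in> A" "\<And>a. a \<in> A \<Longrightarrow> inverse a \<in> A"
  shows "subgp A"
  using assms by (auto simp: subgp_def)

lemma subgp_one: "subgp A \<Longrightarrow> 1 \<in> A"
  and subgp_mult: "subgp A \<Longrightarrow> a \<in> A \<Longrightarrow> b \<in> A \<Longrightarrow> a * b \<in> A"
  and subgp_inv: "subgp A \<Longrightarrow> a \<in> A \<Longrightarrow> inverse a \<in> A"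
  by (auto simp: subgp_def)

lemma subgp_power: "subgp A \<Longrightarrow> a \<in> A \<Longrightarrow> a ^ n \<in> A"
  by (induction n) (auto simp: subgp_one subgp_mult)

lemma subgp_powi: "subgp A \<Longrightarrow> a \<in> A \<Longrightarrow> a powi k \<in> A"
  by (simp add: power_int_def subgp_power subgp_inv)

lemmas subgp_closed = subgp_one subgp_mult subgp_inv subgp_power subgp_powi

inductive_set gen :: "'a :: group_mult set \<Rightarrow> 'a set" for S where
  gen_one: "1 \<in> gen S"
| gen_base: "s \<in> S \<Longrightarrow> s \<in> gen S"
| gen_mult: "a \<in> gen S \<Longrightarrow> b \<in> gen S \<Longrightarrow> a * b \<in> gen S"
| gen_inv: "a \<in> gen S \<Longrightarrow> inverse a \<in> gen S"

lemma subgp_gen: "subgp (gen S)"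
  by (rule subgpI) (auto intro: gen_one gen_mult gen_inv)

lemma gen_least: "subgp A \<Longrightarrow> S \<subseteq> A \<Longrightarrow> gen S \<subseteq> A"
proof
  fix x assume "subgp A" "S \<subseteq> A" "x \<in> gen S"
  from this(3,1,2) show "x \<in> A"
    by (induction rule: gen.induct) (auto simp: subgp_closed)
qed

lemma gen_mono: "S \<subseteq> T \<Longrightarrow> gen S \<subseteq> gen T"
  by (rule gen_least[OF subgp_gen]) (auto intro: gen_base)

definition fg :: "'a :: group_mult set \<Rightarrow> bool"
  where "fg A \<longleftrightarrow> (\<exists>S. finite S \<and> A = gen S)"

section \<open>Words in two letters\<close>

definition word :: "'a :: monoid_mult \<Rightarrow> 'a \<Rightarrow> bool list \<Rightarrow> 'a"
  where "word f g w = prod_list (map (\<lambda>e. if e then f else g) w)"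

definition nofree :: "'a :: group_mult set \<Rightarrow> bool"
  where "nofree A \<longleftrightarrow> (\<forall>f\<in>A. \<forall>g\<in>A. \<not> inj (word f g))"

lemma nofree_subset: "nofree A \<Longrightarrow> B \<subseteq> A \<Longrightarrow> nofree B"
  by (auto simp: nofree_def)

lemma word_simps [simp]:
  "word f g [] = 1" "word f g (e # w) = (if e then f else g) * word f g w"
  by (simp_all add: word_def)

text \<open>Cancelling the common prefix of two distinct words with the same value leaves two words
  with different first letters, or exhausts one of them and leaves a nonempty word with value
  1.\<close>

lemma not_inj_word_cases:
  fixes f g :: "'a :: group_mult"
  assumes "\<not> inj (word f g)"
  obtains (heads) u v where "word f g (True # u) = word f g (False # v)"
    | (unit) w where "w \<noteq> []" "word f g w = 1"
proof -
  obtain w w' where "w \<noteq> w'" "word f g w = word f g w'"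
    using assms by (auto simp: inj_def)
  then have "(\<exists>u v. word f g (True # u) = word f g (False # v)) \<or> (\<exists>w. w \<noteq> [] \<and> word f g w = 1)"
  proof (induction w arbitrary: w')
    case Nil
    then show ?case by (metis word_simps(1))
  next
    case (Cons e w)
    show ?case
    proof (cases w')
      case Nil
      then show ?thesis using Cons.prems by (metis word_simps(1))
    next
      case (Cons e' v)
      show ?thesis
      proof (cases "e = e'")
        case True
        then show ?thesis using Cons Cons.prems Cons.IH[of v] by (simp add: left_cancel)
      next
        case False
        have "word f g (e # w) = word f g (e' # v)" using Cons Cons.prems by simp
        then have "word f g (True # (if e then w else v)) = word f g (False # (if e then v else w))"
          using False by (cases e) auto
        then show ?thesis by blast
      qed
    qed
  qed
  then show ?thesis using heads unit by blast
qed

text \<open>Moving all powers of \<open>t\<close> to the right in a word in \<open>s * t\<close> and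
  \<open>t\<close> leaves this product, in increasing order of i, of the conjugates t^i s t^(-i)
  over the positions i, counted from 0, that carry \<open>True\<close>.\<close>

primrec conj_word :: "'a :: group_mult \<Rightarrow> 'a \<Rightarrow> bool list \<Rightarrow> 'a"
  where
    "conj_word s t [] = 1"
  | "conj_word s t (e # w) = (if e then s else 1) * (t * conj_word s t w * inverse t)"

lemma word_conj_word: "word (s * t) t w = conj_word s t w * t ^ length w"
  by (induction w) (auto simp: group_simps)

text \<open>The offset \<open>j\<close> serves the induction: the tail of a word read at position
  \<open>j\<close> is read at position \<open>j + 1\<close>. With \<open>j = 1\<close> the conjugate
  of index 0, which is \<open>s\<close> itself, does not occur.\<close>

lemma conj_word_in_gen:
  "t ^ j * conj_word s t w * inverse (t ^ j) \<in> gen ((\<lambda>k. t ^ k * s * inverse (t ^ k)) ` {j..<j + length w})"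
proof (induction w arbitrary: j)
  case Nil
  then show ?case by (simp add: group_simps gen_one)
next
  case (Cons e w)
  let ?x = "\<lambda>k. t ^ k * s * inverse (t ^ k)"
  have 1: "t ^ Suc j * conj_word s t w * inverse (t ^ Suc j) \<in> gen (?x ` {j..<j + length (e # w)})"
    by (rule subsetD[OF gen_mono Cons.IH[of "Suc j"]]) auto
  have 2: "?x j \<in> gen (?x ` {j..<j + length (e # w)})"
    by (rule gen_base) auto
  have "t ^ j * conj_word s t (e # w) * inverse (t ^ j)
      = (if e then ?x j else 1) * (t ^ Suc j * conj_word s t w * inverse (t ^ Suc j))"
    by (simp add: group_simps power_Suc2 del: power_Suc)
  then show ?case using gen_mult[OF 2 1] 1 by simp
qed

section \<open>Kernels of homomorphisms to the integers\<close>

definition hom_on :: "'a :: group_mult set \<Rightarrow> ('a \<Rightarrow> 'b :: ab_group_add) \<Rightarrow> bool"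
  where "hom_on A c \<longleftrightarrow> (\<forall>a\<in>A. \<forall>b\<in>A. c (a * b) = c a + c b)"

lemma hom_on_mult: "hom_on A c \<Longrightarrow> a \<in> A \<Longrightarrow> b \<in> A \<Longrightarrow> c (a * b) = c a + c b"
  by (simp add: hom_on_def)

lemma hom_on_one: "hom_on A c \<Longrightarrow> subgp A \<Longrightarrow> c 1 = 0"
  using hom_on_mult[of A c 1 1] by (simp add: subgp_one)

lemma hom_on_inv: "hom_on A c \<Longrightarrow> subgp A \<Longrightarrow> a \<in> A \<Longrightarrow> c (inverse a) = - c a"
  using hom_on_mult[of A c "inverse a" a] hom_on_one[of A c]
  by (simp add: subgp_inv linv eq_neg_iff_add_eq_0)

lemma hom_on_power:
  fixes c :: "'a :: group_mult \<Rightarrow> 'b :: comm_ring_1"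
  shows "hom_on A c \<Longrightarrow> subgp A \<Longrightarrow> a \<in> A \<Longrightarrow> c (a ^ n) = of_nat n * c a"
  by (induction n) (simp_all add: hom_on_one hom_on_mult subgp_power algebra_simps)

lemma hom_on_powi:
  fixes c :: "'a :: group_mult \<Rightarrow> 'b :: comm_ring_1"
  assumes "hom_on A c" "subgp A" "a \<in> A"
  shows "c (a powi k) = of_int k * c a"
  using assms by (auto simp: power_int_def hom_on_power hom_on_inv subgp_inv)

lemma hom_on_subset: "hom_on A c \<Longrightarrow> B \<subseteq> A \<Longrightarrow> hom_on B c"
  by (auto simp: hom_on_def)

lemma subgp_kernel: "subgp A \<Longrightarrow> hom_on A c \<Longrightarrow> subgp {a\<in>A. c a = 0}"
  by (auto intro!: subgpI simp: subgp_closed hom_on_one hom_on_mult hom_on_inv)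

text \<open>In an equality between two words in \<open>s * t\<close> and \<open>t\<close> that differ in their first letter, the
  letter \<open>s\<close> at the front can be solved for.\<close>

lemma milnor_relation:
  assumes A: "subgp A" "nofree A" and c: "hom_on A (c :: 'a :: group_mult \<Rightarrow> int)"
    and st: "s \<in> A" "t \<in> A" "c s = 0" "c t \<noteq> 0"
  obtains m where "s \<in> gen ((\<lambda>k. t ^ k * s * inverse (t ^ k)) ` {1..<Suc m})"
proof -
  have st': "s * t \<in> A" by (simp add: A st subgp_closed)
  \<comment> \<open>Both letters have the value \<open>c t\<close>, since \<open>s\<close> lies in
    the kernel. So \<open>c\<close> counts letters: equal words have equal length, and no nonempty
    word is 1.\<close>
  have W: "word (s * t) t w \<in> A \<and> c (word (s * t) t w) = length w * c t" for w
    using A c st by (induction w) (auto simp: subgp_closed hom_on_mult hom_on_one algebra_simps)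
  have "\<not> inj (word (s * t) t)" using A(2) st' st by (auto simp: nofree_def)
  then show ?thesis
  proof (cases rule: not_inj_word_cases)
    case (heads u v)
    have "length u = length v"
      using W[of "True # u"] W[of "False # v"] heads st(4) by (simp del: word_simps)
    let ?r = "\<lambda>w. t ^ 1 * conj_word s t w * inverse (t ^ 1)"
    have "s * (t * conj_word s t u * inverse t) * t ^ Suc (length v)
        = t * conj_word s t v * inverse t * t ^ Suc (length v)"
      using heads unfolding word_conj_word by (simp add: \<open>length u = length v\<close> del: power_Suc)
    then have "s * ?r u = ?r v" by (simp add: right_cancel del: power_Suc)
    then have eq: "?r v * inverse (?r u) = s" by (metis mult.assoc rinv mult_1_right)
    let ?G = "gen ((\<lambda>k. t ^ k * s * inverse (t ^ k)) ` {1..<Suc (length u)})"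
    have "?r u \<in> ?G" "?r v \<in> ?G"
      using conj_word_in_gen[of t 1 s u] conj_word_in_gen[of t 1 s v] \<open>length u = length v\<close>
      by (simp_all only: plus_1_eq_Suc)
    from gen_mult[OF this(2) gen_inv[OF this(1)]] have "s \<in> ?G" unfolding eq .
    then show ?thesis by (rule that)
  next
    case (unit w)
    then show ?thesis using W[of w] hom_on_one[OF c A(1)] st(4) by simp
  qed
qed

lemma conj_power_mult: "t * (t ^ k * s * inverse (t ^ k)) * inverse t = t ^ Suc k * s * inverse ((t :: 'a :: group_mult) ^ Suc k)"
  by (simp add: group_simps)

lemma gen_conj:
  assumes "\<And>s. s \<in> S \<Longrightarrow> t * s * inverse t \<in> gen T" "x \<in> gen S"
  shows "t * x * inverse t \<in> gen T"
  using assms(2)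
proof (induction rule: gen.induct)
  case gen_one
  then show ?case by (simp add: group_simps gen.gen_one)
next
  case (gen_base s)
  then show ?case by (rule assms(1))
next
  case (gen_mult a b)
  have "t * (a * b) * inverse t = (t * a * inverse t) * (t * b * inverse t)"
    by (simp add: group_simps)
  then show ?case using gen_mult by (simp add: gen.gen_mult)
next
  case (gen_inv a)
  have "t * inverse a * inverse t = inverse (t * a * inverse t)"
    by (simp add: group_simps)
  then show ?case using gen_inv by (simp add: gen.gen_inv)
qed

text \<open>Let x_k = t^k s t^(-k). Milnor's relation for \<open>t\<close> expresses x_0 by x_1,
  ..., x_m, and the one for \<open>inverse t\<close> expresses it by x_(-1), ..., x_(-n).
  Conjugating these by t^(-1) and by t^(m+n+1) expresses the two neighbours x_(-1) and x_(m+n+1) of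
  \<open>T\<close> = {x_0, ..., x_(m+n)} by members of \<open>T\<close>.\<close>

lemma milnor_normalized:
  assumes A: "subgp A" "nofree A" and c: "hom_on A (c :: 'a :: group_mult \<Rightarrow> int)"
    and st: "s \<in> A" "t \<in> A" "c s = 0" "c t \<noteq> 0"
  obtains T where "finite T" "s \<in> T" "T \<subseteq> {a\<in>A. c a = 0}"
    "\<And>x. x \<in> T \<Longrightarrow> t * x * inverse t \<in> gen T" "\<And>x. x \<in> T \<Longrightarrow> inverse t * x * t \<in> gen T"
proof -
  let ?x = "\<lambda>t k. t ^ k * s * inverse (t ^ k)"
  obtain m where m: "s \<in> gen (?x t ` {1..<Suc m})"
    using milnor_relation[OF A c st] .
  have "inverse t \<in> A" "c (inverse t) \<noteq> 0"
    using st A c by (simp_all add: subgp_closed hom_on_inv)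
  then obtain n where n: "s \<in> gen (?x (inverse t) ` {1..<Suc n})"
    using milnor_relation[OF A c st(1) _ st(3)] by blast
  let ?N = "m + n"
  let ?T = "?x t ` {0..?N}"
  have ker: "?T \<subseteq> {a\<in>A. c a = 0}"
    using A c st by (auto simp: subgp_closed hom_on_mult hom_on_inv)
  have up: "t * x * inverse t \<in> gen ?T" if x: "x \<in> ?T" for x
  proof -
    obtain k where k: "k \<le> ?N" "x = ?x t k" using x by auto
    show ?thesis
    proof (cases "k < ?N")
      case True
      then show ?thesis unfolding k(2) conj_power_mult by (intro gen_base imageI) auto
    next
      case False
      then have kN: "k = ?N" using k by simp
      have "t ^ Suc ?N * s * inverse (t ^ Suc ?N) \<in> gen ?T"
      proof (rule gen_conj[OF _ n])
        fix y assume "y \<in> ?x (inverse t) ` {1..<Suc n}"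
        then obtain j where j: "1 \<le> j" "j \<le> n" "y = ?x (inverse t) j" by auto
        have "t ^ Suc ?N = t ^ (Suc ?N - j) * t ^ j"
          using j by (simp add: power_add[symmetric] del: power_Suc)
        then have "t ^ Suc ?N * y * inverse (t ^ Suc ?N) = ?x t (Suc ?N - j)"
          by (simp add: j(3) inverse_power_gp group_simps del: power_Suc)
        then show "t ^ Suc ?N * y * inverse (t ^ Suc ?N) \<in> gen ?T"
          using j by (auto intro!: gen_base)
      qed
      then show ?thesis unfolding k(2) conj_power_mult kN .
    qed
  qed
  have down: "inverse t * x * t \<in> gen ?T" if x: "x \<in> ?T" for x
  proof -
    obtain k where k: "k \<le> ?N" "x = ?x t k" using x by auto
    show ?thesis
    proof (cases k)
      case (Suc k')
      then have "inverse t * x * t = ?x t k'" by (simp add: k(2) group_simps)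
      then show ?thesis using k Suc by (auto intro!: gen_base)
    next
      case 0
      have "inverse t * s * inverse (inverse t) \<in> gen ?T"
      proof (rule gen_conj[OF _ m])
        fix y assume "y \<in> ?x t ` {1..<Suc m}"
        then obtain j where j: "1 \<le> j" "j \<le> m" "y = ?x t j" by auto
        then obtain j' where j': "j = Suc j'" by (cases j) auto
        have "inverse t * y * inverse (inverse t) = ?x t j'" by (simp add: j(3) j' group_simps)
        then show "inverse t * y * inverse (inverse t) \<in> gen ?T"
          using j j' by (auto intro!: gen_base)
      qed
      then show ?thesis using k 0 by (simp add: group_simps)
    qed
  qed
  show ?thesis
    by (rule that[of ?T]) (use ker up down in \<open>auto simp: group_simps intro!: image_eqI[of _ _ 0]\<close>)
qed

text \<open>An element \<open>t\<close> with the least positive value divides all values, so each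
  generator \<open>s\<close> splits as \<open>r s\<close> in the kernel times a power of
  \<open>t\<close>. Milnor's argument yields a finitely generated \<open>Y\<close> in the kernel
  that contains all \<open>r s\<close> and is normalised by \<open>t\<close>. The products y t^k
  then form a subgroup containing the generators, so they exhaust \<open>A\<close>, and those in the
  kernel have k = 0.\<close>

lemma kernel_fg:
  assumes A: "fg A" "nofree A" and c: "hom_on A (c :: 'a :: group_mult \<Rightarrow> int)"
  shows "fg {a\<in>A. c a = 0}"
proof (cases "\<forall>a\<in>A. c a = 0")
  case True
  then have "{a\<in>A. c a = 0} = A" by auto
  then show ?thesis using A by simp
next
  case False
  obtain S where S: "finite S" "A = gen S" using A by (auto simp: fg_def)
  then have sA: "subgp A" by (simp add: subgp_gen)
  obtain a where a: "a \<in> A" "c a \<noteq> 0" using False by auto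
  have "\<exists>t\<in>A. c t > 0"
  proof (cases "c a > 0")
    case False
    then have "c (inverse a) > 0" using hom_on_inv[OF c sA a(1)] a(2) by simp
    then show ?thesis using subgp_inv[OF sA a(1)] by blast
  qed (use a in blast)
  then obtain t where t: "t \<in> A" "c t > 0" and tmin: "\<And>b. b \<in> A \<Longrightarrow> c b > 0 \<Longrightarrow> c t \<le> c b"
    using ex_has_least_nat[of "\<lambda>b. b \<in> A \<and> c b > 0" _ "\<lambda>b. nat (c b)"]
    by (metis nat_le_eq_zle)
  have dvd: "c t dvd c b" if "b \<in> A" for b
  proof (rule ccontr)
    assume n: "\<not> c t dvd c b"
    let ?d = "b * t powi (- (c b div c t))"
    have "c ?d = c b mod c t"
      using that t c sA by (simp add: hom_on_mult subgp_powi hom_on_powi minus_div_mult_eq_mod)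
    moreover have "?d \<in> A" using that t sA by (simp add: subgp_closed)
    moreover have "0 < c b mod c t" "c b mod c t < c t"
      using n t pos_mod_sign[of "c t" "c b"] by (auto simp: dvd_eq_mod_eq_0 simp del: pos_mod_sign)
    ultimately show False using tmin[of ?d] by simp
  qed
  define r where "r s = s * t powi (- (c s div c t))" for s
  have r: "r s \<in> A" "c (r s) = 0" if "s \<in> A" for s
    using that t c sA dvd[OF that]
    by (simp_all add: r_def hom_on_mult subgp_powi hom_on_powi subgp_mult)
  have SA: "S \<subseteq> A" using S gen_base by blast
  let ?P = "\<lambda>s T. finite T \<and> r s \<in> T \<and> T \<subseteq> {a\<in>A. c a = 0} \<and>
    (\<forall>x\<in>T. t * x * inverse t \<in> gen T) \<and> (\<forall>x\<in>T. inverse t * x * t \<in> gen T)"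
  have "\<forall>s\<in>S. \<exists>T. ?P s T"
  proof
    fix s assume "s \<in> S"
    then have s: "r s \<in> A" "c (r s) = 0" "c t \<noteq> 0" using r[of s] SA t(2) by auto
    show "\<exists>T. ?P s T"
    proof (rule milnor_normalized[OF sA A(2) c s(1) t(1) s(2,3)])
      fix T assume "finite T" "r s \<in> T" "T \<subseteq> {a\<in>A. c a = 0}"
        "\<And>x. x \<in> T \<Longrightarrow> t * x * inverse t \<in> gen T" "\<And>x. x \<in> T \<Longrightarrow> inverse t * x * t \<in> gen T"
      then show ?thesis by (intro exI[of _ T]) simp
    qed
  qed
  then obtain T where "\<forall>s\<in>S. ?P s (T s)" by (rule bchoice[THEN exE])
  then have T: "\<And>s. s \<in> S \<Longrightarrow> finite (T s)" "\<And>s. s \<in> S \<Longrightarrow> r s \<in> T s"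
    "\<And>s. s \<in> S \<Longrightarrow> T s \<subseteq> {a\<in>A. c a = 0}"
    "\<And>s x. s \<in> S \<Longrightarrow> x \<in> T s \<Longrightarrow> t * x * inverse t \<in> gen (T s)"
    "\<And>s x. s \<in> S \<Longrightarrow> x \<in> T s \<Longrightarrow> inverse t * x * t \<in> gen (T s)"
    by simp_all
  define Y where "Y = gen (\<Union>s\<in>S. T s)"
  have sY: "subgp Y" by (simp add: Y_def subgp_gen)
  have TY: "gen (T s) \<subseteq> Y" if "s \<in> S" for s
    unfolding Y_def using that by (intro gen_mono) auto
  have up: "t * x * inverse t \<in> Y" if "x \<in> Y" for x
    unfolding Y_def
  proof (rule gen_conj[OF _ that[unfolded Y_def]])
    fix s assume "s \<in> (\<Union>s\<in>S. T s)"
    then show "t * s * inverse t \<in> gen (\<Union>s\<in>S. T s)"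
      using T(4) TY unfolding Y_def by blast
  qed
  have down: "inverse t * x * inverse (inverse t) \<in> Y" if "x \<in> Y" for x
    unfolding Y_def
  proof (rule gen_conj[OF _ that[unfolded Y_def]])
    fix s assume "s \<in> (\<Union>s\<in>S. T s)"
    then show "inverse t * s * inverse (inverse t) \<in> gen (\<Union>s\<in>S. T s)"
      using T(5) TY unfolding Y_def inv_inv by blast
  qed
  have conj: "t powi k * x * inverse (t powi k) \<in> Y" if "x \<in> Y" for x k
    using that
  proof (induction k rule: int_induct[of _ 0])
    case base
    then show ?case by (simp add: group_simps)
  next
    case (step1 i)
    then show ?case using up[of "t powi i * x * inverse (t powi i)"] powi_add_gp[of t 1 i]
      by (simp add: group_simps add.commute)
  next
    case (step2 i)
    then show ?case using down[of "t powi i * x * inverse (t powi i)"] powi_add_gp[of t "-1" i]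
      by (simp add: group_simps)
  qed
  let ?B = "{y * t powi k | y k. y \<in> Y}"
  have "subgp ?B"
  proof (rule subgpI)
    have "1 = 1 * t powi 0" by simp
    then show "1 \<in> ?B" using subgp_one[OF sY] by blast
  next
    fix a b assume "a \<in> ?B" "b \<in> ?B"
    then obtain y k z j where yz: "y \<in> Y" "z \<in> Y" "a = y * t powi k" "b = z * t powi j" by auto
    have "a * b = (y * (t powi k * z * inverse (t powi k))) * t powi (k + j)"
      by (simp add: yz powi_add_gp group_simps)
    moreover have "y * (t powi k * z * inverse (t powi k)) \<in> Y"
      by (simp add: yz conj subgp_mult[OF sY])
    ultimately show "a * b \<in> ?B" by blast
  next
    fix a assume "a \<in> ?B"
    then obtain y k where y: "y \<in> Y" "a = y * t powi k" by auto
    have "inverse a = (t powi (- k) * inverse y * inverse (t powi (- k))) * t powi (- k)"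
      by (simp add: y powi_minus_gp group_simps)
    moreover have "t powi (- k) * inverse y * inverse (t powi (- k)) \<in> Y"
      by (simp add: y conj subgp_inv[OF sY])
    ultimately show "inverse a \<in> ?B" by blast
  qed
  moreover have "S \<subseteq> ?B"
  proof
    fix s assume s: "s \<in> S"
    have "s = r s * t powi (c s div c t)" by (simp add: r_def powi_minus_gp group_simps)
    moreover have "r s \<in> Y" using T(2)[OF s] TY[OF s] gen_base by blast
    ultimately show "s \<in> ?B" by blast
  qed
  ultimately have AB: "A \<subseteq> ?B" unfolding S(2) by (rule gen_least)
  have YK: "Y \<subseteq> {a\<in>A. c a = 0}"
    unfolding Y_def by (rule gen_least[OF subgp_kernel[OF sA c]]) (use T(3) in blast)
  have "{a\<in>A. c a = 0} \<subseteq> Y"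
  proof
    fix a assume a: "a \<in> {a\<in>A. c a = 0}"
    then obtain y k where y: "y \<in> Y" "a = y * t powi k" using AB by blast
    then have "c a = c y + k * c t"
      using YK t sA c by (simp add: hom_on_mult subgp_powi hom_on_powi subset_iff)
    then have "k = 0" using a y YK t(2) by auto
    then show "a \<in> Y" using y by simp
  qed
  with YK have "{a\<in>A. c a = 0} = Y" by auto
  moreover have "finite (\<Union>s\<in>S. T s)" using S T by auto
  ultimately show ?thesis by (auto simp: fg_def Y_def)
qed

section \<open>The residual series\<close>

text \<open>The value 0 outside \<open>A\<close> makes each homomorphism on \<open>A\<close> a
  unique function, so that equations in \<open>homZ A\<close> are equations of functions.\<close>

definition homZ :: "'a :: group_mult set \<Rightarrow> ('a \<Rightarrow> int) set"
  where "homZ A = {c. hom_on A c \<and> (\<forall>a. a \<notin> A \<longrightarrow> c a = 0)}"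

lemma homZ_hom: "c \<in> homZ A \<Longrightarrow> hom_on A c"
  by (simp add: homZ_def)

lemma homZ_outside: "c \<in> homZ A \<Longrightarrow> a \<notin> A \<Longrightarrow> c a = 0"
  by (simp add: homZ_def)

definition zmodule :: "('a \<Rightarrow> int) set \<Rightarrow> bool"
  where "zmodule V \<longleftrightarrow> (\<lambda>_. 0) \<in> V \<and> (\<forall>c\<in>V. \<forall>d\<in>V. \<forall>m n. (\<lambda>a. m * c a + n * d a) \<in> V)"

lemma zmodule_comb: "zmodule V \<Longrightarrow> c \<in> V \<Longrightarrow> d \<in> V \<Longrightarrow> (\<lambda>a. m * c a + n * d a) \<in> V"
  by (simp add: zmodule_def)

lemma zmodule_zero: "zmodule V \<Longrightarrow> (\<lambda>_. 0) \<in> V"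
  by (simp add: zmodule_def)

lemma zmodule_diff: "zmodule V \<Longrightarrow> c \<in> V \<Longrightarrow> d \<in> V \<Longrightarrow> (\<lambda>a. c a - d a) \<in> V"
  using zmodule_comb[of V c d 1 "-1"] by simp

lemma zmodule_add: "zmodule V \<Longrightarrow> c \<in> V \<Longrightarrow> d \<in> V \<Longrightarrow> (\<lambda>a. c a + d a) \<in> V"
  using zmodule_comb[of V c d 1 1] by simp

lemma zmodule_scale: "zmodule V \<Longrightarrow> c \<in> V \<Longrightarrow> (\<lambda>a. m * c a) \<in> V"
  using zmodule_comb[of V c c m 0] by simp

lemma zmodule_homZ: "zmodule (homZ A)"
  unfolding zmodule_def homZ_def hom_on_def by (auto simp: algebra_simps)

lemma homZ_eq_zero:
  assumes "c \<in> homZ (gen S)" "\<And>s. s \<in> S \<Longrightarrow> c s = 0"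
  shows "c = (\<lambda>_. 0)"
proof
  fix a
  show "c a = 0"
  proof (cases "a \<in> gen S")
    case True
    have "gen S \<subseteq> {a \<in> gen S. c a = 0}"
      by (rule gen_least[OF subgp_kernel[OF subgp_gen homZ_hom[OF assms(1)]]])
        (use assms(2) gen_base in auto)
    then show ?thesis using True by blast
  qed (use homZ_outside[OF assms(1)] in blast)
qed

text \<open>Evaluation at \<open>S\<close> embeds \<open>V\<close> into a lattice of finite rank,
  and the induction splits off one coordinate. As only common zeros matter, any \<open>d\<close>
  with \<open>d s\<close> nonzero may be kept: the cross-multiplied combination of \<open>c\<close>
  and \<open>d\<close> vanishes at \<open>s\<close>.\<close>

lemma finite_defining_forms:
  assumes "finite S" "zmodule V" "\<And>c. c \<in> V \<Longrightarrow> (\<And>s. s \<in> S \<Longrightarrow> c s = 0) \<Longrightarrow> c = (\<lambda>_. 0)"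
  shows "\<exists>C. finite C \<and> C \<subseteq> V \<and> (\<forall>a. (\<forall>c\<in>C. c a = 0) \<longrightarrow> (\<forall>c\<in>V. c a = 0))"
  using assms
proof (induction S arbitrary: V rule: finite_induct)
  case empty
  have "c = (\<lambda>_. 0)" if "c \<in> V" for c using empty(2)[OF that] by simp
  then show ?case by (intro exI[of _ "{}"]) auto
next
  case (insert s S)
  let ?V0 = "{c\<in>V. c s = 0}"
  have "zmodule ?V0" using insert.prems(1) by (auto simp: zmodule_def)
  moreover have "c = (\<lambda>_. 0)" if "c \<in> ?V0" "\<And>x. x \<in> S \<Longrightarrow> c x = 0" for c
    using insert.prems(2)[of c] that by blast
  ultimately have "\<exists>C. finite C \<and> C \<subseteq> ?V0 \<and> (\<forall>a. (\<forall>c\<in>C. c a = 0) \<longrightarrow> (\<forall>c\<in>?V0. c a = 0))"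
    by (rule insert.IH)
  then obtain C where C: "finite C" "C \<subseteq> ?V0" "\<forall>a. (\<forall>c\<in>C. c a = 0) \<longrightarrow> (\<forall>c\<in>?V0. c a = 0)"
    by (elim exE conjE)
  show ?case
  proof (cases "\<forall>c\<in>V. c s = 0")
    case True
    then have "?V0 = V" by auto
    then show ?thesis using C by (intro exI[of _ C]) auto
  next
    case False
    then obtain d where d: "d \<in> V" "d s \<noteq> 0" by auto
    have "c a = 0" if "\<forall>e\<in>insert d C. e a = 0" "c \<in> V" for a c
    proof -
      have "(\<lambda>a. d s * c a + (- c s) * d a) \<in> V"
        by (rule zmodule_comb[OF insert.prems(1) that(2) d(1)])
      then have "(\<lambda>a. d s * c a + (- c s) * d a) \<in> ?V0" by simp
      moreover have "\<forall>e\<in>C. e a = 0" using that(1) by simp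
      ultimately have "d s * c a + (- c s) * d a = 0" using C(3) by fast
      then show ?thesis using d(2) that(1) by simp
    qed
    then have "\<forall>a. (\<forall>e\<in>insert d C. e a = 0) \<longrightarrow> (\<forall>c\<in>V. c a = 0)" by blast
    moreover have "finite (insert d C)" "insert d C \<subseteq> V" using C(1,2) d(1) by auto
    ultimately show ?thesis by blast
  qed
qed

text \<open>For finitely generated \<open>A\<close> this is the preimage of the torsion subgroup of
  the abelianisation, so \<open>A\<close> modulo \<open>res A\<close> is free abelian of finite
  rank.\<close>

definition res :: "'a :: group_mult set \<Rightarrow> 'a set"
  where "res A = {a\<in>A. \<forall>c\<in>homZ A. c a = 0}"

lemma res_subset: "res A \<subseteq> A"
  by (auto simp: res_def)

lemma subgp_res: "subgp A \<Longrightarrow> subgp (res A)"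
  unfolding res_def
  by (auto intro!: subgpI simp: subgp_closed hom_on_one[OF homZ_hom] hom_on_mult[OF homZ_hom] hom_on_inv[OF homZ_hom])

lemma kernels_fg:
  assumes "finite C" "fg A" "nofree A" "\<And>c. c \<in> C \<Longrightarrow> hom_on A (c :: 'a :: group_mult \<Rightarrow> int)"
  shows "fg {a\<in>A. \<forall>c\<in>C. c a = 0}"
  using assms
proof (induction C rule: finite_induct)
  case empty
  then show ?case by simp
next
  case (insert c C)
  let ?B = "{a\<in>A. \<forall>c\<in>C. c a = 0}"
  have "fg {a\<in>?B. c a = 0}"
    by (rule kernel_fg) (use insert in \<open>auto intro: nofree_subset[of A] hom_on_subset[of A]\<close>)
  moreover have "{a\<in>?B. c a = 0} = {a\<in>A. \<forall>c\<in>insert c C. c a = 0}" by auto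
  ultimately show ?case by simp
qed

lemma fg_res:
  assumes "fg A" "nofree A"
  shows "fg (res A)"
proof -
  obtain S where S: "finite S" "A = gen S" using assms by (auto simp: fg_def)
  have "\<exists>C. finite C \<and> C \<subseteq> homZ A \<and> (\<forall>a. (\<forall>c\<in>C. c a = 0) \<longrightarrow> (\<forall>c\<in>homZ A. c a = 0))"
    by (rule finite_defining_forms[OF S(1) zmodule_homZ]) (use homZ_eq_zero S(2) in auto)
  then obtain C where C: "finite C" "C \<subseteq> homZ A" "\<forall>a. (\<forall>c\<in>C. c a = 0) \<longrightarrow> (\<forall>c\<in>homZ A. c a = 0)"
    by (elim exE conjE)
  have "res A = {a\<in>A. \<forall>c\<in>C. c a = 0}" using C by (auto simp: res_def)
  then show ?thesis using kernels_fg[OF C(1) assms] C(2) homZ_hom by force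
qed

lemma commutator_res:
  assumes "subgp A" "a \<in> A" "b \<in> A"
  shows "a * b * inverse a * inverse b \<in> res A"
  using assms by (auto simp: res_def subgp_closed hom_on_mult[OF homZ_hom] hom_on_inv[OF homZ_hom])

definition normalizes :: "'a :: group_mult set \<Rightarrow> 'a set \<Rightarrow> bool"
  where "normalizes G A \<longleftrightarrow> (\<forall>g\<in>G. \<forall>a\<in>A. g * a * inverse g \<in> A)"

lemma normalizesD: "normalizes G A \<Longrightarrow> g \<in> G \<Longrightarrow> a \<in> A \<Longrightarrow> g * a * inverse g \<in> A"
  by (simp add: normalizes_def)

lemma normalizes_iff:
  assumes "normalizes G A" "subgp G" "g \<in> G"
  shows "inverse g * a * g \<in> A \<longleftrightarrow> a \<in> A"
proof
  assume "inverse g * a * g \<in> A"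
  from normalizesD[OF assms(1,3) this] show "a \<in> A" by (simp add: group_simps)
next
  assume "a \<in> A"
  from normalizesD[OF assms(1) subgp_inv[OF assms(2,3)] this] show "inverse g * a * g \<in> A"
    by (simp add: group_simps)
qed

definition act :: "'a :: group_mult \<Rightarrow> ('a \<Rightarrow> 'b) \<Rightarrow> 'a \<Rightarrow> 'b"
  where "act g c v = c (inverse g * v * g)"

lemma act_act: "act g (act h c) = act (g * h) c"
  by (simp add: act_def fun_eq_iff group_simps)

lemma act_one: "act 1 c = c"
  by (simp add: act_def fun_eq_iff group_simps)

lemma act_homZ:
  assumes "normalizes G A" "subgp G" "g \<in> G" "c \<in> homZ A"
  shows "act g c \<in> homZ A"
proof -
  have 1: "inverse g * a * g \<in> A \<longleftrightarrow> a \<in> A" for a by (rule normalizes_iff[OF assms(1-3)])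
  have "inverse g * (a * b) * g = (inverse g * a * g) * (inverse g * b * g)" for a b
    by (simp add: group_simps)
  then show ?thesis
    using assms(4) by (auto simp: homZ_def hom_on_def act_def 1)
qed

lemma normalizes_res:
  assumes "normalizes G A" "subgp G"
  shows "normalizes G (res A)"
  unfolding normalizes_def
proof (intro ballI)
  fix g a assume g: "g \<in> G" and a: "a \<in> res A"
  have "c (g * a * inverse g) = 0" if "c \<in> homZ A" for c
    using act_homZ[OF assms subgp_inv[OF assms(2) g] that] a
    by (auto simp: res_def act_def inv_inv)
  then show "g * a * inverse g \<in> res A"
    using a normalizesD[OF assms(1) g] by (auto simp: res_def)
qed

section \<open>Hoelder's theorem\<close>

text \<open>\<open>C\<close> consists of the elements that are at least 1 for a total preorder on
  \<open>A\<close> invariant under left and right multiplication. It is only a preorder: in the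
  application every element with a fixed point in the interval lies both in \<open>C\<close> and in
  its inverse. The Archimedean property refers to the single strictly positive
  \<open>f\<close>.\<close>

locale archimedean_cone =
  fixes A C :: "'a :: group_mult set" and f :: 'a
  assumes subgp: "subgp A" and cone_subset: "C \<subseteq> A"
    and cone_mult: "x \<in> C \<Longrightarrow> y \<in> C \<Longrightarrow> x * y \<in> C"
    and cone_conj: "g \<in> A \<Longrightarrow> x \<in> C \<Longrightarrow> g * x * inverse g \<in> C"
    and cone_total: "x \<in> A \<Longrightarrow> x \<in> C \<or> inverse x \<in> C"
    and unit: "f \<in> C" "inverse f \<notin> C"
    and archimedean: "g \<in> A \<Longrightarrow> \<exists>n. inverse g * f ^ n \<in> C"
begin

lemma unit_in: "f \<in> A"
  using unit cone_subset by blast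

definition le :: "'a \<Rightarrow> 'a \<Rightarrow> bool" (infix \<open>\<preceq>\<close> 50)
  where "g \<preceq> h \<longleftrightarrow> inverse g * h \<in> C"

lemma le_refl: "g \<preceq> g"
  using cone_total[of 1] subgp by (auto simp: le_def group_simps subgp_closed)

lemma le_trans: "g \<preceq> h \<Longrightarrow> h \<preceq> k \<Longrightarrow> g \<preceq> k"
  using cone_mult[of "inverse g * h" "inverse h * k"] by (simp add: le_def group_simps)

lemma le_total: "g \<in> A \<Longrightarrow> h \<in> A \<Longrightarrow> g \<preceq> h \<or> h \<preceq> g"
  using cone_total[of "inverse g * h"] subgp by (auto simp: le_def group_simps subgp_closed)

lemma le_left: "g \<preceq> h \<Longrightarrow> k * g \<preceq> k * h"
  by (simp add: le_def group_simps)

lemma le_right: "k \<in> A \<Longrightarrow> g \<preceq> h \<Longrightarrow> g * k \<preceq> h * k"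
  using cone_conj[of "inverse k" "inverse g * h"] subgp by (simp add: le_def group_simps subgp_closed)

lemma le_mult: "g \<preceq> h \<Longrightarrow> g' \<preceq> h' \<Longrightarrow> g' \<in> A \<Longrightarrow> g * g' \<preceq> h * h'"
  using le_trans[OF le_right le_left] by blast

lemma le_power_swap:
  assumes "g * h \<preceq> h * g" "g \<in> A" "h \<in> A"
  shows "g * h ^ n \<preceq> h ^ n * g" "g ^ n * h \<preceq> h * g ^ n"
proof (induction n)
  case 0
  { case 1 show ?case by (simp add: le_refl) }
  { case 2 show ?case by (simp add: le_refl) }
next
  case (Suc n)
  { case 1
    have "g * h * h ^ n \<preceq> h * g * h ^ n" by (rule le_right) (simp_all add: assms subgp subgp_power)
    moreover have "h * (g * h ^ n) \<preceq> h * (h ^ n * g)" by (rule le_left) (rule Suc)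
    ultimately show ?case using le_trans by (fastforce simp only: power_Suc mult.assoc) }
  { case 2
    have "g * (g ^ n * h) \<preceq> g * (h * g ^ n)" by (rule le_left) (rule Suc)
    moreover have "g * h * g ^ n \<preceq> h * g * g ^ n" by (rule le_right) (simp_all add: assms subgp subgp_power)
    ultimately show ?case using le_trans by (fastforce simp only: power_Suc mult.assoc) }
qed

text \<open>Hoelder's comparison: if \<open>g * h\<close> is below \<open>h * g\<close>, each
  interchange that moves an \<open>h\<close> to the left increases a product. Among the products of
  n letters \<open>g\<close> and n letters \<open>h\<close>, g^n h^n is therefore least and h^n g^n
  greatest. Both mixed powers are bounded so that the opposite case follows by renaming.\<close>

lemma power_mult_bounds:
  assumes "g * h \<preceq> h * g" and [simp]: "g \<in> A" "h \<in> A"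
  shows "g ^ n * h ^ n \<preceq> (g * h) ^ n" "(g * h) ^ n \<preceq> h ^ n * g ^ n"
    "g ^ n * h ^ n \<preceq> (h * g) ^ n" "(h * g) ^ n \<preceq> h ^ n * g ^ n"
proof (induction n)
  case 0
  { case 1 show ?case by (simp add: le_refl) }
  { case 2 show ?case by (simp add: le_refl) }
  { case 3 show ?case by (simp add: le_refl) }
  { case 4 show ?case by (simp add: le_refl) }
next
  case (Suc n)
  note [simp] = subgp subgp_power subgp_mult and swap = le_power_swap[OF assms]
  { case 1
    have "g * (g ^ n * h) * h ^ n \<preceq> g * (h * g ^ n) * h ^ n"
      by (rule le_right[OF _ le_left[OF swap(2)]]) simp
    moreover have "g * h * (g ^ n * h ^ n) \<preceq> g * h * (g * h) ^ n" by (rule le_left) (rule Suc)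
    ultimately show ?case using le_trans by (fastforce simp only: power_Suc mult.assoc) }
  { case 2
    have "g * h * (g * h) ^ n \<preceq> g * h * (h ^ n * g ^ n)" by (rule le_left) (rule Suc)
    moreover have "g * h ^ Suc n * g ^ n \<preceq> h ^ Suc n * g * g ^ n" by (rule le_right[OF _ swap(1)]) simp
    ultimately show ?case using le_trans by (fastforce simp only: power_Suc mult.assoc) }
  { case 3
    have "g ^ n * (g * h ^ n) * h \<preceq> g ^ n * (h ^ n * g) * h"
      by (rule le_right[OF _ le_left[OF swap(1)]]) simp
    moreover have "g ^ n * h ^ n * (g * h) \<preceq> (h * g) ^ n * (h * g)"
      by (rule le_mult[OF Suc(3) assms(1)]) simp
    ultimately show ?case using le_trans by (fastforce simp only: power_Suc2 mult.assoc) }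
  { case 4
    have "(h * g) ^ n * (h * g) \<preceq> h ^ n * g ^ n * (h * g)" by (rule le_right[OF _ Suc(4)]) simp
    moreover have "h ^ n * (g ^ n * h) * g \<preceq> h ^ n * (h * g ^ n) * g"
      by (rule le_right[OF _ le_left[OF swap(2)]]) simp
    ultimately show ?case using le_trans by (fastforce simp only: power_Suc2 mult.assoc) }
qed

lemma cone_power: "x \<in> C \<Longrightarrow> x ^ n \<in> C"
  using le_refl[of 1] by (induction n) (auto simp: le_def group_simps cone_mult)

lemma le_unit_powers: "f powi j \<preceq> f powi k \<longleftrightarrow> j \<le> k"
proof
  assume "j \<le> k"
  then have "inverse (f powi j) * f powi k = f ^ nat (k - j)"
    by (simp add: powi_minus_gp[symmetric] powi_add_gp[symmetric] powi_nat_gp[symmetric])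
  then show "f powi j \<preceq> f powi k" using cone_power[OF unit(1)] by (simp add: le_def)
next
  assume jk: "f powi j \<preceq> f powi k"
  show "j \<le> k"
  proof (rule ccontr)
    assume "\<not> j \<le> k"
    then have "inverse f = inverse (f powi j) * f powi k * f ^ nat (j - k - 1)"
      by (simp add: powi_minus_gp[symmetric] powi_add_gp[symmetric] powi_nat_gp[symmetric])
    then show False using jk cone_mult[OF _ cone_power[OF unit(1)]] unit(2) by (metis le_def)
  qed
qed

definition flr :: "'a \<Rightarrow> int"
  where "flr g = (SOME m. f powi m \<preceq> g \<and> \<not> f powi (m + 1) \<preceq> g)"

lemma le_flr:
  assumes g: "g \<in> A"
  shows "f powi j \<preceq> g \<longleftrightarrow> j \<le> flr g"
proof -
  obtain n where n: "inverse g * f ^ n \<in> C" using archimedean[OF g] by auto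
  obtain m where m: "g * f ^ m \<in> C"
    using archimedean[OF subgp_inv[OF subgp g]] by (auto simp: group_simps)
  \<comment> \<open>The bound for the inverse of \<open>g\<close> puts \<open>f ^ m\<close> on the
    right; conjugation moves it to the left, where the definition of the order wants it.\<close>
  have "f ^ m * (g * f ^ m) * inverse (f ^ m) \<in> C"
    by (rule cone_conj[OF _ m]) (simp add: subgp subgp_power unit_in)
  then have lo: "f powi (- int m) \<preceq> g"
    by (simp add: le_def powi_minus_gp powi_nat_gp group_simps)
  have hi: "g \<preceq> f powi (int n)" using n by (simp add: le_def powi_nat_gp)
  have "\<exists>k. f powi k \<preceq> g \<and> \<not> f powi (k + 1) \<preceq> g"
  proof (rule ccontr)
    assume "\<not> ?thesis"
    then have step: "f powi k \<preceq> g \<Longrightarrow> f powi (k + 1) \<preceq> g" for k by blast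
    have "f powi k \<preceq> g" if "- int m \<le> k" for k
      using that by (induction k rule: int_ge_induct) (simp_all add: lo step)
    from this[of "int n + 1"] have "f powi (int n + 1) \<preceq> f powi (int n)"
      using le_trans[OF _ hi] by simp
    then show False by (simp only: le_unit_powers)
  qed
  then have F: "f powi flr g \<preceq> g" "\<not> f powi (flr g + 1) \<preceq> g"
    unfolding flr_def by (metis (mono_tags, lifting) someI_ex)+
  show ?thesis
  proof
    assume "f powi j \<preceq> g"
    then show "j \<le> flr g"
      using F(2) le_trans[of "f powi (flr g + 1)" "f powi j" g] le_unit_powers[of "flr g + 1" j] by force
  next
    assume "j \<le> flr g"
    then show "f powi j \<preceq> g" using F(1) le_trans le_unit_powers by blast
  qed
qed

lemma flr_mono: "g \<in> A \<Longrightarrow> h \<in> A \<Longrightarrow> g \<preceq> h \<Longrightarrow> flr g \<le> flr h"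
  using le_flr[of g "flr g"] le_flr[of h "flr g"] le_trans by blast

lemma flr_unit_power: "flr (f powi k) = k"
proof -
  have "f powi k \<in> A" by (simp add: subgp subgp_powi unit_in)
  from le_flr[OF this] show ?thesis by (metis le_unit_powers order_antisym order_refl)
qed

lemma flr_mult:
  assumes [simp]: "g \<in> A" "h \<in> A"
  shows "flr g + flr h \<le> flr (g * h)" "flr (g * h) \<le> flr g + flr h + 2"
proof -
  note [simp] = subgp subgp_mult subgp_powi unit_in
  have "f powi flr g * f powi flr h \<preceq> g * h"
    by (rule le_mult) (simp_all add: le_flr)
  then show "flr g + flr h \<le> flr (g * h)" by (simp add: powi_add_gp[symmetric] le_flr)
  have "g \<preceq> f powi (flr g + 1)" "h \<preceq> f powi (flr h + 1)"
    using le_total[of "f powi (flr g + 1)" g] le_total[of "f powi (flr h + 1)" h] by (simp_all add: le_flr)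
  from le_mult[OF this] have "g * h \<preceq> f powi (flr g + flr h + 2)"
    by (simp add: powi_add_gp[symmetric] algebra_simps)
  from flr_mono[OF _ _ this] show "flr (g * h) \<le> flr g + flr h + 2" by (simp add: flr_unit_power)
qed

lemma flr_power_mult:
  assumes [simp]: "g \<in> A" "h \<in> A"
  shows "\<bar>flr ((g * h) ^ n) - flr (g ^ n) - flr (h ^ n)\<bar> \<le> 2"
proof -
  note [simp] = subgp subgp_mult subgp_power
  note fm = flr_mult[of "g ^ n" "h ^ n"] flr_mult[of "h ^ n" "g ^ n"]
  show ?thesis
  proof (cases "g * h \<preceq> h * g")
    case True
    note b = power_mult_bounds[OF True, of n]
    show ?thesis using flr_mono[OF _ _ b(1)] flr_mono[OF _ _ b(2)] fm by simp
  next
    case False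
    then have "h * g \<preceq> g * h" using le_total[of "g * h" "h * g"] by simp
    note b = power_mult_bounds[OF this, of n]
    show ?thesis using flr_mono[OF _ _ b(3)] flr_mono[OF _ _ b(4)] fm by simp
  qed
qed

text \<open>Restricting flr(g^n) / n to powers of 2 makes the sequence increasing for
  \<open>g\<close> in \<open>A\<close>: by \<open>flr_mult\<close>, squaring at least doubles
  \<open>flr\<close>.\<close>

definition avg :: "'a \<Rightarrow> nat \<Rightarrow> real"
  where "avg g k = flr (g ^ (2 ^ k)) / 2 ^ k"

lemma avg_convergent:
  assumes g: "g \<in> A"
  shows "convergent (avg g)"
proof -
  have s: "g ^ 2 ^ k \<in> A" for k by (simp add: subgp subgp_power g)
  have sq: "g ^ 2 ^ Suc k = g ^ 2 ^ k * g ^ 2 ^ k" for k by (simp add: power_add[symmetric] mult_2)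
  have lo: "2 * flr (g ^ 2 ^ k) \<le> flr (g ^ 2 ^ Suc k)"
    and hi: "flr (g ^ 2 ^ Suc k) \<le> 2 * flr (g ^ 2 ^ k) + 2" for k
    using flr_mult[OF s[of k] s[of k]] unfolding sq by simp_all
  have inc: "incseq (avg g)"
  proof (rule incseq_SucI)
    fix k
    have "2 * real_of_int (flr (g ^ 2 ^ k)) \<le> flr (g ^ 2 ^ Suc k)" using lo[of k] by linarith
    then show "avg g k \<le> avg g (Suc k)" by (simp add: avg_def field_simps)
  qed
  \<comment> \<open>Squaring raises twice the value of \<open>flr\<close> by at most 2, so adding 2
    / 2^k turns the averages into a decreasing sequence and bounds them.\<close>
  have "avg g k + 2 / 2 ^ k \<le> avg g 0 + 2" for k
  proof (induction k)
    case (Suc k)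
    have "real_of_int (flr (g ^ 2 ^ Suc k)) / 2 ^ Suc k \<le> (2 * flr (g ^ 2 ^ k) + 2) / 2 ^ Suc k"
      by (rule divide_right_mono) (use hi[of k] in linarith, simp)
    then have "avg g (Suc k) + 2 / 2 ^ Suc k \<le> avg g k + 2 / 2 ^ k"
      by (simp add: avg_def add_divide_distrib)
    then show ?case using Suc by simp
  qed simp
  moreover have "0 \<le> 2 / (2::real) ^ k" for k by simp
  ultimately have "avg g k \<le> avg g 0 + 2" for k by (meson add_increasing2 order_refl order_trans)
  then show ?thesis using incseq_convergent[OF inc] by (metis convergentI)
qed

text \<open>By \<open>flr_power_mult\<close> the averages are additive up to an error of at most 2 /
  2^k, so their limit is additive although \<open>g\<close> and \<open>h\<close> need not
  commute.\<close>

lemma translation_number: "\<exists>\<tau> :: 'a \<Rightarrow> real. hom_on A \<tau> \<and> \<tau> f = 1"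
proof (intro exI conjI)
  let ?\<tau> = "\<lambda>g. lim (avg g)"
  have lim: "avg g \<longlonglongrightarrow> ?\<tau> g" if "g \<in> A" for g
    using avg_convergent[OF that] by (simp add: convergent_LIMSEQ_iff)
  show "hom_on A ?\<tau>"
    unfolding hom_on_def
  proof (intro ballI)
    fix g h assume gh: "g \<in> A" "h \<in> A"
    have "(\<lambda>k. avg (g * h) k - avg g k - avg h k) \<longlonglongrightarrow> ?\<tau> (g * h) - ?\<tau> g - ?\<tau> h"
      by (intro tendsto_diff lim gh subgp_mult[OF subgp])
    moreover have "(\<lambda>k. avg (g * h) k - avg g k - avg h k) \<longlonglongrightarrow> 0"
    proof (rule Lim_null_comparison)
      show "(\<lambda>k. 2 * (1 / 2) ^ k :: real) \<longlonglongrightarrow> 0"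
        by (intro tendsto_mult_right_zero LIMSEQ_realpow_zero) auto
      have "norm (avg (g * h) k - avg g k - avg h k) \<le> 2 * (1 / 2) ^ k" for k
      proof -
        let ?d = "flr ((g * h) ^ 2 ^ k) - flr (g ^ 2 ^ k) - flr (h ^ 2 ^ k)"
        have "avg (g * h) k - avg g k - avg h k = real_of_int ?d / 2 ^ k"
          by (simp add: avg_def field_simps)
        then have "norm (avg (g * h) k - avg g k - avg h k) = real_of_int \<bar>?d\<bar> / 2 ^ k"
          by simp
        also have "\<dots> \<le> 2 / 2 ^ k"
          using flr_power_mult[OF gh, of "2 ^ k"] by (intro divide_right_mono) (linarith, simp)
        finally show ?thesis by (simp add: power_one_over)
      qed
      then show "\<forall>\<^sub>F k in sequentially. norm (avg (g * h) k - avg g k - avg h k) \<le> 2 * (1 / 2) ^ k"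
        by simp
    qed
    ultimately show "?\<tau> (g * h) = ?\<tau> g + ?\<tau> h"
      using LIMSEQ_unique by fastforce
  qed
  have "avg f = (\<lambda>k. 1)"
    using flr_unit_power[of "int (2 ^ k)" for k] by (simp add: avg_def fun_eq_iff powi_nat_gp del: of_nat_power)
  then show "?\<tau> f = 1" by simp
qed

end

text \<open>Obtained by extending 1 to a basis of the reals over the rationals. Composing a real
  homomorphism with it gives rational values and keeps the value 1.\<close>

lemma rational_functional:
  obtains \<phi> :: "real \<Rightarrow> rat" where "\<And>x y. \<phi> (x + y) = \<phi> x + \<phi> y" "\<phi> 1 = 1"
proof -
  interpret vector_space_pair "\<lambda>(q::rat) (x::real). of_rat q * x" "\<lambda>(q::rat) (x::rat). q * x"
    by unfold_locales (auto simp: algebra_simps of_rat_add of_rat_mult)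
  have "vs1.independent {1::real}"
    using vs1.independent_insert[of 1 "{}"] vs1.independent_empty by simp
  from linear_independent_extend[OF this, of "\<lambda>_. 1"] obtain g where
    g: "Vector_Spaces.linear (\<lambda>(q::rat) (x::real). of_rat q * x) (\<lambda>(q::rat) (x::rat). q * x) g" "g 1 = 1"
    by auto
  have "g (x + y) = g x + g y" for x y
    using g(1) unfolding Vector_Spaces.linear_def module_hom_def module_hom_axioms_def by blast
  then show ?thesis using that[of g] g(2) by simp
qed

text \<open>After composition with \<open>rational_functional\<close>, a common denominator
  \<open>D\<close> of the values at the finitely many generators clears denominators on all of
  \<open>A\<close>.\<close>

lemma real_hom_to_homZ:
  fixes \<tau> :: "'a :: group_mult \<Rightarrow> real"
  assumes "fg A" "hom_on A \<tau>" "f \<in> A" "\<tau> f = 1"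
  shows "\<exists>c\<in>homZ A. c f \<noteq> 0"
proof -
  obtain S where S: "finite S" "A = gen S" using assms by (auto simp: fg_def)
  obtain \<phi> :: "real \<Rightarrow> rat" where \<phi>: "\<And>x y. \<phi> (x + y) = \<phi> x + \<phi> y" "\<phi> 1 = 1"
    using rational_functional by blast
  define c where "c a = \<phi> (\<tau> a)" for a
  have c: "hom_on A c" using assms(2) by (simp add: hom_on_def c_def \<phi>(1))
  have "\<exists>D::int. D > 0 \<and> (\<forall>s\<in>S. of_int D * c s \<in> \<int>)"
    using S(1)
  proof (induction S rule: finite_induct)
    case empty
    show ?case by (intro exI[of _ 1]) simp
  next
    case (insert s S)
    then obtain D where D: "D > 0" "\<forall>s\<in>S. of_int D * c s \<in> \<int>" by auto
    obtain p q where pq: "quotient_of (c s) = (p, q)" by fastforce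
    then have q: "q > 0" "of_int q * c s \<in> \<int>"
      using quotient_of_denom_pos[OF pq] quotient_of_div[OF pq] by simp_all
    have "of_int (D * q) * c x = of_int q * (of_int D * c x)" "of_int (D * q) * c x = of_int D * (of_int q * c x)" for x
      by simp_all
    then have "of_int (D * q) * c x \<in> \<int>" if "x \<in> insert s S" for x
      using that D(2) q(2) by (metis Ints_mult Ints_of_int insertE)
    then show ?case using D(1) q(1) by (intro exI[of _ "D * q"]) simp
  qed
  then obtain D :: int where D: "D > 0" "\<And>s. s \<in> S \<Longrightarrow> of_int D * c s \<in> \<int>" by auto
  have int: "of_int D * c a \<in> \<int>" if "a \<in> A" for a
  proof -
    have "subgp {a\<in>A. of_int D * c a \<in> \<int>}"
      using c subgp_gen[of S] unfolding S(2)[symmetric]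
      by (auto intro!: subgpI simp: subgp_closed hom_on_mult hom_on_one hom_on_inv distrib_left)
    moreover have "S \<subseteq> {a\<in>A. of_int D * c a \<in> \<int>}" using D(2) S(2) gen_base by auto
    ultimately show ?thesis using gen_least that S(2) by blast
  qed
  define z where "z a = (if a \<in> A then \<lfloor>of_int D * c a\<rfloor> else 0)" for a
  have z: "rat_of_int (z a) = of_int D * c a" if "a \<in> A" for a
    using int[OF that] that by (auto simp: z_def elim!: Ints_cases)
  have "z \<in> homZ A"
    unfolding homZ_def hom_on_def
  proof (safe)
    fix a b assume ab: "a \<in> A" "b \<in> A"
    then have "a * b \<in> A" using S(2) by (simp add: gen_mult)
    then have "rat_of_int (z (a * b)) = rat_of_int (z a + z b)"
      using ab c by (simp add: z hom_on_mult distrib_left)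
    then show "z (a * b) = z a + z b" by (simp only: of_int_eq_iff)
  qed (simp add: z_def)
  moreover have "z f \<noteq> 0" using z[OF assms(3)] D(1) assms(4) by (auto simp: c_def \<phi>(2))
  ultimately show ?thesis by blast
qed

section \<open>Homeomorphisms of the line\<close>

text \<open>Maps of the interval are extended by the identity, so that composition and inversion need no
  side conditions.\<close>

typedef homeo = "{f :: real \<Rightarrow> real. bij f \<and> strict_mono f}"
  morphisms app Abs_homeo
  by (rule exI[of _ "\<lambda>x. x"]) (auto simp: strict_mono_def bij_id[unfolded id_def])

setup_lifting type_definition_homeo

lemma strict_mono_inv_bij:
  fixes f :: "real \<Rightarrow> real"
  assumes "bij f" "strict_mono f"
  shows "strict_mono (inv_into UNIV f)"
proof (rule strict_monoI)
  fix x y :: real assume "x < y"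
  then have "f (inv_into UNIV f x) < f (inv_into UNIV f y)"
    using assms(1) by (simp add: bij_is_surj surj_f_inv_f)
  then show "inv_into UNIV f x < inv_into UNIV f y"
    using assms(2) by (simp add: strict_mono_less)
qed

instantiation homeo :: group_mult
begin

lift_definition one_homeo :: homeo is "\<lambda>x. x"
  by (auto simp: strict_mono_def bij_id[unfolded id_def])

lift_definition times_homeo :: "homeo \<Rightarrow> homeo \<Rightarrow> homeo" is "\<lambda>f g x. f (g x)"
  by (auto simp: strict_mono_def bij_comp[unfolded o_def])

lift_definition inverse_homeo :: "homeo \<Rightarrow> homeo" is "inv_into UNIV"
  by (auto simp: bij_imp_bij_inv strict_mono_inv_bij)

definition "divide_homeo (f :: homeo) g = f * inverse g"

instance
proof
  fix f g h :: homeo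
  show "f * g * h = f * (g * h)" "1 * f = f" "f * 1 = f" by (transfer, simp)+
  show "inverse f * f = 1" by transfer (auto simp: bij_is_inj)
  show "divide f g = f * inverse g" by (rule divide_homeo_def)
qed

end

lemma app_one [simp]: "app 1 x = x"
  and app_mult [simp]: "app (f * g) x = app f (app g x)"
  by (transfer, simp)+

lemma app_inverse [simp]: "app (inverse f) (app f x) = x" "app f (app (inverse f) x) = x"
  by (simp_all add: app_mult[symmetric] linv rinv del: app_mult)

lemma app_less_iff [simp]: "app f x < app f y \<longleftrightarrow> x < y"
  by transfer (auto simp: strict_mono_less)

lemma app_le_iff [simp]: "app f x \<le> app f y \<longleftrightarrow> x \<le> y"
  by transfer (auto simp: strict_mono_less_eq)

lemma app_eq_iff [simp]: "app f x = app f y \<longleftrightarrow> x = y"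
  by transfer (auto simp: strict_mono_eq)

lemma app_mono: "x \<le> y \<Longrightarrow> app f x \<le> app f y"
  by simp

lemma app_less_inverse: "app f x < y \<longleftrightarrow> x < app (inverse f) y"
  by (metis app_inverse(2) app_less_iff)

lemma less_app_inverse: "y < app f x \<longleftrightarrow> app (inverse f) y < x"
  by (metis app_inverse(2) app_less_iff)

lemma app_inverse_eq: "app (inverse f) x = y \<longleftrightarrow> x = app f y"
  by (metis app_inverse)

lemma homeo_eqI: "(\<And>x. app f x = app g x) \<Longrightarrow> f = g"
  by (metis app_inject ext)

lemma continuous_app: "continuous_on UNIV (app f)"
proof (rule continuous_onI_mono)
  have "range (app f) = UNIV" by (metis app_inverse(2) surjI)
  then show "open (range (app f))" by simp
qed simp

lemma isCont_app: "isCont (app f) x"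
  using continuous_app[of f] by (simp add: continuous_on_eq_continuous_at)

section \<open>Common fixed points and gaps\<close>

definition fixp :: "homeo set \<Rightarrow> real \<Rightarrow> bool"
  where "fixp S x \<longleftrightarrow> (\<forall>s\<in>S. app s x = x)"

lemma fixp_gen: "fixp (gen S) x \<longleftrightarrow> fixp S x"
proof
  assume "fixp S x"
  have "app g x = x" if "g \<in> gen S" for g
    using that by (induction rule: gen.induct) (use \<open>fixp S x\<close> in \<open>auto simp: fixp_def app_inverse_eq\<close>)
  then show "fixp (gen S) x" by (simp add: fixp_def)
qed (auto simp: fixp_def intro: gen_base)

lemma closed_fixp: "closed {x. fixp S x}"
proof -
  have "{x. fixp S x} = (\<Inter>s\<in>S. {x. app s x = x})" by (auto simp: fixp_def)
  moreover have "closed {x. app s x = x}" for s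
    by (intro closed_Collect_eq continuous_app continuous_on_id)
  ultimately show ?thesis by (simp add: closed_INT)
qed

lemma fixp_image:
  assumes "normalizes G A" "g \<in> G" "subgp G"
  shows "fixp A (app g x) \<longleftrightarrow> fixp A x"
proof
  assume x: "fixp A x"
  have "app a (app g x) = app g x" if "a \<in> A" for a
  proof -
    have "inverse g * a * g \<in> A" using normalizes_iff[OF assms(1,3,2)] that by simp
    then have "app (inverse g * a * g) x = x" using x unfolding fixp_def by blast
    then show ?thesis by (simp add: app_inverse_eq)
  qed
  then show "fixp A (app g x)" by (simp add: fixp_def)
next
  assume x: "fixp A (app g x)"
  have "app a x = x" if "a \<in> A" for a
    using x normalizesD[OF assms(1,2) that] by (force simp: fixp_def)
  then show "fixp A x" by (simp add: fixp_def)
qed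

text \<open>The bounded components of the complement of the common fixed point set.\<close>

definition gap :: "homeo set \<Rightarrow> real \<Rightarrow> real \<Rightarrow> bool"
  where "gap S a b \<longleftrightarrow> a < b \<and> fixp S a \<and> fixp S b \<and> (\<forall>x. a < x \<and> x < b \<longrightarrow> \<not> fixp S x)"

lemma gap_gen: "gap (gen S) a b \<longleftrightarrow> gap S a b"
  by (simp add: gap_def fixp_gen)

lemma gap_exists:
  assumes "\<not> fixp S x" "fixp S l" "fixp S r" "l < x" "x < r"
  shows "\<exists>a b. gap S a b \<and> l \<le> a \<and> a < x \<and> x < b \<and> b \<le> r"
proof -
  let ?L = "{y. fixp S y} \<inter> {..x}" and ?R = "{y. fixp S y} \<inter> {x..}"
  have L: "?L \<noteq> {}" "bdd_above ?L" "closed ?L" and R: "?R \<noteq> {}" "bdd_below ?R" "closed ?R"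
    using assms closed_fixp[of S] by (auto intro: less_imp_le)
  have a: "Sup ?L \<in> ?L" and b: "Inf ?R \<in> ?R"
    using closed_contains_Sup[OF L] closed_contains_Inf[OF R] by auto
  have "Sup ?L < x" "x < Inf ?R" using a b assms(1) by (auto simp: order_less_le)
  moreover have "l \<le> Sup ?L" "Inf ?R \<le> r"
    using assms by (auto intro!: cSup_upper cInf_lower L R)
  moreover have "\<not> fixp S y" if "Sup ?L < y" "y < Inf ?R" for y
  proof
    assume y: "fixp S y"
    show False
    proof (cases "y \<le> x")
      case True
      then have "y \<le> Sup ?L" using y L by (intro cSup_upper) auto
      then show False using that by simp
    next
      case False
      then have "Inf ?R \<le> y" using y R by (intro cInf_lower) auto
      then show False using that by simp
    qed
  qed
  moreover have "fixp S (Sup ?L)" "fixp S (Inf ?R)" using a b by blast+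
  ultimately have "gap S (Sup ?L) (Inf ?R)" "l \<le> Sup ?L" "Sup ?L < x" "x < Inf ?R" "Inf ?R \<le> r"
    unfolding gap_def by (blast intro: less_trans)+
  then show ?thesis by blast
qed

lemma gap_unique:
  assumes "gap S a b" "gap S c d" "a < x" "x < b" "c < x" "x < d"
  shows "a = c" "b = d"
  using assms unfolding gap_def by (metis less_trans linorder_neqE_linordered_idom)+

lemma gap_image:
  assumes "normalizes G A" "g \<in> G" "subgp G" "gap A a b"
  shows "gap A (app g a) (app g b)"
  using assms(4) unfolding gap_def
  using fixp_image[OF assms(1-3)] by (metis app_inverse(2) app_less_iff)

lemma gap_inverse: "gap {f} a b \<Longrightarrow> gap {inverse f} a b"
  by (auto simp: gap_def fixp_def app_inverse_eq)

lemma gap_sign: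
  assumes "gap {f} a b"
  shows "(\<forall>x. a < x \<and> x < b \<longrightarrow> app f x < x) \<or> (\<forall>x. a < x \<and> x < b \<longrightarrow> x < app f x)"
proof (rule ccontr)
  assume "\<not> ?thesis"
  then obtain x y where xy: "a < x" "x < b" "x \<le> app f x" "a < y" "y < b" "app f y \<le> y"
    by (auto simp: not_less)
  have cont: "continuous_on S (\<lambda>x. app f x - x)" for S
    by (intro continuous_intros continuous_on_subset[OF continuous_app]) auto
  have "\<exists>z. min x y \<le> z \<and> z \<le> max x y \<and> app f z - z = 0"
    using IVT'[of "\<lambda>x. app f x - x" y 0 x] IVT2'[of "\<lambda>x. app f x - x" y 0 x] cont xy
    by (cases "x \<le> y") (auto simp: min_def max_def)
  then obtain z where "min x y \<le> z" "z \<le> max x y" "app f z = z" by auto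
  then show False using assms xy unfolding gap_def fixp_def by (auto simp: min_def max_def split: if_splits)
qed

lemma gap_oriented:
  assumes "gap {f} a b" "f \<in> A" "subgp A"
  shows "\<exists>h\<in>A. gap {h} a b \<and> (\<forall>x. a < x \<and> x < b \<longrightarrow> app h x < x)"
    and "\<exists>h\<in>A. gap {h} a b \<and> (\<forall>x. a < x \<and> x < b \<longrightarrow> x < app h x)"
proof -
  have "app (inverse f) a = a" "app (inverse f) b = b"
    using gap_inverse[OF assms(1)] by (simp_all add: gap_def fixp_def)
  then have pres: "a < app (inverse f) x \<and> app (inverse f) x < b" if "a < x" "x < b" for x
    using that by (metis app_less_iff)
  have inv: "inverse f \<in> A" "gap {inverse f} a b"
    using assms gap_inverse subgp_inv by blast+
  have "(\<forall>x. a < x \<and> x < b \<longrightarrow> app f x < x) \<Longrightarrow> (\<forall>x. a < x \<and> x < b \<longrightarrow> x < app (inverse f) x)"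
    and "(\<forall>x. a < x \<and> x < b \<longrightarrow> x < app f x) \<Longrightarrow> (\<forall>x. a < x \<and> x < b \<longrightarrow> app (inverse f) x < x)"
    using pres by (metis app_inverse(2))+
  then show "\<exists>h\<in>A. gap {h} a b \<and> (\<forall>x. a < x \<and> x < b \<longrightarrow> app h x < x)"
    and "\<exists>h\<in>A. gap {h} a b \<and> (\<forall>x. a < x \<and> x < b \<longrightarrow> x < app h x)"
    using gap_sign[OF assms(1)] assms(1,2) inv by blast+
qed

lemma gap_attract_left:
  assumes "gap {f} a b" "\<And>x. a < x \<Longrightarrow> x < b \<Longrightarrow> app f x < x" "a < c" "c < b" "a < y"
  shows "\<exists>n. app (f ^ n) c < y"
proof (rule ccontr)
  assume "\<not> ?thesis"
  then have ge: "y \<le> app (f ^ n) c" for n by (auto simp: not_less)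
  let ?u = "\<lambda>n. app (f ^ n) c"
  have u: "a < ?u n \<and> ?u n \<le> c" for n
  proof (induction n)
    case (Suc n)
    have "app f a = a" using assms(1) by (simp add: gap_def fixp_def)
    then have "app f (?u n) < ?u n" "a < app f (?u n)"
      using assms Suc app_less_iff[of f a "?u n"] by simp_all
    then show ?case using Suc by simp
  qed (use assms in simp)
  have dec: "decseq ?u"
  proof (rule decseq_SucI)
    fix n
    show "?u (Suc n) \<le> ?u n" using assms(2)[of "?u n"] u[of n] assms(4) by simp
  qed
  obtain L where L: "?u \<longlonglongrightarrow> L" using decseq_convergent[OF dec] ge by blast
  have "(\<lambda>n. app f (?u n)) \<longlonglongrightarrow> app f L" by (rule isCont_tendsto_compose[OF isCont_app L])
  moreover have "(\<lambda>n. app f (?u n)) \<longlonglongrightarrow> L" using LIMSEQ_Suc[OF L] by simp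
  ultimately have "app f L = L" by (rule LIMSEQ_unique)
  moreover have "y \<le> L" "L \<le> c"
    using LIMSEQ_le_const[OF L] LIMSEQ_le_const2[OF L] ge u by blast+
  ultimately show False using assms(2)[of L] assms(4,5) by simp
qed

lemma gap_attract_right:
  assumes "gap {f} a b" "\<And>x. a < x \<Longrightarrow> x < b \<Longrightarrow> x < app f x" "a < c" "c < b" "y < b"
  shows "\<exists>n. y < app (f ^ n) c"
proof (rule ccontr)
  assume "\<not> ?thesis"
  then have le: "app (f ^ n) c \<le> y" for n by (auto simp: not_less)
  let ?u = "\<lambda>n. app (f ^ n) c"
  have u: "c \<le> ?u n \<and> ?u n < b" for n
  proof (induction n)
    case (Suc n)
    have "app f b = b" using assms(1) by (simp add: gap_def fixp_def)
    then have "?u n < app f (?u n)" "app f (?u n) < b"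
      using assms Suc app_less_iff[of f "?u n" b] by simp_all
    then show ?case using Suc by simp
  qed (use assms in simp)
  have inc: "incseq ?u"
  proof (rule incseq_SucI)
    fix n
    show "?u n \<le> ?u (Suc n)" using assms(2)[of "?u n"] u[of n] assms(3) by simp
  qed
  obtain L where L: "?u \<longlonglongrightarrow> L" using incseq_convergent[OF inc] le by blast
  have "(\<lambda>n. app f (?u n)) \<longlonglongrightarrow> app f L" by (rule isCont_tendsto_compose[OF isCont_app L])
  moreover have "(\<lambda>n. app f (?u n)) \<longlonglongrightarrow> L" using LIMSEQ_Suc[OF L] by simp
  ultimately have "app f L = L" by (rule LIMSEQ_unique)
  moreover have "L \<le> y" "c \<le> L"
    using LIMSEQ_le_const[OF L] LIMSEQ_le_const2[OF L] le u by blast+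
  ultimately show False using assms(2)[of L] assms(3,5) by simp
qed

section \<open>Ping-pong and its consequences\<close>

text \<open>Words with different first letters send \<open>x\<close> to the disjoint images of
  \<open>I\<close> under \<open>u\<close> and \<open>v\<close>. A word equal to 1 is excluded as
  well: if its first letter is \<open>u\<close>, every point of \<open>I\<close>, in particular
  \<open>app v x\<close>, would lie in the image of \<open>I\<close> under \<open>u\<close>;
  likewise for \<open>v\<close>.\<close>

lemma ping_pong:
  assumes "nofree A" "u \<in> A" "v \<in> A" "x \<in> I"
    and inI: "\<And>y. y \<in> I \<Longrightarrow> app u y \<in> I" "\<And>y. y \<in> I \<Longrightarrow> app v y \<in> I"
    and disj: "\<And>y z. y \<in> I \<Longrightarrow> z \<in> I \<Longrightarrow> app u y \<noteq> app v z"
  shows False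
proof -
  have w: "app (word u v w) y \<in> I" if "y \<in> I" for w y
    using that inI by (induction w) auto
  have "\<not> inj (word u v)" using assms(1-3) by (simp add: nofree_def)
  then show False
  proof (cases rule: not_inj_word_cases)
    case (heads w w')
    then have "app (word u v (True # w)) x = app (word u v (False # w')) x" by simp
    then show False using disj[OF w w] assms(4) by simp
  next
    case (unit w)
    then obtain e w' where ew: "w = e # w'" by (cases w) auto
    have "app (word u v w) y = y" for y using unit by simp
    then have eq: "app (if e then u else v) (app (word u v w') y) = y" for y by (simp add: ew)
    show False
    proof (cases e)
      case True
      then show False using eq[of "app v x"] disj[OF w[OF inI(2)[OF assms(4)]] assms(4)] by simp
    next
      case False
      then show False using eq[of "app u x"] disj[OF assms(4) w[OF inI(1)[OF assms(4)]]] by metis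
    qed
  qed
qed

text \<open>If \<open>g\<close> moved the end point \<open>a\<close> into the gap, let
  \<open>h\<close> in \<open>A\<close> contract the gap towards \<open>a\<close>, and take
  \<open>c\<close> between \<open>app g a\<close> and \<open>b\<close>. A high power h^n sends
  [a, c] to the left of \<open>app g a\<close>, while g h^m sends it between \<open>app g a\<close>
  and \<open>c\<close>; these two maps play ping-pong. The other end point is treated by
  reflection.\<close>

lemma no_crossing:
  assumes A: "nofree A" "subgp A" and fg: "f \<in> A" "g \<in> A" and gap: "gap {f} a b"
  shows "\<not> (a < app g a \<and> app g a < b)" "\<not> (a < app g b \<and> app g b < b)"
proof -
  have fpow: "app (h ^ n) x = x" if "app h x = x" for h n x
    using that by (induction n) auto
  show "\<not> (a < app g a \<and> app g a < b)"
  proof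
    assume g: "a < app g a \<and> app g a < b"
    obtain h where h: "h \<in> A" "gap {h} a b" "\<And>x. a < x \<Longrightarrow> x < b \<Longrightarrow> app h x < x"
      using gap_oriented(1)[OF gap fg(1) A(2)] by blast
    define c where "c = (app g a + b) / 2"
    have c: "app g a < c" "c < b" "a < c" using g by (auto simp: c_def)
    obtain n where n: "app (h ^ n) c < app g a"
      using gap_attract_left[OF h(2,3) c(3,2)] g by blast
    have "a < app (inverse g) c" using c(1) by (simp add: app_less_inverse)
    then obtain m where m: "app (h ^ m) c < app (inverse g) c"
      using gap_attract_left[OF h(2,3) c(3,2)] by blast
    have ha: "app (h ^ k) a = a" for k using h(2) fpow by (simp add: gap_def fixp_def)
    have ge: "a \<le> app (h ^ k) y" if "a \<le> y" for k y using ha[of k] that by (metis app_le_iff)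
    show False
    proof (rule ping_pong[OF A(1), of "h ^ n" "g * h ^ m" a "{a..c}"])
      show "h ^ n \<in> A" "g * h ^ m \<in> A" using h fg A by (simp_all add: subgp_closed)
      show "a \<in> {a..c}" using c by simp
      show "app (h ^ n) y \<in> {a..c}" if "y \<in> {a..c}" for y
        using that ge[of y n] n c(1) app_mono[of y c "h ^ n"] by (simp del: app_le_iff)
      show "app (g * h ^ m) y \<in> {a..c}" if "y \<in> {a..c}" for y
      proof -
        have "app (h ^ m) y < app (inverse g) c" using that m app_mono[of y c "h ^ m"] by (simp del: app_le_iff)
        then have "app g (app (h ^ m) y) < c" by (simp add: app_less_inverse)
        moreover have "app g a \<le> app g (app (h ^ m) y)" by (intro app_mono ge) (use that in simp)
        ultimately show ?thesis using g by (simp del: app_le_iff)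
      qed
      show "app (h ^ n) y \<noteq> app (g * h ^ m) z" if "y \<in> {a..c}" "z \<in> {a..c}" for y z
      proof -
        have "app (h ^ n) y < app g a" using that n app_mono[of y c "h ^ n"] by (simp del: app_le_iff)
        moreover have "app g a \<le> app g (app (h ^ m) z)" by (intro app_mono ge) (use that in simp)
        ultimately show ?thesis by (simp del: app_le_iff)
      qed
    qed
  qed
  show "\<not> (a < app g b \<and> app g b < b)"
  proof
    assume g: "a < app g b \<and> app g b < b"
    obtain h where h: "h \<in> A" "gap {h} a b" "\<And>x. a < x \<Longrightarrow> x < b \<Longrightarrow> x < app h x"
      using gap_oriented(2)[OF gap fg(1) A(2)] by blast
    define c where "c = (a + app g b) / 2"
    have c: "c < app g b" "c < b" "a < c" using g by (auto simp: c_def)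
    obtain n where n: "app g b < app (h ^ n) c"
      using gap_attract_right[OF h(2,3) c(3,2)] g by blast
    have "app (inverse g) c < b" using c(1) by (simp add: less_app_inverse)
    then obtain m where m: "app (inverse g) c < app (h ^ m) c"
      using gap_attract_right[OF h(2,3) c(3,2)] by blast
    have hb: "app (h ^ k) b = b" for k using h(2) fpow by (simp add: gap_def fixp_def)
    have le: "app (h ^ k) y \<le> b" if "y \<le> b" for k y using hb[of k] that by (metis app_le_iff)
    show False
    proof (rule ping_pong[OF A(1), of "h ^ n" "g * h ^ m" b "{c..b}"])
      show "h ^ n \<in> A" "g * h ^ m \<in> A" using h fg A by (simp_all add: subgp_closed)
      show "b \<in> {c..b}" using c by simp
      show "app (h ^ n) y \<in> {c..b}" if "y \<in> {c..b}" for y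
        using that le[of y n] n c(1) app_mono[of c y "h ^ n"] by (simp del: app_le_iff)
      show "app (g * h ^ m) y \<in> {c..b}" if "y \<in> {c..b}" for y
      proof -
        have "app (inverse g) c < app (h ^ m) y" using that m app_mono[of c y "h ^ m"] by (simp del: app_le_iff)
        then have "c < app g (app (h ^ m) y)" by (simp add: less_app_inverse)
        moreover have "app g (app (h ^ m) y) \<le> app g b" by (intro app_mono le) (use that in simp)
        ultimately show ?thesis using g by (simp del: app_le_iff)
      qed
      show "app (h ^ n) y \<noteq> app (g * h ^ m) z" if "y \<in> {c..b}" "z \<in> {c..b}" for y z
      proof -
        have "app g b < app (h ^ n) y" using that n app_mono[of c y "h ^ n"] by (simp del: app_le_iff)
        moreover have "app g (app (h ^ m) z) \<le> app g b" by (intro app_mono le) (use that in simp)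
        ultimately show ?thesis by (simp del: app_le_iff)
      qed
    qed
  qed
qed

text \<open>Take the midpoint \<open>x\<close> and the widest gap (l, r) around it belonging to one
  generator \<open>s\<close>. If r < b, some generator \<open>t\<close> moves \<open>r\<close> and
  has a gap (l', r') around \<open>r\<close>. If l < l', then \<open>s\<close> or its inverse moves
  l' into (l', r'); if l' = l, then \<open>t\<close> or its inverse moves \<open>r\<close> into (l,
  r). Both are crossings. If l' < l, the gap of \<open>t\<close> is a wider one around
  \<open>x\<close>. The end \<open>l\<close> is symmetric.\<close>

lemma gap_generator:
  assumes A: "nofree A" "subgp A" and S: "finite S" "S \<subseteq> A" and gap: "gap S a b"
  shows "\<exists>s\<in>S. gap {s} a b"
proof -
  have ab: "app s a = a" "app s b = b" if "s \<in> S" for s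
    using gap that by (auto simp: gap_def fixp_def)
  have gap1: "\<exists>l r. gap {s} l r \<and> a \<le> l \<and> l < x \<and> x < r \<and> r \<le> b"
    if "s \<in> S" "app s x \<noteq> x" "a < x" "x < b" for s x
    using gap_exists[of "{s}" x a b] ab[OF that(1)] that by (auto simp: fixp_def)
  have moved: "\<exists>s\<in>S. app s x \<noteq> x" if "a < x" "x < b" for x
    using gap that by (auto simp: gap_def fixp_def)
  define x where "x = (a + b) / 2"
  have x: "a < x" "x < b" using gap by (auto simp: x_def gap_def)
  let ?M = "{s\<in>S. app s x \<noteq> x}"
  have "\<forall>s\<in>?M. \<exists>p. gap {s} (fst p) (snd p) \<and> a \<le> fst p \<and> fst p < x \<and> x < snd p \<and> snd p \<le> b"
    using gap1 x by fastforce
  then obtain p where p: "\<forall>s\<in>?M. gap {s} (fst (p s)) (snd (p s)) \<and> a \<le> fst (p s) \<and>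
      fst (p s) < x \<and> x < snd (p s) \<and> snd (p s) \<le> b"
    by (rule bchoice[THEN exE])
  let ?w = "\<lambda>s. snd (p s) - fst (p s)"
  have M: "finite ?M" "?M \<noteq> {}" using S moved[OF x] by auto
  have "Max (?w ` ?M) \<in> ?w ` ?M" using M by (intro Max_in) auto
  then obtain s where s: "s \<in> ?M" "Max (?w ` ?M) = ?w s" by (rule imageE)
  have smax: "?w t \<le> ?w s" if "t \<in> ?M" for t
    unfolding s(2)[symmetric] by (intro Max_ge finite_imageI imageI M(1) that)
  define l r where "l = fst (p s)" and "r = snd (p s)"
  have lr: "gap {s} l r" "a \<le> l" "l < x" "x < r" "r \<le> b" "app s l = l" "app s r = r"
    using p s by (auto simp: l_def r_def gap_def fixp_def)
  have sA: "s \<in> A" "inverse s \<in> A" using s S A by (auto intro: subgp_inv)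
  have bigger: False if t: "t \<in> S" "gap {t} l' r'" "l' < x" "x < r'" "l' \<le> l" "r \<le> r'" "(l', r') \<noteq> (l, r)" for t l' r'
  proof -
    have tM: "t \<in> ?M" using t by (auto simp: gap_def fixp_def)
    then have "fst (p t) = l'" "snd (p t) = r'"
      using p gap_unique[of "{t}" "fst (p t)" "snd (p t)" l' r' x] t by auto
    then have "r' - l' \<le> r - l" using smax[OF tM] by (simp add: l_def r_def)
    then show False using t(5-7) by simp
  qed
  have "r = b"
  proof (rule ccontr)
    assume "r \<noteq> b"
    then have rb: "a < r" "r < b" using lr by auto
    obtain t where t: "t \<in> S" "app t r \<noteq> r" using moved[OF rb] by auto
    then obtain l' r' where t': "gap {t} l' r'" "l' < r" "r < r'" using gap1 rb by blast
    have tA: "t \<in> A" "inverse t \<in> A" using t S A by (auto intro: subgp_inv)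
    consider "l < l'" | "l' = l" | "l' < l" by linarith
    then show False
    proof cases
      case 1
      have "app s l' \<noteq> l'" using lr(1) 1 t'(2) by (auto simp: gap_def fixp_def)
      moreover have "app s l' < r" "app (inverse s) l' < r"
        using t'(2) lr(7) by (metis app_less_iff, metis app_less_iff app_inverse_eq)
      ultimately show False
        using no_crossing(1)[OF A tA(1) sA(1) t'(1)] no_crossing(1)[OF A tA(1) sA(2) t'(1)] t'(3)
        by (metis app_less_inverse linorder_neqE_linordered_idom order_less_trans)
    next
      case 2
      have "app t l = l" using t'(1) 2 by (auto simp: gap_def fixp_def)
      then have "l < app t r" "l < app (inverse t) r"
        using lr(3,4) by (metis app_less_iff less_trans, metis app_less_iff app_inverse_eq less_trans)
      then show False
        using no_crossing(2)[OF A sA(1) tA(1) lr(1)] no_crossing(2)[OF A sA(1) tA(2) lr(1)] t(2)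
        by (metis app_less_inverse linorder_neqE_linordered_idom less_app_inverse)
    next
      case 3
      then show False using bigger[OF t(1) t'(1)] lr t' by auto
    qed
  qed
  moreover have "l = a"
  proof (rule ccontr)
    assume "l \<noteq> a"
    then have rb: "a < l" "l < b" using lr by auto
    obtain t where t: "t \<in> S" "app t l \<noteq> l" using moved[OF rb] by auto
    then obtain l' r' where t': "gap {t} l' r'" "l' < l" "l < r'" using gap1 rb by blast
    have tA: "t \<in> A" "inverse t \<in> A" using t S A by (auto intro: subgp_inv)
    consider "r' < r" | "r' = r" | "r < r'" by linarith
    then show False
    proof cases
      case 1
      have "app s r' \<noteq> r'" using lr(1) 1 t'(3) by (auto simp: gap_def fixp_def)
      moreover have "l < app s r'" "l < app (inverse s) r'"
        using t'(3) lr(6) by (metis app_less_iff, metis app_less_iff app_inverse_eq)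
      ultimately show False
        using no_crossing(2)[OF A tA(1) sA(1) t'(1)] no_crossing(2)[OF A tA(1) sA(2) t'(1)] t'(2)
        by (metis less_app_inverse linorder_neqE_linordered_idom order_less_trans)
    next
      case 2
      have "app t r = r" using t'(1) 2 by (auto simp: gap_def fixp_def)
      then have "app t l < r" "app (inverse t) l < r"
        using lr(3,4) by (metis app_less_iff less_trans, metis app_less_iff app_inverse_eq less_trans)
      then show False
        using no_crossing(1)[OF A sA(1) tA(1) lr(1)] no_crossing(1)[OF A sA(1) tA(2) lr(1)] t(2)
        by (metis app_less_inverse linorder_neqE_linordered_idom less_app_inverse)
    next
      case 3
      then show False using bigger[OF t(1) t'(1)] lr t' by auto
    qed
  qed
  ultimately show ?thesis using lr(1) s by auto
qed

text \<open>If the gap survived, some \<open>f\<close> in \<open>res A\<close> would have no fixed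
  point in it, by \<open>gap_generator\<close>. The motion of the points of the gap orders
  \<open>A\<close> with \<open>f\<close> as Archimedean unit, and Hoelder's theorem leads to an
  integral homomorphism that is nonzero at \<open>f\<close>.\<close>

lemma gap_res:
  assumes A: "nofree A" "subgp A" "fg A" and gap: "gap A a b"
  shows "\<not> gap (res A) a b"
proof
  assume gap': "gap (res A) a b"
  obtain S where S: "finite S" "res A = gen S" using fg_res[OF A(3,1)] by (auto simp: fg_def)
  have ab: "app g a = a" "app g b = b" if "g \<in> A" for g
    using gap that by (auto simp: gap_def fixp_def)
  have pres: "a < app g x \<and> app g x < b" if "g \<in> A" "a < x" "x < b" for g x
    using ab[OF that(1)] that by (metis app_less_iff)
  have "S \<subseteq> res A" using S gen_base by blast
  then obtain s where s: "s \<in> res A" "gap {s} a b"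
    using gap_generator[OF A(1,2) S(1)] gap' res_subset[of A] unfolding S(2) gap_gen by blast
  obtain f where f: "f \<in> res A" "gap {f} a b" "\<And>x. a < x \<Longrightarrow> x < b \<Longrightarrow> x < app f x"
    using gap_oriented(2)[OF s(2,1) subgp_res[OF A(2)]] by blast
  have fA: "f \<in> A" using f(1) res_subset by blast
  \<comment> \<open>An element is outside \<open>C\<close> only if it moves every point of the gap
    to the left; elements with a fixed point in the gap are thus equivalent to 1.\<close>
  define C where "C = {g\<in>A. \<exists>x. a < x \<and> x < b \<and> x \<le> app g x}"
  have "archimedean_cone A C f"
  proof
    show "subgp A" by (rule A)
    show "C \<subseteq> A" by (auto simp: C_def)
  next
    fix g h assume gh: "g \<in> C" "h \<in> C"
    then have ghA: "g \<in> A" "h \<in> A" "g * h \<in> A" using A by (auto simp: C_def subgp_closed)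
    show "g * h \<in> C"
    proof (rule ccontr)
      assume "g * h \<notin> C"
      then have neg: "app g (app h x) < x" if "a < x" "x < b" for x
        using ghA that by (auto simp: C_def not_le)
      \<comment> \<open>Two maps without a common fixed point in the gap cannot both have fixed
        points there, by \<open>gap_generator\<close>. The one without moves all points to the
        right, as it lies in \<open>C\<close>; the other would then move all points to the
        left.\<close>
      have "\<not> fixp {g, h} x" if "a < x" "x < b" for x
        using neg[OF that] by (auto simp: fixp_def)
      then have "gap {g, h} a b"
        using gap ab ghA by (auto simp: gap_def fixp_def)
      then have "gap {g} a b \<or> gap {h} a b"
        using gap_generator[OF A(1,2), of "{g, h}"] ghA by auto
      then show False
      proof
        assume "gap {g} a b"
        then have "x < app g x" if "a < x" "x < b" for x
          using gap_sign[of g a b] gh(1) that by (fastforce simp: C_def)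
        then have "app h x < x" if "a < x" "x < b" for x
          using pres[OF ghA(2) that] neg[OF that] by (meson less_trans)
        then show False using gh(2) by (force simp: C_def)
      next
        assume "gap {h} a b"
        then have h: "x < app h x" if "a < x" "x < b" for x
          using gap_sign[of h a b] gh(2) that by (fastforce simp: C_def)
        have "app g x < x" if "a < x" "x < b" for x
          using neg[OF that] h[OF that] by (meson app_less_iff less_trans)
        then show False using gh(1) by (force simp: C_def)
      qed
    qed
  next
    fix g x assume gx: "g \<in> A" "x \<in> C"
    then obtain y where y: "x \<in> A" "a < y" "y < b" "y \<le> app x y" by (auto simp: C_def)
    have "app g y \<le> app (g * x * inverse g) (app g y)" using y by simp
    then show "g * x * inverse g \<in> C"
      using pres[OF gx(1) y(2,3)] gx y A by (auto simp: C_def subgp_closed)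
  next
    fix x assume x: "x \<in> A"
    define y where "y = (a + b) / 2"
    have y: "a < y" "y < b" using gap by (auto simp: gap_def y_def)
    show "x \<in> C \<or> inverse x \<in> C"
    proof (cases "y \<le> app x y")
      case False
      then have "y \<le> app (inverse x) y" by (simp add: not_le app_less_inverse)
      then show ?thesis using y subgp_inv[OF A(2) x] by (auto simp: C_def)
    qed (use x y in \<open>auto simp: C_def\<close>)
  next
    have "a < (a + b) / 2" "(a + b) / 2 < b" using gap by (auto simp: gap_def)
    then show "f \<in> C" using f(3) fA unfolding C_def by (metis (mono_tags, lifting) less_imp_le mem_Collect_eq)
    show "inverse f \<notin> C"
    proof
      assume "inverse f \<in> C"
      then obtain x where x: "a < x" "x < b" "x \<le> app (inverse f) x" by (auto simp: C_def)
      then have "app f x \<le> x" using app_mono[of x "app (inverse f) x" f] by simp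
      then show False using f(3)[OF x(1,2)] by simp
    qed
  next
    fix g assume g: "g \<in> A"
    define y where "y = (a + b) / 2"
    have y: "a < y" "y < b" using gap by (auto simp: gap_def y_def)
    obtain n where "app g y < app (f ^ n) y"
      using gap_attract_right[OF f(2,3) y, of "app g y"] pres[OF g y] by blast
    then have "y < app (inverse g * f ^ n) y" by (simp add: app_less_inverse)
    moreover have "inverse g * f ^ n \<in> A" using A g fA by (simp add: subgp_closed)
    ultimately show "\<exists>n. inverse g * f ^ n \<in> C" using y by (auto simp: C_def intro: less_imp_le)
  qed
  then interpret archimedean_cone A C f .
  obtain \<tau> :: "homeo \<Rightarrow> real" where "hom_on A \<tau>" "\<tau> f = 1" using translation_number by blast
  then obtain c where "c \<in> homZ A" "c f \<noteq> 0" using real_hom_to_homZ[OF A(3) _ fA] by blast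
  then show False using f(1) by (auto simp: res_def)
qed

section \<open>Diffeomorphisms with Hoelder derivative\<close>

text \<open>If the conjugates of \<open>g\<close> by the powers of \<open>f\<close> displace \<open>[a, b]\<close> by a summable amount, then for
  large \<open>N\<close> the displacement of \<open>g\<close> exceeds that of every product of conjugates by powers of \<open>f^N\<close>,
  so \<open>g * f^(-N)\<close> and \<open>f^(-N)\<close> generate a free semigroup.\<close>

lemma summable_displacement_trivial:
  assumes G: "nofree G" "subgp G" and B: "subgp B" "B \<subseteq> G" "normalizes G B"
    and fg: "f \<in> G" "g \<in> B" and ab: "fixp B a" "fixp B b" "a < app f a"
    and d: "summable d" "\<And>k y. a \<le> y \<Longrightarrow> y \<le> b \<Longrightarrow> \<bar>app (inverse (f ^ k) * g * f ^ k) y - y\<bar> \<le> d k"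
    and y0: "a \<le> y0" "y0 \<le> b"
  shows "app g y0 = y0"
proof (rule ccontr)
  assume ne: "app g y0 \<noteq> y0"
  \<comment> \<open>Half the displacement, because both sides of a relation between words contribute
    to the final estimate.\<close>
  define \<delta> where "\<delta> = \<bar>app g y0 - y0\<bar> / 2"
  have \<delta>: "\<delta> > 0" using ne by (simp add: \<delta>_def)
  have d0: "0 \<le> d k" for k using d(2)[of y0 k] y0 by linarith
  obtain N0 where N0: "\<And>m n. m \<ge> N0 \<Longrightarrow> \<bar>sum d {m..<n}\<bar> < \<delta>"
    using d(1) \<delta> unfolding summable_Cauchy real_norm_def by meson
  define N where "N = Suc N0"
  \<comment> \<open>Powers of \<open>t\<close> meet only the indices N, 2 N, ..., all beyond
    \<open>N0\<close>, so the corresponding terms of \<open>d\<close> belong to one small tail.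
    Index 0, the element \<open>g\<close> itself, is left out.\<close>
  have sparse: "(\<Sum>i\<in>{1..<l}. d (N * i)) < \<delta>" for l
  proof -
    have "(\<Sum>i\<in>{1..<l}. d (N * i)) = sum d ((\<lambda>i. N * i) ` {1..<l})"
      by (subst sum.reindex) (auto simp: inj_on_def N_def simp del: mult_Suc)
    also have "\<dots> \<le> sum d {N..<N * l}"
      by (rule sum_mono2) (auto simp: d0 N_def simp del: mult_Suc)
    also have "\<dots> < \<delta>" using N0[of N "N * l"] by (simp add: N_def)
    finally show ?thesis .
  qed
  define t where "t = inverse (f ^ N)"
  have tG: "t \<in> G" using G fg by (simp add: t_def subgp_closed)
  have pow: "t ^ k = inverse (f ^ (N * k))" for k
    by (simp add: t_def inverse_power_gp power_mult)
  have pres: "a \<le> app h y \<and> app h y \<le> b" if "h \<in> B" "a \<le> y" "y \<le> b" for h y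
    using ab(1,2) that app_mono[of a y h] app_mono[of y b h] by (simp add: fixp_def del: app_le_iff)
  have disp: "t ^ j * conj_word g t w * inverse (t ^ j) \<in> B \<and>
      (\<forall>y. a \<le> y \<longrightarrow> y \<le> b \<longrightarrow>
        \<bar>app (t ^ j * conj_word g t w * inverse (t ^ j)) y - y\<bar> \<le> (\<Sum>i\<in>{j..<j + length w}. d (N * i)))" for j w
  proof (induction w arbitrary: j)
    case Nil
    then show ?case using subgp_one[OF B(1)] by (simp add: group_simps)
  next
    case (Cons e w)
    let ?r = "t ^ Suc j * conj_word g t w * inverse (t ^ Suc j)" and ?x = "if e then t ^ j * g * inverse (t ^ j) else 1"
    have eq: "t ^ j * conj_word g t (e # w) * inverse (t ^ j) = ?x * ?r"
      by (simp add: group_simps power_Suc2 del: power_Suc)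
    have xB: "?x \<in> B" using normalizesD[OF B(3) subgp_power[OF G(2) tG] fg(2)] subgp_one[OF B(1)] by simp
    have xd: "\<bar>app ?x y - y\<bar> \<le> d (N * j)" if "a \<le> y" "y \<le> b" for y
      using d(2)[OF that, of "N * j"] d0 by (simp add: pow group_simps)
    have "\<bar>app (?x * ?r) y - y\<bar> \<le> (\<Sum>i\<in>{j..<j + length (e # w)}. d (N * i))" if y: "a \<le> y" "y \<le> b" for y
    proof -
      have "\<bar>app ?r y - y\<bar> \<le> (\<Sum>i\<in>{Suc j..<Suc j + length w}. d (N * i))"
        using Cons[of "Suc j"] y by blast
      moreover have "\<bar>app ?x (app ?r y) - app ?r y\<bar> \<le> d (N * j)"
        using xd pres[of ?r y] Cons[of "Suc j"] y by blast
      moreover have "(\<Sum>i\<in>{j..<j + length (e # w)}. d (N * i))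
          = d (N * j) + (\<Sum>i\<in>{Suc j..<Suc j + length w}. d (N * i))"
        by (simp add: sum.atLeast_Suc_lessThan)
      ultimately show ?thesis by (simp only: app_mult)
    qed
    then show ?case unfolding eq using subgp_mult[OF B(1) xB] Cons[of "Suc j"] by blast
  qed
  have ta: "app (t ^ k) a < a" if "k > 0" for k
    using that
  proof (induction k)
    case (Suc k)
    have "app f a > a" by (rule ab)
    then have "a < app (f ^ Suc n) a" for n
      by (induction n) (auto simp: less_trans[OF ab(3)])
    from this[of N0] have "app t a < a"
      by (simp add: t_def app_less_inverse[symmetric] less_app_inverse[symmetric] N_def del: power_Suc)
    then show ?case using Suc by (cases "k = 0") (auto intro: less_trans[of _ "app t a"])
  qed simp
  \<comment> \<open>Conjugates of \<open>g\<close> lie in \<open>B\<close>, whose fixed point set is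
    preserved by \<open>G\<close>. So a word sends \<open>a\<close> where
    \<open>t ^ length w\<close> does, and since \<open>t\<close> pushes \<open>a\<close> strictly to
    the left this determines the length.\<close>
  have word_a: "app (word (g * t) t w) a = app (t ^ length w) a" for w
  proof -
    have "fixp B (app (t ^ length w) a)"
      using fixp_image[OF B(3) subgp_power[OF G(2) tG] G(2)] ab(1) by simp
    moreover have "conj_word g t w \<in> B" using disp[of 0 w] by (simp add: group_simps)
    ultimately show ?thesis by (simp add: word_conj_word fixp_def)
  qed
  have "\<not> inj (word (g * t) t)" using G B fg tG by (auto simp: nofree_def subgp_mult)
  then show False
  proof (cases rule: not_inj_word_cases)
    case (unit w)
    then show False using word_a[of w] ta[of "length w"] by simp
  next
    case (heads u v)
    have len: "length u = length v"
    proof (rule ccontr)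
      assume "length u \<noteq> length v"
      have eq: "app (t ^ Suc (length u)) a = app (t ^ Suc (length v)) a"
        using word_a[of "True # u"] word_a[of "False # v"] unfolding heads by simp
      have no: False if "app (t ^ i) a = app (t ^ j) a" "i < j" for i j
      proof -
        have "t ^ j = t ^ i * t ^ (j - i)" using that(2) by (simp add: power_add[symmetric])
        then have "a = app (t ^ (j - i)) a" using that(1) by simp
        then show False using ta[of "j - i"] that(2) by simp
      qed
      show False
        using no[OF eq] no[OF eq[symmetric]] \<open>length u \<noteq> length v\<close> by (cases "length u < length v") auto
    qed
    let ?R = "\<lambda>w. t ^ 1 * conj_word g t w * inverse (t ^ 1)"
    have "g * (t * conj_word g t u * inverse t) * t ^ Suc (length v)
        = t * conj_word g t v * inverse t * t ^ Suc (length v)"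
      using heads unfolding word_conj_word by (simp add: len del: power_Suc)
    then have gR: "g * ?R u = ?R v" by (simp add: right_cancel del: power_Suc)
    have R: "?R w \<in> B" "\<And>y. a \<le> y \<Longrightarrow> y \<le> b \<Longrightarrow> \<bar>app (?R w) y - y\<bar> < \<delta>" for w
      using disp[of 1 w] sparse[of "1 + length w"] by (blast intro: le_less_trans)+
    \<comment> \<open>The relation g R(u) = R(v) gives \<open>app g y0\<close> as the image of
      \<open>y\<close> under R(v), while \<open>y0\<close> is its image under R(u); both are within
      \<delta> of \<open>y\<close>.\<close>
    define y where "y = app (inverse (?R u)) y0"
    have y: "a \<le> y" "y \<le> b" "app (?R u) y = y0"
      using pres[OF subgp_inv[OF B(1) R(1)] y0] by (simp_all add: y_def del: power_one_right)
    have "app g y0 = app (?R v) y" using y(3) gR by (metis app_mult)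
    then have "\<bar>app g y0 - y0\<bar> \<le> \<bar>app (?R v) y - y\<bar> + \<bar>y0 - y\<bar>" by linarith
    from le_less_trans[OF this add_strict_mono[OF R(2)[OF y(1,2), of v] R(2)[OF y(1,2), of u, unfolded y(3)]]]
    show False unfolding \<delta>_def by simp
  qed
qed

section \<open>Displacement and distortion estimates\<close>

text \<open>The lower bound \<open>m\<close> turns the Hoelder bound for differences of derivatives
  into a bound for their ratios, as \<open>distortion\<close> requires.\<close>

definition holder_diffeo :: "real \<Rightarrow> homeo \<Rightarrow> bool"
  where "holder_diffeo \<alpha> g \<longleftrightarrow> (\<forall>x. x \<notin> {0<..<1} \<longrightarrow> app g x = x) \<and>
    (\<exists>g' C m. C \<ge> 0 \<and> m > 0 \<and> deriv_on {0..1} (app g) g' \<and> (\<forall>x\<in>{0..1}. m \<le> \<bar>g' x\<bar>) \<and>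
      (\<forall>x\<in>{0..1}. \<forall>y\<in>{0..1}. \<bar>g' x - g' y\<bar> \<le> C * \<bar>x - y\<bar> powr \<alpha>))"

lemma mvt_deriv_on:
  assumes "deriv_on {0..1} g g'" "0 \<le> x" "x < y" "y \<le> 1"
  shows "\<exists>z. x < z \<and> z < y \<and> g y - g x = (y - x) * g' z"
proof -
  have "(g has_derivative (*) (g' z)) (at z within {x..y})" if "x \<le> z" "z \<le> y" for z
  proof -
    have "(g has_real_derivative g' z) (at z within {0..1})"
      using assms that by (simp add: deriv_on_def)
    then show ?thesis
      unfolding has_field_derivative_def by (rule has_derivative_subset) (use assms in auto)
  qed
  from mvt_simple[of x y g "\<lambda>z. (*) (g' z)", OF assms(3) this] obtain z where
    z: "z \<in> {x<..<y}" "g y - g x = g' z * (y - x)" by (rule bexE)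
  then have "g y - g x = (y - x) * g' z" by (simp only: mult.commute)
  then show ?thesis using z(1) by auto
qed

text \<open>A map that fixes \<open>p\<close> and \<open>r\<close> has derivative 1 at some point
  between them, hence derivative within C (r - p)^\<alpha> of 1 throughout. The mean value theorem
  on [p, y] gains one more factor r - p.\<close>

lemma displacement_bound:
  assumes "deriv_on {0..1} (app s) s'" "C \<ge> 0" "\<alpha> > 0"
    and "\<And>x y. x \<in> {0..1} \<Longrightarrow> y \<in> {0..1} \<Longrightarrow> \<bar>s' x - s' y\<bar> \<le> C * \<bar>x - y\<bar> powr \<alpha>"
    and "0 \<le> p" "p < r" "r \<le> 1" "app s p = p" "app s r = r" "p \<le> y" "y \<le> r"
  shows "\<bar>app s y - y\<bar> \<le> C * (r - p) powr (1 + \<alpha>)"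
proof (cases "y = p")
  case False
  then have y: "p < y" using assms by simp
  obtain z where z: "p < z" "z < r" "app s r - app s p = (r - p) * s' z"
    using mvt_deriv_on[OF assms(1,5,6,7)] by auto
  then have z1: "s' z = 1" using assms(6,8,9) by simp
  obtain w where w: "p < w" "w < y" "app s y - app s p = (y - p) * s' w"
    using mvt_deriv_on[OF assms(1,5) y] assms(7,11) by auto
  have "app s y - y = (y - p) * (s' w - s' z)" using w(3) assms(8) z1 by (simp add: algebra_simps)
  then have "\<bar>app s y - y\<bar> = (y - p) * \<bar>s' w - s' z\<bar>" using y by (simp add: abs_mult)
  also have "\<dots> \<le> (r - p) * (C * \<bar>w - z\<bar> powr \<alpha>)"
    using assms w z y by (intro mult_mono assms(4)) auto
  also have "\<dots> \<le> (r - p) * (C * (r - p) powr \<alpha>)"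
    using assms w z y by (intro mult_left_mono powr_mono2) auto
  also have "\<dots> = C * (r - p) powr (1 + \<alpha>)" using assms(6) by (simp add: powr_add)
  finally show ?thesis .
qed (use assms in simp)

text \<open>The mean derivatives of f^k on [a, b] and on the part [u, v] are compared, in a form
  without division. Each application of \<open>f\<close> contributes a ratio f'(y) / f'(z) with y
  and z in the current image of [a, b]; for an image of length L it is at most 1 + (C / m)
  L^\<alpha> \<le> exp ((C / m) L^\<alpha>).\<close>

lemma distortion:
  assumes f': "deriv_on {0..1} (app f) f'" and C: "C \<ge> 0" "m > 0" "\<alpha> > 0"
    and m: "\<And>x. x \<in> {0..1} \<Longrightarrow> m \<le> \<bar>f' x\<bar>"
    and H: "\<And>x y. x \<in> {0..1} \<Longrightarrow> y \<in> {0..1} \<Longrightarrow> \<bar>f' x - f' y\<bar> \<le> C * \<bar>x - y\<bar> powr \<alpha>"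
    and f01: "app f 0 = 0" "app f 1 = 1" and ord: "0 \<le> a" "a \<le> u" "u < v" "v \<le> b" "b \<le> 1"
  shows "(app (f ^ k) b - app (f ^ k) a) * (v - u)
    \<le> (app (f ^ k) v - app (f ^ k) u) * (b - a) * exp (C / m * (\<Sum>j<k. (app (f ^ j) b - app (f ^ j) a) powr \<alpha>))"
proof (induction k)
  case 0
  then show ?case by (simp add: mult.commute)
next
  case (Suc k)
  let ?e = "\<lambda>k. exp (C / m * (\<Sum>j<k. (app (f ^ j) b - app (f ^ j) a) powr \<alpha>))"
  define A B U V where F: "A = app (f ^ k) a" "B = app (f ^ k) b" "U = app (f ^ k) u" "V = app (f ^ k) v"
  have fk: "app (f ^ k) 0 = 0" "app (f ^ k) 1 = 1"
    using f01 by (induction k) auto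
  have ABUV: "0 \<le> A" "A \<le> U" "U < V" "V \<le> B" "B \<le> 1" "A < B"
    using app_mono[of 0 a "f ^ k"] app_mono[of b 1 "f ^ k"] ord fk unfolding F by simp_all
  obtain y where y: "A < y" "y < B" "app f B - app f A = (B - A) * f' y"
    using mvt_deriv_on[OF f' ABUV(1) ABUV(6) ABUV(5)] by auto
  obtain z where z: "U < z" "z < V" "app f V - app f U = (V - U) * f' z"
    using mvt_deriv_on[OF f' _ ABUV(3)] ABUV by force
  have "0 < (B - A) * f' y" "0 < (V - U) * f' z"
    unfolding y(3)[symmetric] z(3)[symmetric] using ABUV by simp_all
  then have pos: "0 < f' y" "0 < f' z"
    using ABUV by (simp_all add: zero_less_mult_iff)
  have "f' y \<le> f' z + C * \<bar>y - z\<bar> powr \<alpha>" using H[of y z] y z ABUV by auto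
  also have "\<dots> \<le> f' z + C * (B - A) powr \<alpha>"
    using y z ABUV C by (intro add_left_mono mult_left_mono powr_mono2) auto
  also have "\<dots> \<le> f' z * (1 + C / m * (B - A) powr \<alpha>)"
  proof -
    have "C * (B - A) powr \<alpha> = m * (C / m * (B - A) powr \<alpha>)" using C by simp
    also have "\<dots> \<le> f' z * (C / m * (B - A) powr \<alpha>)"
      using m[of z] z ABUV pos C by (intro mult_right_mono) auto
    finally show ?thesis by (simp add: distrib_left)
  qed
  also have "\<dots> \<le> f' z * exp (C / m * (B - A) powr \<alpha>)"
    using pos exp_ge_add_one_self by (intro mult_left_mono) auto
  finally have ratio: "f' y \<le> f' z * exp (C / m * (B - A) powr \<alpha>)" .
  have "(app (f ^ Suc k) b - app (f ^ Suc k) a) * (v - u) = f' y * ((B - A) * (v - u))"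
    using y(3) by (simp add: F)
  also have "\<dots> \<le> (f' z * exp (C / m * (B - A) powr \<alpha>)) * ((V - U) * (b - a) * ?e k)"
    by (rule mult_mono[OF ratio Suc[folded F]]) (use ABUV ord pos in simp_all)
  also have "\<dots> = ((V - U) * f' z) * (b - a) * (?e k * exp (C / m * (B - A) powr \<alpha>))"
    by (simp add: algebra_simps)
  also have "?e k * exp (C / m * (B - A) powr \<alpha>) = ?e (Suc k)"
    by (simp add: exp_add[symmetric] distrib_left F)
  finally show ?case using z(3) by (simp add: F)
qed

section \<open>Nested gaps\<close>

lemma gap_disjoint:
  assumes "gap S a b" "gap S c d" "(a, b) \<noteq> (c, d)"
  shows "b \<le> c \<or> d \<le> a"
proof (rule ccontr)
  assume n: "\<not> ?thesis"
  define x where "x = (max a c + min b d) / 2"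
  have "max a c < min b d" using n assms by (auto simp: gap_def)
  then have "a < x" "x < b" "c < x" "x < d" by (auto simp: x_def max_def min_def split: if_splits)
  then show False using gap_unique[OF assms(1,2)] assms(3) by auto
qed

text \<open>An end point of the smaller gap lies strictly inside the larger one, hence is moved by a
  generator. Since \<open>B\<close> is normalised, its gaps are permuted, so the moved gap is
  disjoint from the original one.\<close>

lemma gap_moved:
  assumes "gap (gen S) p r" "gap B p' r'" "p \<le> p'" "r' \<le> r" "(p', r') \<noteq> (p, r)" "normalizes (gen S) B"
  shows "\<exists>s\<in>S. r' \<le> app s p' \<or> app s r' \<le> p'"
proof -
  have "p < p' \<or> r' < r" "p' < r'" using assms by (auto simp: gap_def)
  then obtain e where e: "e = p' \<or> e = r'" "p < e" "e < r" using assms(3,4) by force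
  then have "\<not> fixp S e" using assms(1) by (simp add: gap_def fixp_gen)
  then obtain s where s: "s \<in> S" "app s e \<noteq> e" by (auto simp: fixp_def)
  have "gap B (app s p') (app s r')"
    by (rule gap_image[OF assms(6) gen_base[OF s(1)] subgp_gen assms(2)])
  moreover have "(p', r') \<noteq> (app s p', app s r')" using s(2) e(1) by auto
  ultimately show ?thesis using gap_disjoint[OF assms(2)] s(1) by blast
qed

lemma gap_length:
  assumes "gap (gen S) p r" "gap B p' r'" "p \<le> p'" "r' \<le> r" "(p', r') \<noteq> (p, r)" "normalizes (gen S) B"
    and M: "\<And>s y. s \<in> S \<Longrightarrow> p \<le> y \<Longrightarrow> y \<le> r \<Longrightarrow> \<bar>app s y - y\<bar> \<le> M"
  shows "r' - p' \<le> M"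
proof -
  obtain s where s: "s \<in> S" "r' \<le> app s p' \<or> app s r' \<le> p'" using gap_moved[OF assms(1-6)] by auto
  have "p' < r'" using assms(2) by (simp add: gap_def)
  then show ?thesis using M[OF s(1), of p'] M[OF s(1), of r'] s(2) assms(3,4) by auto
qed

lemma holder_displacement:
  assumes "holder_diffeo \<alpha> s" "\<alpha> > 0"
  shows "\<exists>C\<ge>0. \<forall>p r y. 0 \<le> p \<longrightarrow> p < r \<longrightarrow> r \<le> 1 \<longrightarrow> app s p = p \<longrightarrow> app s r = r \<longrightarrow> p \<le> y \<longrightarrow> y \<le> r \<longrightarrow>
    \<bar>app s y - y\<bar> \<le> C * (r - p) powr (1 + \<alpha>)"
proof -
  obtain s' C where "C \<ge> 0" "deriv_on {0..1} (app s) s'"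
    "\<And>x y. x \<in> {0..1} \<Longrightarrow> y \<in> {0..1} \<Longrightarrow> \<bar>s' x - s' y\<bar> \<le> C * \<bar>x - y\<bar> powr \<alpha>"
    using assms(1) unfolding holder_diffeo_def by blast
  then show ?thesis using displacement_bound[of s s' C \<alpha>] assms(2) by blast
qed

lemma res_series:
  assumes "subgp G" "nofree G" "fg G"
  shows "subgp ((res ^^ i) G)" "nofree ((res ^^ i) G)" "fg ((res ^^ i) G)" "(res ^^ i) G \<subseteq> G"
    "normalizes G ((res ^^ i) G)"
proof -
  have "subgp ((res ^^ i) G) \<and> nofree ((res ^^ i) G) \<and> fg ((res ^^ i) G) \<and> (res ^^ i) G \<subseteq> G \<and>
    normalizes G ((res ^^ i) G)"
  proof (induction i)
    case 0
    then show ?case using assms by (simp add: normalizes_def subgp_closed)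
  next
    case (Suc i)
    then show ?case
      using subgp_res fg_res normalizes_res[OF _ assms(1)] res_subset nofree_subset[OF _ res_subset]
      by fastforce
  qed
  then show "subgp ((res ^^ i) G)" "nofree ((res ^^ i) G)" "fg ((res ^^ i) G)" "(res ^^ i) G \<subseteq> G"
    "normalizes G ((res ^^ i) G)" by blast+
qed

lemma normalizes_subset: "normalizes G A \<Longrightarrow> H \<subseteq> G \<Longrightarrow> normalizes H A"
  by (auto simp: normalizes_def)

text \<open>For a point moved by the \<open>n\<close>-th term of the series, the gaps around it are strictly nested
  \<open>K 0, \<dots>, K n\<close>.  An element fixing the end points of an interval has derivative 1 somewhere in it,
  so moving a translate of \<open>K (i + 1)\<close> off itself inside a translate of \<open>K i\<close> forces
  \<open>|K (i + 1)| \<le> C |K i|^(1 + \<alpha>)\<close>.  Hence the lengths of the translates of \<open>K n\<close> under the powers of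
  \<open>f\<close> have summable \<open>\<alpha>\<close>-th powers as soon as \<open>\<alpha> (1 + \<alpha>)^(n - 1) \<ge> 1\<close>, which bounds the distortion
  of all powers of \<open>f\<close> on \<open>K n\<close>.\<close>

theorem res_series_trivial:
  assumes \<alpha>: "\<alpha> > 0" and G: "subgp G" "nofree G" "fg G" and hol: "\<And>g. g \<in> G \<Longrightarrow> holder_diffeo \<alpha> g"
  shows "\<exists>n. (res ^^ n) G = {1}"
proof -
  obtain j where "1 / \<alpha> < (1 + \<alpha>) ^ j" using real_arch_pow[of "1 + \<alpha>" "1 / \<alpha>"] \<alpha> by auto
  then have j: "1 \<le> (1 + \<alpha>) ^ j * \<alpha>" using \<alpha> by (simp add: field_simps)
  \<comment> \<open>One level more than \<open>j\<close>: summable lengths are available only from K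
    1 on, which is moved off itself, and each of the \<open>j\<close> steps from K 1 to K n
    multiplies the exponent by 1 + \<alpha>.\<close>
  define n where "n = Suc j"
  define Gs where "Gs i = (res ^^ i) G" for i
  have Gs: "subgp (Gs i)" "nofree (Gs i)" "fg (Gs i)" "Gs i \<subseteq> G" "normalizes G (Gs i)"
    "Gs (Suc i) = res (Gs i)" for i
    unfolding Gs_def by (intro res_series G)+ simp
  have anti: "Gs k \<subseteq> Gs i" if "i \<le> k" for i k
    using that by (induction k rule: dec_induct) (use Gs(6) res_subset in blast)+
  have "Gs n = {1}"
  proof (rule ccontr)
    assume "Gs n \<noteq> {1}"
    then obtain g where g: "g \<in> Gs n" "g \<noteq> 1" using subgp_one[OF Gs(1)[of n]] by blast
    then obtain x where x: "app g x \<noteq> x" using homeo_eqI[of g 1] by auto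
    have fix01: "app h y = y" if "h \<in> G" "y \<notin> {0<..<1}" for h y
      using hol[OF that(1)] that(2) by (simp add: holder_diffeo_def)
    have x01: "0 < x" "x < 1" using fix01[of g x] g Gs(4) x by auto
    have "\<forall>i. \<exists>p. i \<le> n \<longrightarrow> gap (Gs i) (fst p) (snd p) \<and> 0 \<le> fst p \<and> fst p < x \<and> x < snd p \<and> snd p \<le> 1"
    proof (intro allI)
      fix i
      show "\<exists>p. i \<le> n \<longrightarrow> gap (Gs i) (fst p) (snd p) \<and> 0 \<le> fst p \<and> fst p < x \<and> x < snd p \<and> snd p \<le> 1"
      proof (cases "i \<le> n")
        case True
        have "\<not> fixp (Gs i) x" "fixp (Gs i) 0" "fixp (Gs i) 1"
          using anti[OF True] g(1) x fix01 Gs(4)[of i] by (auto simp: fixp_def)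
        from gap_exists[OF this x01] show ?thesis by auto
      qed simp
    qed
    then obtain p where p: "\<forall>i. i \<le> n \<longrightarrow> gap (Gs i) (fst (p i)) (snd (p i)) \<and> 0 \<le> fst (p i) \<and>
        fst (p i) < x \<and> x < snd (p i) \<and> snd (p i) \<le> 1"
      by (rule choice[THEN exE])
    define a b where "a i = fst (p i)" and "b i = snd (p i)" for i
    have ab: "gap (Gs i) (a i) (b i)" "0 \<le> a i" "a i < x" "x < b i" "b i \<le> 1" if "i \<le> n" for i
      using p that by (simp_all add: a_def b_def)
    have nest: "a i \<le> a (Suc i)" "b (Suc i) \<le> b i" "(a (Suc i), b (Suc i)) \<noteq> (a i, b i)" if "i < n" for i
    proof -
      have fx: "fixp (Gs (Suc i)) (a i)" "fixp (Gs (Suc i)) (b i)"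
        using ab(1)[of i] that anti[of i "Suc i"] by (auto simp: gap_def fixp_def)
      then show "a i \<le> a (Suc i)" "b (Suc i) \<le> b i"
        using ab(1,3,4)[of "Suc i"] ab(3,4)[of i] that unfolding gap_def
        by (metis Suc_leI less_imp_le_nat less_trans linorder_not_le)+
      show "(a (Suc i), b (Suc i)) \<noteq> (a i, b i)"
        using gap_res[OF Gs(2,1,3) ab(1)[of i]] ab(1)[of "Suc i"] that Gs(6)[of i] by force
    qed
    have a1: "a 1 \<le> a i" if "1 \<le> i" "i \<le> n" for i
      using that
    proof (induction i rule: dec_induct)
      case (step i)
      then show ?case using nest(1)[of i] by simp
    qed simp
    obtain S0 where S0: "G = gen S0" using G(3) by (auto simp: fg_def)
    have n0: "0 < n" by (simp add: n_def)
    \<comment> \<open>Passing to the inverse if needed, \<open>f\<close> pushes K 1 to the right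
      past itself. Its translates by f^k are then disjoint and lie in [0, 1], whence the bound on
      the sum of their lengths.\<close>
    have "\<exists>f\<in>G. b 1 \<le> app f (a 1)"
    proof -
      have g0: "gap (gen S0) (a 0) (b 0)" using ab(1)[of 0] S0 by (simp add: Gs_def)
      have g1: "gap (Gs 1) (a 1) (b 1)" using ab(1)[of 1] n0 by simp
      have "\<exists>s\<in>S0. b 1 \<le> app s (a 1) \<or> app s (b 1) \<le> a 1"
        by (rule gap_moved[OF g0 g1]) (use nest[of 0] n0 Gs(5)[of 1] S0 in auto)
      then obtain s where s: "s \<in> G" "b 1 \<le> app s (a 1) \<or> app s (b 1) \<le> a 1"
        using S0 gen_base by blast
      then show ?thesis
        using app_mono[of "app s (b 1)" "a 1" "inverse s"] subgp_inv[OF G(1) s(1)] by auto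
    qed
    then obtain f where f: "f \<in> G" "b 1 \<le> app f (a 1)" by blast
    have fk: "f ^ k \<in> G" for k by (simp add: G f subgp_power)
    define L where "L i k = app (f ^ k) (b i) - app (f ^ k) (a i)" for i k
    have in01: "0 \<le> app (f ^ k) y" "app (f ^ k) y \<le> 1" if "0 \<le> y" "y \<le> 1" for k y
      using app_mono[OF that(1), of "f ^ k"] app_mono[OF that(2), of "f ^ k"] fix01[OF fk] by simp_all
    have Lpos: "0 < L i k" "L i k \<le> 1" if "i \<le> n" for i k
      using ab[OF that] in01[of "a i" k] in01[of "b i" k] by (simp_all add: L_def)
    have L1: "(\<Sum>k<N. L 1 k) \<le> 1" for N
    proof -
      have "(\<Sum>k<N. L 1 k) \<le> app (f ^ N) (a 1) - a 1"
      proof (induction N)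
        case (Suc N)
        have "app (f ^ N) (b 1) \<le> app (f ^ Suc N) (a 1)"
          unfolding power_Suc2 using f(2) by simp
        then show ?case using Suc by (simp add: L_def)
      qed simp
      then show ?thesis using in01(2)[of "a 1" N] ab[of 1] n0 by simp
    qed
    \<comment> \<open>The constant must not depend on k. The translate of K i by f^k is again a gap
      of the normal subgroup \<open>Gs i\<close>, so the same generators of \<open>Gs i\<close>
      serve for every k.\<close>
    have step: "\<exists>C\<ge>0. \<forall>k. L (Suc i) k \<le> C * L i k powr (1 + \<alpha>)" if i: "i < n" for i
    proof -
      obtain S where S: "finite S" "Gs i = gen S" using Gs(3) by (auto simp: fg_def)
      have SG: "s \<in> G" if "s \<in> S" for s using that S(2) Gs(4) gen_base by blast
      have "\<forall>s\<in>S. \<exists>C\<ge>0. \<forall>p r y. 0 \<le> p \<longrightarrow> p < r \<longrightarrow> r \<le> 1 \<longrightarrow> app s p = p \<longrightarrow> app s r = r \<longrightarrow> p \<le> y \<longrightarrow> y \<le> r \<longrightarrow>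
          \<bar>app s y - y\<bar> \<le> C * (r - p) powr (1 + \<alpha>)"
        using holder_displacement[OF hol \<alpha>] SG by blast
      then obtain C where C: "\<forall>s\<in>S. C s \<ge> 0 \<and> (\<forall>p r y. 0 \<le> p \<longrightarrow> p < r \<longrightarrow> r \<le> 1 \<longrightarrow> app s p = p \<longrightarrow> app s r = r \<longrightarrow> p \<le> y \<longrightarrow> y \<le> r \<longrightarrow>
          \<bar>app s y - y\<bar> \<le> C s * (r - p) powr (1 + \<alpha>))"
        by (rule bchoice[THEN exE])
      have "L (Suc i) k \<le> sum C S * L i k powr (1 + \<alpha>)" for k
        unfolding L_def
      proof (rule gap_length[of S _ _ "Gs (Suc i)"])
        show gp: "gap (gen S) (app (f ^ k) (a i)) (app (f ^ k) (b i))"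
          using gap_image[OF Gs(5) fk G(1) ab(1)[of i]] i S(2) by simp
        show "gap (Gs (Suc i)) (app (f ^ k) (a (Suc i))) (app (f ^ k) (b (Suc i)))"
          using gap_image[OF Gs(5) fk G(1) ab(1)[of "Suc i"]] i by simp
        show "app (f ^ k) (a i) \<le> app (f ^ k) (a (Suc i))" "app (f ^ k) (b (Suc i)) \<le> app (f ^ k) (b i)"
          "(app (f ^ k) (a (Suc i)), app (f ^ k) (b (Suc i))) \<noteq> (app (f ^ k) (a i), app (f ^ k) (b i))"
          using nest[OF i] by simp_all
        show "normalizes (gen S) (Gs (Suc i))"
          by (rule normalizes_subset[OF Gs(5)]) (use S(2) Gs(4) in blast)
        fix s y assume s: "s \<in> S" and y: "app (f ^ k) (a i) \<le> y" "y \<le> app (f ^ k) (b i)"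
        have "app s (app (f ^ k) (a i)) = app (f ^ k) (a i)" "app s (app (f ^ k) (b i)) = app (f ^ k) (b i)"
          using gp gen_base[OF s] by (auto simp: gap_def fixp_def)
        moreover have "0 \<le> app (f ^ k) (a i)" "app (f ^ k) (a i) < app (f ^ k) (b i)" "app (f ^ k) (b i) \<le> 1"
          using ab[of i] i in01 by (simp_all add: less_trans[of "a i" x])
        ultimately have "\<bar>app s y - y\<bar> \<le> C s * (app (f ^ k) (b i) - app (f ^ k) (a i)) powr (1 + \<alpha>)"
          using C s y by blast
        also have "\<dots> \<le> sum C S * (app (f ^ k) (b i) - app (f ^ k) (a i)) powr (1 + \<alpha>)"
          using member_le_sum[OF s, of C] C S(1) by (intro mult_right_mono) auto
        finally show "\<bar>app s y - y\<bar> \<le> sum C S * (app (f ^ k) (b i) - app (f ^ k) (a i)) powr (1 + \<alpha>)" .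
      qed
      moreover have "sum C S \<ge> 0" using C by (intro sum_nonneg) auto
      ultimately show ?thesis by blast
    qed
    have "\<exists>C\<ge>0. \<forall>k. L (Suc i) k \<le> C * L 1 k powr ((1 + \<alpha>) ^ i)" if "i \<le> j" for i
      using that
    proof (induction i)
      case 0
      have "L 1 k powr 1 = L 1 k" for k using Lpos(1)[of 1 k] n0 by simp
      then show ?case by (intro exI[of _ 1]) simp
    next
      case (Suc i)
      then obtain C where C: "C \<ge> 0" "\<And>k. L (Suc i) k \<le> C * L 1 k powr ((1 + \<alpha>) ^ i)" by auto
      obtain D where D: "D \<ge> 0" "\<And>k. L (Suc (Suc i)) k \<le> D * L (Suc i) k powr (1 + \<alpha>)"
        using step[of "Suc i"] Suc.prems by (auto simp: n_def)
      have "L (Suc (Suc i)) k \<le> D * C powr (1 + \<alpha>) * L 1 k powr ((1 + \<alpha>) ^ Suc i)" for k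
      proof -
        have "L (Suc (Suc i)) k \<le> D * L (Suc i) k powr (1 + \<alpha>)" by (rule D)
        also have "\<dots> \<le> D * (C * L 1 k powr ((1 + \<alpha>) ^ i)) powr (1 + \<alpha>)"
          using Lpos(1)[of "Suc i" k] Suc.prems \<alpha> D(1)
          by (intro mult_left_mono powr_mono2 C) (auto simp: n_def)
        also have "\<dots> = D * C powr (1 + \<alpha>) * L 1 k powr ((1 + \<alpha>) ^ Suc i)"
          using C(1) by (simp add: powr_mult powr_powr mult.commute mult.left_commute)
        finally show ?thesis .
      qed
      then show ?case using D(1) by (intro exI[of _ "D * C powr (1 + \<alpha>)"]) simp
    qed
    then obtain C where C: "C \<ge> 0" "\<And>k. L n k \<le> C * L 1 k powr ((1 + \<alpha>) ^ j)"
      unfolding n_def by blast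
    have La: "L n k powr \<alpha> \<le> C powr \<alpha> * L 1 k" for k
    proof -
      have L1k: "0 < L 1 k" "L 1 k \<le> 1" using Lpos[of 1 k] n0 by simp_all
      have "L n k powr \<alpha> \<le> (C * L 1 k powr ((1 + \<alpha>) ^ j)) powr \<alpha>"
        using Lpos(1)[of n k] \<alpha> by (intro powr_mono2 C) auto
      also have "\<dots> = C powr \<alpha> * L 1 k powr ((1 + \<alpha>) ^ j * \<alpha>)"
        using C(1) by (simp add: powr_mult powr_powr)
      also have "\<dots> \<le> C powr \<alpha> * L 1 k powr 1"
        using L1k by (intro mult_left_mono powr_mono' j) auto
      finally show ?thesis using L1k by simp
    qed
    have sumL: "(\<Sum>k<N. L n k powr \<alpha>) \<le> C powr \<alpha>" for N
    proof -
      have "(\<Sum>k<N. L n k powr \<alpha>) \<le> C powr \<alpha> * (\<Sum>k<N. L 1 k)"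
        unfolding sum_distrib_left by (intro sum_mono La)
      also have "\<dots> \<le> C powr \<alpha>" using L1[of N] mult_left_mono[of _ 1 "C powr \<alpha>"] by simp
      finally show ?thesis .
    qed
    have smL: "summable (\<lambda>k. L n k powr \<alpha>)"
      by (rule summableI_nonneg_bounded[OF _ sumL]) simp
    obtain f' Cf m where f': "Cf \<ge> 0" "m > 0" "deriv_on {0..1} (app f) f'" "\<And>x. x \<in> {0..1} \<Longrightarrow> m \<le> \<bar>f' x\<bar>"
      "\<And>x y. x \<in> {0..1} \<Longrightarrow> y \<in> {0..1} \<Longrightarrow> \<bar>f' x - f' y\<bar> \<le> Cf * \<bar>x - y\<bar> powr \<alpha>"
      using hol[OF f(1)] unfolding holder_diffeo_def by blast
    define E where "E = exp (Cf / m * C powr \<alpha>)"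
    have gG: "g \<in> G" using g(1) Gs(4) by blast
    obtain D where D: "D \<ge> 0" "\<And>p r y. 0 \<le> p \<Longrightarrow> p < r \<Longrightarrow> r \<le> 1 \<Longrightarrow> app g p = p \<Longrightarrow> app g r = r \<Longrightarrow> p \<le> y \<Longrightarrow> y \<le> r \<Longrightarrow>
        \<bar>app g y - y\<bar> \<le> D * (r - p) powr (1 + \<alpha>)"
      using holder_displacement[OF hol[OF gG] \<alpha>] by blast
    \<comment> \<open>If L is the length of the k-th translate of K n, then \<open>g\<close>
      displaces its points by at most D L^(1 + \<alpha>); pulling back by f^k multiplies this by at
      most (b n - a n) E / L, by bounded distortion.\<close>
    define d where "d k = D * (b n - a n) * E * L n k powr \<alpha>" for k
    note abn = ab[OF order_refl]
    have fx: "fixp (Gs n) (a n)" "fixp (Gs n) (b n)" using abn(1) by (auto simp: gap_def)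
    have disp: "\<bar>app (inverse (f ^ k) * g * f ^ k) y - y\<bar> \<le> d k" if y: "a n \<le> y" "y \<le> b n" for k y
    proof -
      let ?h = "inverse (f ^ k) * g * f ^ k"
      define w where "w = app ?h y"
      have "?h \<in> Gs n" by (rule normalizes_iff[OF Gs(5) G(1) fk, THEN iffD2]) (rule g)
      then have w: "a n \<le> w" "w \<le> b n"
        using app_mono[OF y(1), of ?h] app_mono[OF y(2), of ?h] fx by (simp_all only: fixp_def w_def)
      have fw: "app (f ^ k) w = app g (app (f ^ k) y)" by (simp add: w_def)
      have gp: "gap (Gs n) (app (f ^ k) (a n)) (app (f ^ k) (b n))"
        by (rule gap_image[OF Gs(5) fk G(1) abn(1)])
      have "\<bar>app (f ^ k) w - app (f ^ k) y\<bar> \<le> D * L n k powr (1 + \<alpha>)"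
        unfolding fw L_def
      proof (rule D(2))
        show "app g (app (f ^ k) (a n)) = app (f ^ k) (a n)" "app g (app (f ^ k) (b n)) = app (f ^ k) (b n)"
          using gp g(1) by (simp_all add: gap_def fixp_def)
      qed (use in01[of "a n" k] in01[of "b n" k] abn y in simp_all)
      moreover have "L n k * (v - u) \<le> (app (f ^ k) v - app (f ^ k) u) * (b n - a n) * E"
        if uv: "a n \<le> u" "u < v" "v \<le> b n" for u v
      proof -
        have "L n k * (v - u) \<le> (app (f ^ k) v - app (f ^ k) u) * (b n - a n) *
            exp (Cf / m * (\<Sum>j<k. L n j powr \<alpha>))"
          unfolding L_def
          by (rule distortion[OF f'(3,1,2) \<alpha> f'(4,5)]) (use fix01[OF f(1)] abn uv in auto)
        also have "\<dots> \<le> (app (f ^ k) v - app (f ^ k) u) * (b n - a n) * E"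
        proof (rule mult_left_mono)
          have "Cf / m * (\<Sum>j<k. L n j powr \<alpha>) \<le> Cf / m * C powr \<alpha>"
            using sumL[of k] f'(1,2) by (intro mult_left_mono) auto
          then show "exp (Cf / m * (\<Sum>j<k. L n j powr \<alpha>)) \<le> E" by (simp add: E_def)
        qed (use uv abn in simp)
        finally show ?thesis .
      qed
      from this[of w y] this[of y w] have
        "L n k * \<bar>w - y\<bar> \<le> \<bar>app (f ^ k) w - app (f ^ k) y\<bar> * (b n - a n) * E"
        using w y by (cases w y rule: linorder_cases) (simp_all add: abs_if)
      ultimately have "L n k * \<bar>w - y\<bar> \<le> D * L n k powr (1 + \<alpha>) * (b n - a n) * E"
        using abn by (elim order_trans) (auto intro!: mult_right_mono simp: E_def)
      also have "\<dots> = L n k * d k"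
        using Lpos(1)[of n k] by (simp add: d_def powr_add)
      finally show ?thesis using Lpos(1)[of n k] by (simp add: w_def)
    qed
    have "summable d" unfolding d_def by (intro summable_mult smL)
    moreover have "a n < app f (a n)"
    proof -
      have "a n < b 1" using abn(3) ab(4)[of 1] n0 by simp
      also have "\<dots> \<le> app f (a 1)" by (rule f)
      also have "\<dots> \<le> app f (a n)" using a1[of n] n0 by simp
      finally show ?thesis .
    qed
    ultimately have "app g x = x"
      using summable_displacement_trivial[OF G(2,1) Gs(1,4,5) f(1) g(1) fx _ _ disp] abn by simp
    then show False using x by simp
  qed
  then show ?thesis by (auto simp: Gs_def)
qed

section \<open>Integer recurrences with small roots\<close>

text \<open>The polynomial \<open>p\<close> evaluated at the shift operator, applied to
  \<open>u\<close> and read off at \<open>k\<close>. It vanishes for all \<open>k\<close> when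
  \<open>u\<close> satisfies the linear recurrence with characteristic polynomial
  \<open>p\<close>.\<close>

definition recur :: "'a :: comm_ring_1 poly \<Rightarrow> (nat \<Rightarrow> 'a) \<Rightarrow> nat \<Rightarrow> 'a"
  where "recur p u k = (\<Sum>i\<le>degree p. coeff p i * u (k + i))"

lemma recur_eq: "degree p \<le> N \<Longrightarrow> recur p u k = (\<Sum>i\<le>N. coeff p i * u (k + i))"
  unfolding recur_def by (rule sum.mono_neutral_left) (auto simp: coeff_eq_0)

lemma recur_zero [simp]: "recur 0 u k = 0"
  by (simp add: recur_def)

lemma recur_pCons: "recur (pCons a p) u k = a * u k + recur p u (Suc k)"
proof -
  have "recur (pCons a p) u k = (\<Sum>i\<le>Suc (degree p). coeff (pCons a p) i * u (k + i))"
    by (rule recur_eq) (rule degree_pCons_le)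
  also have "\<dots> = a * u k + (\<Sum>i\<le>degree p. coeff p i * u (k + Suc i))"
    by (subst sum.atMost_Suc_shift) simp
  finally show ?thesis by (simp add: recur_def)
qed

lemma recur_add: "recur (p + q) u k = recur p u k + recur q u k"
proof -
  let ?N = "max (degree p) (degree q)"
  have "degree (p + q) \<le> ?N" by (rule degree_add_le_max)
  then show ?thesis
    by (simp add: recur_eq[of _ ?N] sum.distrib[symmetric] distrib_right)
qed

lemma recur_smult: "recur (smult a p) u k = a * recur p u k"
  using recur_eq[of "smult a p" "degree p"] by (simp add: recur_def degree_smult_le sum_distrib_left mult.assoc)

lemma recur_monom: "recur (monom a j) u k = a * u (k + j)"
  by (induction j arbitrary: k) (simp_all add: monom_0 monom_Suc recur_pCons)

lemma recur_shift: "recur p (\<lambda>i. u (i + j)) k = recur p u (k + j)"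
  by (simp add: recur_def add.assoc add.commute add.left_commute)

lemma recur_add_right: "recur p (\<lambda>i. u i + v i) k = recur p u k + recur p v k"
  by (simp add: recur_def distrib_left sum.distrib)

lemma recur_mult_right: "recur p (\<lambda>i. a * u i) k = a * recur p u k"
  by (simp add: recur_def sum_distrib_left mult.left_commute)

text \<open>Once the errors w(k + 1) - \<mu> w(k) stay below (\<epsilon> / 2) (1 - |\<mu>|), their
  geometrically damped sum is at most \<epsilon> / 2, and the contribution of the starting value
  decays.\<close>

lemma contraction_tendsto_zero:
  fixes w :: "nat \<Rightarrow> complex"
  assumes \<mu>: "cmod \<mu> < 1" and lim: "(\<lambda>k. w (Suc k) - \<mu> * w k) \<longlonglongrightarrow> 0"
  shows "w \<longlonglongrightarrow> 0"
proof (rule LIMSEQ_I)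
  fix \<epsilon> :: real assume \<epsilon>: "\<epsilon> > 0"
  let ?\<rho> = "cmod \<mu>"
  have "\<epsilon> / 2 * (1 - ?\<rho>) > 0" using \<epsilon> \<mu> by simp
  then obtain K where K: "\<And>k. k \<ge> K \<Longrightarrow> cmod (w (Suc k) - \<mu> * w k) < \<epsilon> / 2 * (1 - ?\<rho>)"
    using LIMSEQ_D[OF lim] by fastforce
  have b: "cmod (w (K + i)) \<le> ?\<rho> ^ i * cmod (w K) + \<epsilon> / 2" for i
  proof (induction i)
    case (Suc i)
    have "w (Suc (K + i)) = (w (Suc (K + i)) - \<mu> * w (K + i)) + \<mu> * w (K + i)" by simp
    then have "cmod (w (Suc (K + i))) \<le> cmod (w (Suc (K + i)) - \<mu> * w (K + i)) + ?\<rho> * cmod (w (K + i))"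
      by (metis norm_mult norm_triangle_ineq)
    also have "\<dots> \<le> \<epsilon> / 2 * (1 - ?\<rho>) + ?\<rho> * (?\<rho> ^ i * cmod (w K) + \<epsilon> / 2)"
      by (intro add_mono mult_left_mono Suc less_imp_le[OF K]) auto
    also have "\<dots> = ?\<rho> ^ Suc i * cmod (w K) + \<epsilon> / 2" by (simp add: field_simps)
    finally show ?case by simp
  qed (use \<epsilon> in simp)
  have "(\<lambda>i. ?\<rho> ^ i * cmod (w K)) \<longlonglongrightarrow> 0"
    using \<mu> by (intro tendsto_mult_left_zero LIMSEQ_realpow_zero) auto
  then obtain I where I: "\<And>i. i \<ge> I \<Longrightarrow> norm (?\<rho> ^ i * cmod (w K) - 0) < \<epsilon> / 2"
    using LIMSEQ_D[of _ 0 "\<epsilon> / 2"] \<epsilon> by (metis half_gt_zero)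
  have "norm (w k - 0) < \<epsilon>" if "k \<ge> K + I" for k
  proof -
    have "cmod (w k) \<le> ?\<rho> ^ (k - K) * cmod (w K) + \<epsilon> / 2" using b[of "k - K"] that by simp
    moreover have "?\<rho> ^ (k - K) * cmod (w K) < \<epsilon> / 2" using I[of "k - K"] that by simp
    ultimately show ?thesis by simp
  qed
  then show "\<exists>N. \<forall>k\<ge>N. norm (w k - 0) < \<epsilon>" by blast
qed

text \<open>A root \<mu> splits Q into (X - \<mu>) R, and \<open>contraction_tendsto_zero\<close>
  passes from Q to R. The hypothesis is convergence to 0 rather than an exact recurrence, as this is
  what the induction hands on to R.\<close>

lemma recur_tendsto_zero:
  fixes Q :: "complex poly"
  assumes "Q \<noteq> 0" "\<And>\<mu>. poly Q \<mu> = 0 \<Longrightarrow> cmod \<mu> < 1" "(\<lambda>k. recur Q u k) \<longlonglongrightarrow> 0"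
  shows "u \<longlonglongrightarrow> 0"
  using assms
proof (induction "degree Q" arbitrary: Q)
  case 0
  then obtain a where a: "Q = [:a:]" by (metis degree_eq_zeroE)
  have "(\<lambda>k. inverse a * (a * u k)) \<longlonglongrightarrow> inverse a * 0"
    using 0(4) by (intro tendsto_mult_left) (simp add: a recur_pCons)
  then show ?case using 0(2) a by simp
next
  case (Suc d)
  have "\<not> constant (poly Q)" using Suc(2) by (simp add: constant_degree)
  then obtain \<mu> where \<mu>: "poly Q \<mu> = 0" using fundamental_theorem_of_algebra by blast
  then obtain R where R: "Q = [:-\<mu>, 1:] * R" by (auto simp: poly_eq_0_iff_dvd dvd_def)
  have R0: "R \<noteq> 0" using R Suc(3) by auto
  then have "degree Q = Suc (degree R)" unfolding R by (subst degree_mult_eq) auto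
  then have d: "d = degree R" using Suc(2) by simp
  have Q: "Q = smult (- \<mu>) R + pCons 0 R" by (simp add: R)
  have "recur Q u = (\<lambda>k. recur R u (Suc k) - \<mu> * recur R u k)"
    unfolding Q recur_add recur_smult recur_pCons by (simp add: fun_eq_iff)
  then have "recur R u \<longlonglongrightarrow> 0"
    using contraction_tendsto_zero[OF Suc(4)[OF \<mu>], of "recur R u"] Suc(5) by simp
  then show ?case using Suc(1)[OF d R0] Suc(4) R by simp
qed

text \<open>If |z| \<ge> 2, the leading term has modulus at least |z|^d, while the lower terms sum
  to at most |z|^d - 1.\<close>

lemma root_bound:
  fixes p :: "int poly"
  assumes "p \<noteq> 0" "\<And>i. \<bar>coeff p i\<bar> \<le> 1" "poly (map_poly of_int p) (z :: complex) = 0"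
  shows "cmod z < 2"
proof (rule ccontr)
  assume "\<not> cmod z < 2"
  then have r: "cmod z \<ge> 2" by simp
  let ?r = "cmod z" and ?d = "degree p"
  have geo: "(\<Sum>i<d. ?r ^ i) \<le> ?r ^ d - 1" for d
  proof (induction d)
    case (Suc d)
    have "2 * ?r ^ d \<le> ?r ^ Suc d" using r by (simp add: mult_right_mono)
    then show ?case using Suc by simp
  qed simp
  have "poly (map_poly of_int p) z = (\<Sum>i\<le>?d. of_int (coeff p i) * z ^ i)"
    by (simp add: poly_altdef coeff_map_poly degree_map_poly)
  also have "\<dots> = (\<Sum>i<?d. of_int (coeff p i) * z ^ i) + of_int (lead_coeff p) * z ^ ?d"
    by (simp add: lessThan_Suc_atMost[symmetric])
  finally have eq: "of_int (lead_coeff p) * z ^ ?d = - (\<Sum>i<?d. of_int (coeff p i) * z ^ i)"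
    using assms(3) by (simp add: eq_neg_iff_add_eq_0 add.commute)
  have "1 \<le> \<bar>lead_coeff p\<bar>" using assms(1) leading_coeff_0_iff[of p] by linarith
  then have "1 * ?r ^ ?d \<le> \<bar>of_int (lead_coeff p)\<bar> * ?r ^ ?d"
    by (intro mult_right_mono) (linarith, simp)
  also have "\<dots> = cmod (of_int (lead_coeff p) * z ^ ?d)" by (simp add: norm_mult norm_power)
  also have "\<dots> = cmod (\<Sum>i<?d. of_int (coeff p i) * z ^ i)" by (simp add: eq)
  also have "\<dots> \<le> (\<Sum>i<?d. cmod (of_int (coeff p i) * z ^ i))" by (rule norm_sum)
  also have "\<dots> \<le> (\<Sum>i<?d. ?r ^ i)"
  proof (rule sum_mono)
    fix i
    have "real_of_int \<bar>coeff p i\<bar> \<le> 1" using assms(2)[of i] by linarith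
    then show "cmod (of_int (coeff p i) * z ^ i) \<le> ?r ^ i"
      by (simp add: norm_mult norm_power mult_left_le_one_le)
  qed
  also have "\<dots> \<le> ?r ^ ?d - 1" by (rule geo)
  finally show False by simp
qed

text \<open>The roots of P(1 + 4 X) are (\<lambda> - 1) / 4 with \<lambda> a root of P, so they have
  modulus below 1. The integer sequence tends to 0 and hence ends in zeros.\<close>

lemma int_recur_eventually_zero:
  fixes P :: "int poly" and y :: "nat \<Rightarrow> int"
  assumes P: "P \<noteq> 0" "\<And>i. \<bar>coeff P i\<bar> \<le> 1" and y: "\<And>k. recur (pcompose P [:1, 4:]) y k = 0"
  shows "\<exists>K. \<forall>k\<ge>K. y k = 0"
proof -
  let ?Q = "pcompose P [:1, 4:]"
  let ?Qc = "map_poly of_int ?Q :: complex poly"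
  have "?Q \<noteq> 0" using pcompose_eq_0[of P "[:1, 4:]"] P(1) by auto
  then have "?Qc \<noteq> 0" by (simp add: map_poly_eq_0_iff)
  moreover have "cmod \<mu> < 1" if "poly ?Qc \<mu> = 0" for \<mu>
  proof -
    have pc: "map_poly of_int (pCons a p) = pCons (of_int a) (map_poly of_int p :: complex poly)" for a p
      by (rule map_poly_pCons) simp
    have add: "map_poly of_int (p + q) = (map_poly of_int p + map_poly of_int q :: complex poly)" for p q
      by (rule poly_eqI) (simp add: coeff_map_poly)
    have smult: "map_poly of_int (smult a p) = smult (of_int a) (map_poly of_int p :: complex poly)" for a p
      by (rule poly_eqI) (simp add: coeff_map_poly)
    have "poly (map_poly of_int (pcompose P [:1, 4:])) \<mu> = poly (map_poly of_int P) (1 + \<mu> * 4)"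
      by (induction P) (simp_all add: pcompose_pCons pc add smult distrib_right)
    then have "poly (map_poly of_int P) (1 + \<mu> * 4) = 0" using that by simp
    then have "cmod (1 + \<mu> * 4) < 2" by (rule root_bound[OF P])
    then have "cmod (\<mu> * 4) < 3"
      using norm_triangle_ineq4[of "1 + \<mu> * 4" 1] by simp
    then show ?thesis by (simp add: norm_mult)
  qed
  moreover have "recur ?Qc (\<lambda>k. of_int (y k)) k = of_int (recur ?Q y k)" for k
    by (simp add: recur_def coeff_map_poly degree_map_poly)
  then have "recur ?Qc (\<lambda>k. of_int (y k)) = (\<lambda>k. 0)" by (simp only: y of_int_0 fun_eq_iff simp_thms)
  then have "recur ?Qc (\<lambda>k. of_int (y k)) \<longlonglongrightarrow> 0" by (simp only: tendsto_const)
  ultimately have "(\<lambda>k. of_int (y k) :: complex) \<longlonglongrightarrow> 0"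
    by (rule recur_tendsto_zero)
  then obtain K where K: "\<And>k. k \<ge> K \<Longrightarrow> norm (of_int (y k) - 0 :: complex) < 1"
    using LIMSEQ_D[of _ 0 1] zero_less_one by blast
  have "y k = 0" if "k \<ge> K" for k
    using K[OF that] by simp
  then show ?thesis by blast
qed

section \<open>Unipotence of a congruence subgroup\<close>

definition diff_act :: "'a :: group_mult \<Rightarrow> ('a \<Rightarrow> int) \<Rightarrow> 'a \<Rightarrow> int"
  where "diff_act g c v = act g c v - c v"

definition congr :: "'a :: group_mult set \<Rightarrow> 'a set \<Rightarrow> 'a set"
  where "congr G A = {g\<in>G. \<forall>c\<in>homZ A. \<forall>v\<in>A. 4 dvd diff_act g c v}"

lemma act_power_Suc: "act (g ^ k) (act g c) = act (g ^ Suc k) c"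
  by (simp add: act_act power_Suc2 del: power_Suc)

lemma homZ_add: "c \<in> homZ A \<Longrightarrow> d \<in> homZ A \<Longrightarrow> (\<lambda>v. c v + d v) \<in> homZ A"
  by (rule zmodule_add[OF zmodule_homZ])

primrec word_poly :: "bool list \<Rightarrow> int poly"
  where
    "word_poly [] = 0"
  | "word_poly (e # w) = pCons (if e then 1 else 0) (word_poly w)"

lemma coeff_word_poly: "coeff (word_poly w) i = 0 \<or> coeff (word_poly w) i = 1"
  by (induction w arbitrary: i) (auto simp: coeff_pCons split: nat.split)

text \<open>The preimage in \<open>U\<close> of the \<open>K\<close>-fixed vectors of U / W.
  Iterated from the zero module with \<open>U = homZ A\<close>, it produces an ascending filtration
  on whose quotients \<open>K\<close> acts trivially.\<close>

definition rel_fixed :: "'a :: group_mult set \<Rightarrow> ('a \<Rightarrow> int) set \<Rightarrow> ('a \<Rightarrow> int) set \<Rightarrow> ('a \<Rightarrow> int) set"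
  where "rel_fixed K U W = {c\<in>U. \<forall>g\<in>K. diff_act g c \<in> W}"

locale normal_subgroup =
  fixes G A :: "'a :: group_mult set" and S
  assumes G: "subgp G" "nofree G" and AG: "A \<subseteq> G" "normalizes G A" and S: "finite S" "A = gen S"
begin

lemma A: "subgp A"
  by (simp add: S subgp_gen)

lemma act_in: "g \<in> G \<Longrightarrow> c \<in> homZ A \<Longrightarrow> act g c \<in> homZ A"
  by (rule act_homZ[OF AG(2) G(1)])

lemma conj_in: "g \<in> G \<Longrightarrow> v \<in> A \<Longrightarrow> inverse g * v * g \<in> A"
  using normalizes_iff[OF AG(2) G(1)] by blast

text \<open>At t = g^(-1) the expansion of a word consists of conjugates g^(-i) v g^i, and the value
  of \<open>c\<close> there is the value at \<open>v\<close> of the i-th translate of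
  \<open>c\<close>.\<close>

lemma conj_word_recur:
  assumes "g \<in> G" "v \<in> A" "c \<in> homZ A"
  shows "conj_word v (inverse g) w \<in> A \<and>
    c (conj_word v (inverse g) w) = recur (word_poly w) (\<lambda>k. act (g ^ k) c v) 0"
  using assms(3)
proof (induction w arbitrary: c)
  case Nil
  then show ?case using A hom_on_one[OF homZ_hom A] by (simp add: subgp_one)
next
  case (Cons e w)
  let ?x = "conj_word v (inverse g) w"
  have x: "?x \<in> A" "inverse g * ?x * g \<in> A" "(if e then v else 1) \<in> A"
    using Cons assms conj_in A by (auto simp: subgp_one)
  have "c (inverse g * ?x * g) = recur (word_poly w) (\<lambda>k. act (g ^ Suc k) c v) 0"
    using Cons.IH[OF act_in[OF assms(1) Cons.prems]] unfolding act_power_Suc by (simp add: act_def)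
  also have "\<dots> = recur (word_poly w) (\<lambda>k. act (g ^ k) c v) 1"
    using recur_shift[of "word_poly w" "\<lambda>k. act (g ^ k) c v" 1 0] by simp
  finally have "c (conj_word v (inverse g) (e # w)) =
      c (if e then v else 1) + recur (word_poly w) (\<lambda>k. act (g ^ k) c v) 1"
    using hom_on_mult[OF homZ_hom[OF Cons.prems] x(3,2)] by (simp add: inv_inv)
  moreover have "c (if e then v else 1) = (if e then 1 else 0) * act (g ^ 0) c v"
    using hom_on_one[OF homZ_hom[OF Cons.prems] A] by (simp add: act_one)
  moreover have "conj_word v (inverse g) (e # w) \<in> A"
    using x A by (simp add: inv_inv subgp_mult)
  ultimately show ?case by (simp add: recur_pCons)
qed

text \<open>A power of \<open>g\<close> inside \<open>A\<close> acts trivially on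
  \<open>homZ A\<close>, since homomorphisms to an abelian group are invariant under inner
  conjugation; so X^j - 1 serves.\<close>

lemma periodic_relation:
  assumes "g \<in> G" "v \<in> A" "g ^ j \<in> A" "0 < j"
  shows "\<exists>P::int poly. P \<noteq> 0 \<and> (\<forall>i. \<bar>coeff P i\<bar> \<le> 1) \<and>
    (\<forall>c\<in>homZ A. recur P (\<lambda>k. act (g ^ k) c v) 0 = 0)"
proof (intro exI conjI ballI allI)
  let ?P = "monom 1 j + [:-1:] :: int poly"
  have co: "coeff ?P i = (if i = j then 1 else 0) + (if i = 0 then -1 else 0)" for i
    by (simp add: coeff_pCons split: nat.split)
  have "coeff ?P j = 1" using co[of j] assms(4) by simp
  then show "?P \<noteq> 0" by (metis coeff_0 zero_neq_one)
  show "\<bar>coeff ?P i\<bar> \<le> 1" for i unfolding co by simp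
  fix c assume c: "c \<in> homZ A"
  have "c (inverse (g ^ j) * v * g ^ j) = c v"
    using A assms hom_on_mult[OF homZ_hom[OF c]] hom_on_inv[OF homZ_hom[OF c]] by (simp add: subgp_closed)
  then have "act (g ^ j) c v = c v" by (simp add: act_def)
  then show "recur ?P (\<lambda>k. act (g ^ k) c v) 0 = 0"
    by (simp add: recur_add recur_monom recur_pCons act_one)
qed

text \<open>The polynomial depends on \<open>v\<close> but not on \<open>c\<close>. For the letters
  v g^(-1) and g^(-1), a relation between words of equal length and different first letters gives a
  difference of two polynomials with coefficients 0 and 1, nonzero by its constant term. A relation
  between words of different lengths forces a power of \<open>g\<close> into
  \<open>A\<close>.\<close>

lemma relation:
  assumes g: "g \<in> G" and v: "v \<in> A"
  shows "\<exists>P::int poly. P \<noteq> 0 \<and> (\<forall>i. \<bar>coeff P i\<bar> \<le> 1) \<and>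
    (\<forall>c\<in>homZ A. recur P (\<lambda>k. act (g ^ k) c v) 0 = 0)"
proof -
  let ?t = "inverse g"
  note cw = conj_word_recur[OF g v]
  have zero: "(\<lambda>_. 0) \<in> homZ A" by (rule zmodule_zero[OF zmodule_homZ])
  have cwA: "conj_word v ?t w \<in> A" for w using cw[OF zero] by blast
  have per: ?thesis if "?t ^ j \<in> A" "0 < j" for j
    using periodic_relation[OF g v _ that(2)] subgp_inv[OF A that(1)] by (simp add: inverse_power_gp inv_inv)
  have "v * ?t \<in> G" "?t \<in> G" using g v G AG by (auto intro: subgp_closed)
  then have "\<not> inj (word (v * ?t) ?t)" using G(2) by (simp add: nofree_def)
  then show ?thesis
  proof (cases rule: not_inj_word_cases)
    case (unit w)
    then have "conj_word v ?t w * ?t ^ length w = 1" by (simp add: word_conj_word)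
    then have "?t ^ length w = inverse (conj_word v ?t w)" using inv_unique by metis
    then have "?t ^ length w \<in> A" using cwA A by (simp add: subgp_inv)
    then show ?thesis using per unit(1) by simp
  next
    case (heads u w)
    have eq: "conj_word v ?t (True # u) * ?t ^ Suc (length u) = conj_word v ?t (False # w) * ?t ^ Suc (length w)"
      using heads unfolding word_conj_word by (simp only: list.size add_Suc_right add_0_right)
    show ?thesis
    proof (cases "length u = length w")
      case True
      then have eq': "conj_word v ?t (True # u) = conj_word v ?t (False # w)"
        using eq by (simp only: right_cancel)
      let ?P = "word_poly (True # u) - word_poly (False # w)"
      have "coeff ?P 0 = 1" by simp
      then have "?P \<noteq> 0" by (metis coeff_0 zero_neq_one)
      moreover have "\<bar>coeff ?P i\<bar> \<le> 1" for i
        unfolding coeff_diff using coeff_word_poly[of "True # u" i] coeff_word_poly[of "False # w" i] by linarith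
      moreover have "recur ?P (\<lambda>k. act (g ^ k) c v) 0 = 0" if c: "c \<in> homZ A" for c
      proof -
        have "?P = word_poly (True # u) + smult (-1) (word_poly (False # w))" by simp
        moreover have "recur (word_poly (True # u)) (\<lambda>k. act (g ^ k) c v) 0 =
            recur (word_poly (False # w)) (\<lambda>k. act (g ^ k) c v) 0"
          using cw[OF c] eq' by metis
        ultimately show ?thesis by (simp only: recur_add recur_smult)
      qed
      ultimately show ?thesis by blast
    next
      case False
      have "\<exists>j>0. ?t ^ j \<in> A"
        if "x * ?t ^ p = y * ?t ^ q" "x \<in> A" "y \<in> A" "p < q" for x y p q
      proof -
        have "?t ^ q = ?t ^ (q - p) * ?t ^ p" using that(4) by (simp add: power_add[symmetric])
        then have "x = y * ?t ^ (q - p)" using that(1) by (simp only: mult.assoc[symmetric] right_cancel)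
        then have "?t ^ (q - p) = inverse y * x" by (simp add: linv_mult)
        then show ?thesis using that A by (intro exI[of _ "q - p"]) (simp add: subgp_closed)
      qed
      from this[OF eq cwA cwA] this[OF eq[symmetric] cwA cwA] show ?thesis
        using False per by (metis Suc_less_eq linorder_neqE_nat)
    qed
  qed
qed

section \<open>Unipotence by division by 4\<close>

definition quarter :: "'a \<Rightarrow> ('a \<Rightarrow> int) \<Rightarrow> 'a \<Rightarrow> int"
  where "quarter g c v = diff_act g c v div 4"

lemma congr_in: "g \<in> congr G A \<Longrightarrow> g \<in> G"
  by (simp add: congr_def)

lemma diff_act_in: "g \<in> G \<Longrightarrow> c \<in> homZ A \<Longrightarrow> diff_act g c \<in> homZ A"
  unfolding diff_act_def[abs_def] by (rule zmodule_diff[OF zmodule_homZ act_in])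

lemma quarter_mult:
  assumes "g \<in> congr G A" "c \<in> homZ A"
  shows "4 * quarter g c v = diff_act g c v"
proof (cases "v \<in> A")
  case True
  then show ?thesis using assms by (auto simp: quarter_def congr_def)
next
  case False
  then have "diff_act g c v = 0"
    using homZ_outside[OF diff_act_in[OF congr_in[OF assms(1)] assms(2)]] by simp
  then show ?thesis by (simp add: quarter_def)
qed

lemma quarter_in:
  assumes "g \<in> congr G A" "c \<in> homZ A"
  shows "quarter g c \<in> homZ A"
proof -
  have d: "diff_act g c \<in> homZ A" by (rule diff_act_in[OF congr_in[OF assms(1)] assms(2)])
  have "quarter g c (a * b) = quarter g c a + quarter g c b" if "a \<in> A" "b \<in> A" for a b
    using hom_on_mult[OF homZ_hom[OF d] that] unfolding quarter_mult[OF assms, symmetric] by linarith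
  moreover have "quarter g c a = 0" if "a \<notin> A" for a
    using homZ_outside[OF d that] by (simp add: quarter_def)
  ultimately show ?thesis by (simp add: homZ_def hom_on_def)
qed

lemma quarter_pow_in: "g \<in> congr G A \<Longrightarrow> c \<in> homZ A \<Longrightarrow> (quarter g ^^ k) c \<in> homZ A"
  by (induction k) (auto simp: quarter_in)

lemma quarter_add:
  assumes "g \<in> congr G A" "c \<in> homZ A" "d \<in> homZ A"
  shows "quarter g (\<lambda>v. c v + m * d v) = (\<lambda>v. quarter g c v + m * quarter g d v)"
proof
  fix v
  have "(\<lambda>v. c v + m * d v) \<in> homZ A"
    using homZ_add[OF assms(2) zmodule_scale[OF zmodule_homZ assms(3)]] .
  then have "4 * quarter g (\<lambda>v. c v + m * d v) v = diff_act g (\<lambda>v. c v + m * d v) v"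
    by (rule quarter_mult[OF assms(1)])
  also have "\<dots> = diff_act g c v + m * diff_act g d v"
    by (simp add: diff_act_def act_def algebra_simps)
  also have "\<dots> = 4 * (quarter g c v + m * quarter g d v)"
    using quarter_mult[OF assms(1,2), of v] quarter_mult[OF assms(1,3), of v] by (simp add: algebra_simps)
  finally show "quarter g (\<lambda>v. c v + m * d v) v = quarter g c v + m * quarter g d v" by simp
qed

lemma quarter_pow_add:
  assumes "g \<in> congr G A" "c \<in> homZ A" "d \<in> homZ A"
  shows "(quarter g ^^ k) (\<lambda>v. c v + m * d v) = (\<lambda>v. (quarter g ^^ k) c v + m * (quarter g ^^ k) d v)"
  by (induction k) (simp_all add: quarter_add quarter_pow_in assms)

text \<open>For q = \<open>quarter g\<close> the element \<open>g\<close> acts as 1 + 4 q, so P(g)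
  is P(1 + 4 X) evaluated at q. The induction follows Horner's scheme, with \<open>act g c\<close>
  in place of \<open>c\<close>.\<close>

lemma recur_quarter:
  assumes "g \<in> congr G A" "c \<in> homZ A"
  shows "recur (pcompose P [:1, 4:]) (\<lambda>k. (quarter g ^^ k) c v) 0 = recur P (\<lambda>k. act (g ^ k) c v) 0"
  using assms(2)
proof (induction P arbitrary: c)
  case 0
  then show ?case by simp
next
  case (pCons a p)
  note c = pCons.prems
  let ?q = "pcompose p [:1, 4:]"
  have ac: "act g c = (\<lambda>v. c v + 4 * quarter g c v)"
    using quarter_mult[OF assms(1) c] by (simp add: fun_eq_iff diff_act_def)
  have "recur p (\<lambda>k. act (g ^ k) c v) 1 = recur p (\<lambda>k. act (g ^ k) (act g c) v) 0"
    unfolding act_power_Suc using recur_shift[of p "\<lambda>k. act (g ^ k) c v" 1 0] by simp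
  also have "\<dots> = recur ?q (\<lambda>k. (quarter g ^^ k) (act g c) v) 0"
    by (rule pCons.IH[OF act_in[OF congr_in[OF assms(1)] c], symmetric])
  also have "(\<lambda>k. (quarter g ^^ k) (act g c) v) =
      (\<lambda>k. (quarter g ^^ k) c v + 4 * (quarter g ^^ Suc k) c v)"
    unfolding ac quarter_pow_add[OF assms(1) c quarter_in[OF assms(1) c]] by (simp add: funpow_swap1)
  also have "recur ?q \<dots> 0 = recur ?q (\<lambda>k. (quarter g ^^ k) c v) 0 + 4 * recur ?q (\<lambda>k. (quarter g ^^ k) c v) 1"
    using recur_shift[of ?q "\<lambda>k. (quarter g ^^ k) c v" 1 0]
    by (simp only: recur_add_right recur_mult_right) simp
  finally have *: "recur p (\<lambda>k. act (g ^ k) c v) 1 = \<dots>" .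
  have "pcompose (pCons a p) [:1, 4:] = [:a:] + ?q + pCons 0 (smult 4 ?q)"
    by (simp add: pcompose_pCons)
  then show ?case
    by (simp add: recur_add recur_pCons recur_smult *[unfolded One_nat_def] act_one)
qed

lemma quarter_nilpotent:
  assumes g: "g \<in> congr G A" and c: "c \<in> homZ A"
  shows "\<exists>K. (quarter g ^^ K) c = (\<lambda>_. 0)"
proof -
  have "\<exists>K. \<forall>k\<ge>K. (quarter g ^^ k) c v = 0" if v: "v \<in> A" for v
  proof -
    obtain P :: "int poly" where P: "P \<noteq> 0" "\<And>i. \<bar>coeff P i\<bar> \<le> 1"
      "\<And>c. c \<in> homZ A \<Longrightarrow> recur P (\<lambda>k. act (g ^ k) c v) 0 = 0"
      using relation[OF congr_in[OF g] v] by blast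
    \<comment> \<open>As P annihilates every homomorphism at \<open>v\<close>, it may be applied to
      the vectors q^k c with q = \<open>quarter g\<close>; this makes the recurrence hold at every
      index.\<close>
    have "recur (pcompose P [:1, 4:]) (\<lambda>k. (quarter g ^^ k) c v) k = 0" for k
    proof -
      have "(\<lambda>i. (quarter g ^^ i) ((quarter g ^^ k) c) v) = (\<lambda>i. (quarter g ^^ (i + k)) c v)"
        by (simp add: funpow_add)
      then show ?thesis
        using recur_quarter[OF g quarter_pow_in[OF g c, of k], of P v] P(3)[OF quarter_pow_in[OF g c, of k]]
          recur_shift[of "pcompose P [:1, 4:]" "\<lambda>i. (quarter g ^^ i) c v" k 0] by simp
    qed
    then show ?thesis by (rule int_recur_eventually_zero[OF P(1,2)])
  qed
  then have "\<forall>s\<in>S. \<exists>K. \<forall>k\<ge>K. (quarter g ^^ k) c s = 0" using S(2) gen_base by blast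
  then obtain K where K: "\<forall>s\<in>S. \<forall>k\<ge>K s. (quarter g ^^ k) c s = 0" by (rule bchoice[THEN exE])
  have "(quarter g ^^ sum K S) c = (\<lambda>_. 0)"
  proof (rule homZ_eq_zero)
    show "(quarter g ^^ sum K S) c \<in> homZ (gen S)" using quarter_pow_in[OF g c] S(2) by simp
    fix s assume "s \<in> S"
    then show "(quarter g ^^ sum K S) c s = 0" using K member_le_sum[of s S K] S(1) by simp
  qed
  then show ?thesis ..
qed

lemma diff_act_pow:
  assumes "g \<in> congr G A" "c \<in> homZ A"
  shows "(diff_act g ^^ k) c = (\<lambda>v. 4 ^ k * (quarter g ^^ k) c v)"
proof (induction k)
  case (Suc k)
  have "diff_act g (\<lambda>v. 4 ^ k * (quarter g ^^ k) c v) = (\<lambda>v. 4 ^ k * diff_act g ((quarter g ^^ k) c) v)"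
    by (simp add: fun_eq_iff diff_act_def act_def algebra_simps)
  also have "\<dots> = (\<lambda>v. 4 ^ k * (4 * (quarter g ^^ Suc k) c v))"
    using quarter_mult[OF assms(1) quarter_pow_in[OF assms, of k]] by simp
  finally show ?case using Suc by (simp add: mult.assoc mult.left_commute)
qed simp

lemma unipotent:
  assumes "g \<in> congr G A" "c \<in> homZ A"
  shows "\<exists>k. (diff_act g ^^ k) c = (\<lambda>_. 0)"
proof -
  obtain K where "(quarter g ^^ K) c = (\<lambda>_. 0)" using quarter_nilpotent[OF assms] by auto
  then show ?thesis using diff_act_pow[OF assms, of K] by (intro exI[of _ K]) simp
qed

lemma subgp_congr: "subgp (congr G A)"
proof (rule subgpI)
  show "1 \<in> congr G A" by (simp add: congr_def diff_act_def act_one subgp_one G)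
next
  fix g h assume gh: "g \<in> congr G A" "h \<in> congr G A"
  show "g * h \<in> congr G A"
    unfolding congr_def
  proof (intro CollectI conjI ballI)
    show "g * h \<in> G" using gh G by (simp add: congr_def subgp_mult)
    fix c v assume c: "c \<in> homZ A" and v: "v \<in> A"
    have "diff_act (g * h) c v = diff_act g (act h c) v + diff_act h c v"
      by (simp add: diff_act_def act_act)
    moreover have "4 dvd diff_act g (act h c) v" "4 dvd diff_act h c v"
      using gh act_in[OF congr_in[OF gh(2)] c] c v by (simp_all add: congr_def)
    ultimately show "4 dvd diff_act (g * h) c v" by simp
  qed
next
  fix g assume g: "g \<in> congr G A"
  then have gi: "inverse g \<in> G" using G by (simp add: congr_def subgp_inv)
  show "inverse g \<in> congr G A"
    unfolding congr_def
  proof (intro CollectI conjI ballI gi)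
    fix c v assume c: "c \<in> homZ A" and v: "v \<in> A"
    have "4 dvd diff_act g (act (inverse g) c) v"
      using g act_in[OF gi c] v by (simp add: congr_def)
    moreover have "diff_act g (act (inverse g) c) v = - diff_act (inverse g) c v"
      by (simp add: diff_act_def act_act rinv act_one)
    ultimately show "4 dvd diff_act (inverse g) c v" by simp
  qed
qed

lemma dvd_gen:
  assumes "c \<in> homZ A" "\<And>s. s \<in> S \<Longrightarrow> 4 dvd c s" "v \<in> A"
  shows "4 dvd c v"
proof -
  have "subgp {v\<in>A. 4 dvd c v}"
    using A hom_on_mult[OF homZ_hom[OF assms(1)]] hom_on_inv[OF homZ_hom[OF assms(1)]]
      hom_on_one[OF homZ_hom[OF assms(1)]] by (auto intro!: subgpI simp: subgp_closed)
  moreover have "S \<subseteq> {v\<in>A. 4 dvd c v}" using assms(2) S(2) gen_base by auto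
  ultimately show ?thesis using gen_least assms(3) S(2) by blast
qed

text \<open>\<open>F g\<close> is the graph of the action of g^(-1) modulo 4, recorded by values at
  \<open>S\<close>, and so ranges over a finite set. If \<open>F g = F h\<close>, each
  \<open>c\<close> has a \<open>d\<close> such that c = d and g^(-1) c = h^(-1) d modulo 4, whence
  (h g^(-1)) c = d = c modulo 4.\<close>

lemma congr_finite_index:
  obtains F :: "'a \<Rightarrow> (('a \<Rightarrow> int) \<times> ('a \<Rightarrow> int)) set"
  where "finite (F ` G)" "\<And>g h. g \<in> G \<Longrightarrow> h \<in> G \<Longrightarrow> F g = F h \<Longrightarrow> h * inverse g \<in> congr G A"
proof -
  define r where "r c = restrict (\<lambda>s. c s mod 4) S" for c :: "'a \<Rightarrow> int"
  define F where "F g = (\<lambda>c. (r c, r (act (inverse g) c))) ` homZ A" for g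
  let ?T = "S \<rightarrow>\<^sub>E {0..<4::int}"
  have "F ` G \<subseteq> Pow (?T \<times> ?T)" by (auto simp: F_def r_def)
  moreover have "finite (Pow (?T \<times> ?T))" using S(1) by (simp add: finite_PiE)
  ultimately have fin: "finite (F ` G)" by (rule finite_subset)
  have r: "4 dvd c s - d s" if "r c = r d" "s \<in> S" for c d s
  proof -
    have "c s mod 4 = d s mod 4" using fun_cong[OF that(1), of s] that(2) by (simp add: r_def)
    then show ?thesis by (simp add: mod_eq_dvd_iff)
  qed
  have "h * inverse g \<in> congr G A" if gh: "g \<in> G" "h \<in> G" "F g = F h" for g h
    unfolding congr_def
  proof (intro CollectI conjI ballI)
    show "h * inverse g \<in> G" using gh G by (simp add: subgp_closed)
    have gi: "inverse g \<in> G" "inverse h \<in> G" using gh G by (simp_all add: subgp_inv)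
    fix c v assume c: "c \<in> homZ A" and v: "v \<in> A"
    have "(r c, r (act (inverse g) c)) \<in> F g" unfolding F_def by (rule imageI[OF c])
    then have "(r c, r (act (inverse g) c)) \<in> F h" by (simp only: gh(3))
    then obtain d where d': "(r c, r (act (inverse g) c)) = (r d, r (act (inverse h) d))" "d \<in> homZ A"
      unfolding F_def by (rule imageE)
    then have d: "d \<in> homZ A" "r c = r d" "r (act (inverse g) c) = r (act (inverse h) d)"
      by (simp_all only: prod.inject)
    have cd: "4 dvd c w - d w" if "w \<in> A" for w
      using dvd_gen[OF zmodule_diff[OF zmodule_homZ c d(1)] r[OF d(2)] that] .
    have gd: "4 dvd act (inverse g) c w - act (inverse h) d w" if "w \<in> A" for w
      using dvd_gen[OF zmodule_diff[OF zmodule_homZ act_in[OF gi(1) c] act_in[OF gi(2) d(1)]] r[OF d(3)] that] .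
    let ?w = "inverse h * v * h"
    have w: "?w \<in> A" by (rule conj_in[OF gh(2) v])
    have "act (inverse h) d ?w = d v" by (simp add: act_def group_simps)
    moreover have "act (inverse g) c ?w = act (h * inverse g) c v"
      by (simp add: act_def group_simps)
    ultimately have "4 dvd act (h * inverse g) c v - d v" using gd[OF w] by simp
    from dvd_diff[OF this cd[OF v]]
    show "4 dvd diff_act (h * inverse g) c v" by (simp add: diff_act_def)
  qed
  then show ?thesis using that fin by blast
qed

section \<open>Pure sublattices and their rank\<close>

text \<open>The quotient of \<open>homZ A\<close> by such a \<open>V\<close> has no torsion. Between
  pure sublattices a proper inclusion shows in the rank, as it does for subspaces.\<close>

definition pure :: "('a \<Rightarrow> int) set \<Rightarrow> bool"
  where "pure V \<longleftrightarrow> zmodule V \<and> V \<subseteq> homZ A \<and>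
    (\<forall>c\<in>homZ A. \<forall>m. m \<noteq> 0 \<longrightarrow> (\<lambda>a. m * c a) \<in> V \<longrightarrow> c \<in> V)"

lemma pureD:
  assumes "pure V"
  shows "zmodule V" "V \<subseteq> homZ A" "c \<in> homZ A \<Longrightarrow> m \<noteq> 0 \<Longrightarrow> (\<lambda>a. m * c a) \<in> V \<Longrightarrow> c \<in> V"
  using assms unfolding pure_def by blast+

definition gens :: "'a list"
  where "gens = (SOME xs. set xs = S)"

lemma set_gens: "set gens = S"
  unfolding gens_def by (rule someI_ex) (use finite_list[OF S(1)] in blast)

text \<open>The positions of the leading entries of the echelon form of \<open>V\<close>, evaluated at the generators;
  their number is the rank of \<open>V\<close>.\<close>

definition pivots :: "('a \<Rightarrow> int) set \<Rightarrow> nat set"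
  where "pivots V = {i. i < length gens \<and> (\<exists>c\<in>V. c (gens ! i) \<noteq> 0 \<and> (\<forall>k<i. c (gens ! k) = 0))}"

lemma finite_pivots: "finite (pivots V)"
  by (rule finite_subset[of _ "{..<length gens}"]) (auto simp: pivots_def)

lemma card_pivots_le: "card (pivots V) \<le> length gens"
  using card_mono[of "{..<length gens}" "pivots V"] by (force simp: pivots_def)

lemma pivots_mono: "V \<subseteq> U \<Longrightarrow> pivots V \<subseteq> pivots U"
  by (auto simp: pivots_def)

text \<open>Gaussian elimination without division: a vector of \<open>U\<close> is reduced position
  by position by vectors of \<open>V\<close> with the same leading position, so that a nonzero
  multiple of it lies in \<open>V\<close>; purity removes the factor.\<close>

lemma pure_eqI:
  assumes V: "pure V" and U: "pure U" and VU: "V \<subseteq> U" "pivots U \<subseteq> pivots V"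
  shows "V = U"
proof
  note zV = pureD(1)[OF V] and zU = pureD(1)[OF U]
  have claim: "\<exists>m. m \<noteq> 0 \<and> (\<lambda>a. m * c a) \<in> V"
    if "i \<le> length gens" "c \<in> U" "\<forall>k<i. c (gens ! k) = 0" for c i
    using that
  proof (induction i arbitrary: c rule: inc_induct)
    case base
    have "c = (\<lambda>_. 0)"
    proof (rule homZ_eq_zero)
      show "c \<in> homZ (gen S)" using base pureD(2)[OF U] S(2) by blast
      fix s assume "s \<in> S"
      then obtain k where "k < length gens" "s = gens ! k" using set_gens by (metis in_set_conv_nth)
      then show "c s = 0" using base by simp
    qed
    then show ?case using zmodule_zero[OF zV] by (intro exI[of _ 1]) simp
  next
    case (step i)
    show ?case
    proof (cases "c (gens ! i) = 0")
      case True
      then have "\<forall>k<Suc i. c (gens ! k) = 0" using step.prems by (simp add: less_Suc_eq)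
      then show ?thesis using step by blast
    next
      case False
      then have "i \<in> pivots U" using step by (auto simp: pivots_def)
      then obtain d where d: "d \<in> V" "d (gens ! i) \<noteq> 0" "\<forall>k<i. d (gens ! k) = 0"
        using VU(2) by (auto simp: pivots_def)
      let ?p = "d (gens ! i)" and ?q = "c (gens ! i)"
      have "(\<lambda>a. ?p * c a + (- ?q) * d a) \<in> U"
        by (rule zmodule_comb[OF zU]) (use step d VU in auto)
      moreover have "\<forall>k<Suc i. ?p * c (gens ! k) + (- ?q) * d (gens ! k) = 0"
        using step.prems(2) d(3) by (auto simp: less_Suc_eq)
      ultimately obtain m where m: "m \<noteq> 0" "(\<lambda>a. m * (?p * c a + (- ?q) * d a)) \<in> V"
        using step.IH by blast
      have "(\<lambda>a. 1 * (m * (?p * c a + (- ?q) * d a)) + (m * ?q) * d a) \<in> V"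
        by (rule zmodule_comb[OF zV m(2) d(1)])
      then have "(\<lambda>a. (m * ?p) * c a) \<in> V" by (simp add: algebra_simps)
      then show ?thesis using m(1) d(2) by (intro exI[of _ "m * ?p"]) simp
    qed
  qed
  show "U \<subseteq> V"
  proof
    fix c assume c: "c \<in> U"
    obtain m where "m \<noteq> 0" "(\<lambda>a. m * c a) \<in> V" using claim[of 0 c] c by auto
    then show "c \<in> V" using pureD(3)[OF V] pureD(2)[OF U] c by blast
  qed
qed (rule VU)

lemma card_pivots_less:
  assumes "pure V" "pure U" "V \<subset> U"
  shows "card (pivots V) < card (pivots U)"
proof (rule psubset_card_mono[OF finite_pivots])
  show "pivots V \<subset> pivots U" using pure_eqI[OF assms(1,2)] pivots_mono[of V U] assms(3) by blast
qed

definition invariant :: "'a set \<Rightarrow> ('a \<Rightarrow> int) set \<Rightarrow> bool"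
  where "invariant K V \<longleftrightarrow> (\<forall>g\<in>K. \<forall>c\<in>V. act g c \<in> V)"

lemma invariantD: "invariant K V \<Longrightarrow> g \<in> K \<Longrightarrow> c \<in> V \<Longrightarrow> act g c \<in> V"
  by (simp add: invariant_def)

lemma invariant_diff: "invariant K V \<Longrightarrow> zmodule V \<Longrightarrow> g \<in> K \<Longrightarrow> c \<in> V \<Longrightarrow> diff_act g c \<in> V"
  unfolding diff_act_def[abs_def] by (intro zmodule_diff invariantD)

lemma pure_rel_fixed:
  assumes U: "pure U" and W: "pure W" and K: "K \<subseteq> G"
  shows "pure (rel_fixed K U W)"
proof -
  have lin: "diff_act g (\<lambda>a. m * c a + n * d a) = (\<lambda>a. m * diff_act g c a + n * diff_act g d a)" for g m n c d
    by (simp add: fun_eq_iff diff_act_def act_def algebra_simps)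
  have scale: "diff_act g (\<lambda>a. m * c a) = (\<lambda>a. m * diff_act g c a)" for g m c
    by (simp add: fun_eq_iff diff_act_def act_def algebra_simps)
  have "diff_act g (\<lambda>_. 0) = (\<lambda>_. 0)" for g :: 'a
    by (simp add: fun_eq_iff diff_act_def act_def)
  then have "diff_act g (\<lambda>_. 0) \<in> W" for g using zmodule_zero[OF pureD(1)[OF W]] by metis
  then have "zmodule (rel_fixed K U W)"
    using pureD(1)[OF U] pureD(1)[OF W] by (simp add: zmodule_def rel_fixed_def lin)
  moreover have "c \<in> rel_fixed K U W" if c: "c \<in> homZ A" "m \<noteq> 0" "(\<lambda>a. m * c a) \<in> rel_fixed K U W" for c m
  proof -
    have "c \<in> U" using pureD(3)[OF U c(1,2)] c(3) by (simp add: rel_fixed_def)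
    moreover have "diff_act g c \<in> W" if "g \<in> K" for g
      using pureD(3)[OF W diff_act_in[OF _ c(1)] c(2)] that c(3) K by (auto simp: rel_fixed_def scale)
    ultimately show ?thesis by (simp add: rel_fixed_def)
  qed
  moreover have "rel_fixed K U W \<subseteq> homZ A" using pureD(2)[OF U] by (auto simp: rel_fixed_def)
  ultimately show ?thesis unfolding pure_def by blast
qed

lemma diff_act_conj: "diff_act h (act g c) = act g (diff_act (inverse g * h * g) c)"
  by (simp add: fun_eq_iff diff_act_def act_def group_simps)

lemma invariant_rel_fixed:
  assumes "invariant K U" "invariant K W" "subgp K" "normalizes K H"
  shows "invariant K (rel_fixed H U W)"
  unfolding invariant_def
proof (intro ballI)
  fix g c assume g: "g \<in> K" and c: "c \<in> rel_fixed H U W"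
  have "diff_act h (act g c) \<in> W" if "h \<in> H" for h
    unfolding diff_act_conj
    using invariantD[OF assms(2) g] c normalizes_iff[OF assms(4,3) g] that by (simp add: rel_fixed_def)
  then show "act g c \<in> rel_fixed H U W"
    using invariantD[OF assms(1) g] c by (simp add: rel_fixed_def)
qed

section \<open>Kolchin's argument\<close>

text \<open>Fixed vectors are demanded in all invariant pure sections U / W, since the step from
  \<open>H\<close> to \<open>K\<close> uses them in a minimal section that is not known in
  advance.\<close>

definition has_fixed :: "'a set \<Rightarrow> bool"
  where "has_fixed K \<longleftrightarrow> (\<forall>W U. pure W \<longrightarrow> pure U \<longrightarrow> invariant K W \<longrightarrow> invariant K U \<longrightarrow> W \<subset> U \<longrightarrow>
    (\<exists>c\<in>U - W. c \<in> rel_fixed K U W))"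

lemma has_fixed_trivial: "has_fixed {1}"
  unfolding has_fixed_def
proof (intro allI impI)
  fix W U assume W: "pure W" and "W \<subset> U"
  have "diff_act 1 c = (\<lambda>_. 0)" for c :: "'a \<Rightarrow> int" by (simp add: fun_eq_iff diff_act_def act_one)
  then have "diff_act 1 c \<in> W" for c using zmodule_zero[OF pureD(1)[OF W]] by metis
  then have "rel_fixed {1} U W = U" by (simp add: rel_fixed_def)
  then show "\<exists>c\<in>U - W. c \<in> rel_fixed {1} U W" using \<open>W \<subset> U\<close> by auto
qed

text \<open>Kolchin's argument: in a \<open>K\<close>-invariant \<open>V\<close> minimal over \<open>W\<close>, the vectors fixed by \<open>H\<close> modulo \<open>W\<close>
  are all of \<open>V\<close>; then the elements of \<open>K\<close> commute on \<open>V\<close> modulo \<open>W\<close>, so the vectors fixed by any single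
  one of them form an invariant submodule, which is again all of \<open>V\<close> by unipotence.\<close>

lemma has_fixed_step:
  assumes K: "K \<subseteq> congr G A" "subgp K" and H: "H \<subseteq> K" "normalizes K H"
    and comm: "\<And>g h. g \<in> K \<Longrightarrow> h \<in> K \<Longrightarrow> g * h * inverse g * inverse h \<in> H"
    and good: "has_fixed H"
  shows "has_fixed K"
  unfolding has_fixed_def
proof (intro allI impI)
  fix W U assume W: "pure W" "invariant K W" and U: "pure U" "invariant K U" and WU: "W \<subset> U"
  let ?P = "\<lambda>V. pure V \<and> invariant K V \<and> W \<subset> V \<and> V \<subseteq> U"
  have "?P U" using U WU by simp
  then obtain V where V: "?P V" and Vmin: "\<And>V'. ?P V' \<Longrightarrow> card (pivots V) \<le> card (pivots V')"
    using ex_has_least_nat[of ?P U "\<lambda>V. card (pivots V)"] by blast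
  have KG: "K \<subseteq> G" "H \<subseteq> G" using K(1) H(1) congr_in by blast+
  have full: "V' = V" if "pure V'" "invariant K V'" "W \<subset> V'" "V' \<subseteq> V" for V'
  proof (rule ccontr)
    assume "V' \<noteq> V"
    then have "card (pivots V') < card (pivots V)" using card_pivots_less[of V' V] that V by blast
    moreover have "card (pivots V) \<le> card (pivots V')" using Vmin[of V'] that V by blast
    ultimately show False by simp
  qed
  have Winv: "W \<subseteq> rel_fixed K' V W" if "K' \<subseteq> K" for K'
    using V invariant_diff[OF W(2) pureD(1)[OF W(1)]] that by (auto simp: rel_fixed_def)
  have VH: "rel_fixed H V W = V"
  proof (rule full)
    show "pure (rel_fixed H V W)" by (rule pure_rel_fixed) (use V W KG in auto)
    show "invariant K (rel_fixed H V W)" by (rule invariant_rel_fixed) (use V W K H in auto)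
    have "invariant H W" "invariant H V" using V W H(1) by (auto simp: invariant_def)
    then obtain c where "c \<in> V - W" "c \<in> rel_fixed H V W" using good V W unfolding has_fixed_def by blast
    then show "W \<subset> rel_fixed H V W" using Winv[OF H(1)] by blast
  qed (auto simp: rel_fixed_def)
  have Vg: "rel_fixed {k} V W = V" if k: "k \<in> K" for k
  proof (rule full)
    show "pure (rel_fixed {k} V W)" by (rule pure_rel_fixed) (use V W KG k in auto)
    show "invariant K (rel_fixed {k} V W)"
      unfolding invariant_def
    proof (intro ballI)
      fix g c assume g: "g \<in> K" and c: "c \<in> rel_fixed {k} V W"
      then have cV: "c \<in> V" "diff_act k c \<in> W" by (simp_all add: rel_fixed_def)
      \<comment> \<open>For this commutator h one has k g = g k h, hence (k - 1) g = g k (h - 1) + g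
        (k - 1), and h acts trivially on V modulo W.\<close>
      let ?h = "inverse k * inverse g * k * g"
      have "inverse k * inverse g * inverse (inverse k) * inverse (inverse g) \<in> H"
        by (rule comm) (use g k K in \<open>auto intro: subgp_inv\<close>)
      then have "?h \<in> H" by (simp add: inv_inv)
      then have "diff_act ?h c \<in> W" using cV(1) VH by (auto simp: rel_fixed_def)
      then have "act (g * k) (diff_act ?h c) \<in> W" using invariantD[OF W(2)] subgp_mult[OF K(2) g k] by simp
      moreover have "act g (diff_act k c) \<in> W" by (rule invariantD[OF W(2) g cV(2)])
      moreover have "diff_act k (act g c) = (\<lambda>v. act (g * k) (diff_act ?h c) v + act g (diff_act k c) v)"
        by (simp add: fun_eq_iff diff_act_def act_def group_simps)
      ultimately have "diff_act k (act g c) \<in> W" using zmodule_add[OF pureD(1)[OF W(1)]] by simp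
      then show "act g c \<in> rel_fixed {k} V W"
        using invariantD[OF _ g cV(1)] V by (simp add: rel_fixed_def)
    qed
    obtain c where c: "c \<in> V" "c \<notin> W" using V by blast
    have cL: "c \<in> homZ A" using c V pureD(2) by blast
    have kc: "k \<in> congr G A" using k K by blast
    obtain j where "(diff_act k ^^ j) c = (\<lambda>_. 0)" using unipotent[OF kc cL] by blast
    then have ex: "(diff_act k ^^ j) c \<in> W" using zmodule_zero[OF pureD(1)[OF W(1)]] by simp
    \<comment> \<open>The vector just before the sequence (k - 1)^i c first enters W is outside W
      and fixed by k modulo W.\<close>
    define l where "l = (LEAST j. (diff_act k ^^ j) c \<in> W)"
    have l: "(diff_act k ^^ l) c \<in> W" unfolding l_def by (rule LeastI[of _ j]) (rule ex)
    then obtain l' where l': "l = Suc l'" using c(2) by (cases l) auto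
    let ?e = "(diff_act k ^^ l') c"
    have "?e \<notin> W" using not_less_Least[of l' "\<lambda>j. (diff_act k ^^ j) c \<in> W"] l' by (simp add: l_def[symmetric])
    moreover have "?e \<in> V"
      by (induction l') (use c(1) invariant_diff[OF _ _ k] V pureD(1) in auto)
    moreover have "diff_act k ?e \<in> W" using l l' by simp
    ultimately show "W \<subset> rel_fixed {k} V W" using Winv[of "{k}"] k by (auto simp: rel_fixed_def)
  qed (auto simp: rel_fixed_def)
  obtain c where c: "c \<in> V" "c \<notin> W" using V by blast
  have "diff_act k c \<in> W" if "k \<in> K" for k using Vg[OF that] c(1) by (auto simp: rel_fixed_def)
  moreover have "c \<in> U" using c(1) V by blast
  ultimately have "c \<in> rel_fixed K U W" by (simp add: rel_fixed_def)
  then show "\<exists>c\<in>U - W. c \<in> rel_fixed K U W" using c(2) \<open>c \<in> U\<close> by blast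
qed

text \<open>Each term of the filtration short of \<open>homZ A\<close> is followed by one of larger
  rank, and the rank is at most the number of generators.\<close>

lemma fixed_filtration:
  assumes K: "K \<subseteq> G" "subgp K" and good: "has_fixed K"
  shows "\<exists>j. (rel_fixed K (homZ A) ^^ j) {\<lambda>_. 0} = homZ A"
proof (rule ccontr)
  assume n: "\<not> ?thesis"
  let ?V = "\<lambda>j. (rel_fixed K (homZ A) ^^ j) {\<lambda>_. 0}"
  have L: "pure (homZ A)" by (simp add: pure_def zmodule_homZ)
  have Linv: "invariant K (homZ A)" using act_in K(1) by (auto simp: invariant_def)
  have KK: "normalizes K K" using K(2) by (simp add: normalizes_def subgp_closed)
  have V: "pure (?V j) \<and> invariant K (?V j) \<and> j \<le> card (pivots (?V j))" for j
  proof (induction j)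
    case 0
    have "pure {\<lambda>_. 0}"
      using zmodule_zero[OF zmodule_homZ[of A]] by (auto simp: pure_def zmodule_def fun_eq_iff)
    then show ?case by (simp add: invariant_def act_def)
  next
    case (Suc j)
    have p: "pure (?V (Suc j))" using pure_rel_fixed[OF L _ K(1)] Suc by simp
    have i: "invariant K (?V (Suc j))" using invariant_rel_fixed[OF Linv _ K(2) KK] Suc by simp
    have "?V j \<subset> homZ A" using n pureD(2) Suc by blast
    then obtain c where "c \<notin> ?V j" "c \<in> ?V (Suc j)"
      using good Suc L Linv unfolding has_fixed_def by fastforce
    moreover have "?V j \<subseteq> ?V (Suc j)"
      using Suc pureD(1,2) invariant_diff[of K "?V j"] by (fastforce simp: rel_fixed_def)
    ultimately have "?V j \<subset> ?V (Suc j)" by blast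
    then show ?case using p i card_pivots_less[of "?V j" "?V (Suc j)"] Suc by simp
  qed
  from V[of "Suc (length gens)"] card_pivots_le[of "?V (Suc (length gens))"] show False by simp
qed

end

section \<open>Nilpotence\<close>

primrec lcs :: "'a :: group_mult set \<Rightarrow> nat \<Rightarrow> 'a set"
  where
    "lcs N 0 = N"
  | "lcs N (Suc k) = gen (\<Union>h\<in>lcs N k. \<Union>g\<in>N. {h * g * inverse h * inverse g})"

definition finite_index :: "'a :: group_mult set \<Rightarrow> 'a set \<Rightarrow> bool"
  where "finite_index N G \<longleftrightarrow> finite ((\<lambda>g. (\<lambda>x. x * g) ` N) ` G)"

lemma coset_eq_iff:
  assumes "subgp N"
  shows "(\<lambda>x. x * g) ` N = (\<lambda>x. x * h) ` N \<longleftrightarrow> h * inverse g \<in> (N :: 'a :: group_mult set)"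
proof
  assume eq: "(\<lambda>x. x * g) ` N = (\<lambda>x. x * h) ` N"
  have "h \<in> (\<lambda>x. x * h) ` N" using subgp_one[OF assms] by (intro image_eqI[of _ _ 1]) auto
  then obtain x where "x \<in> N" "h = x * g" unfolding eq[symmetric] by auto
  then show "h * inverse g \<in> N" by (simp add: group_simps)
next
  assume N: "h * inverse g \<in> N"
  have "x * g \<in> (\<lambda>x. x * h) ` N" if "x \<in> N" for x
  proof (rule image_eqI)
    show "x * g = (x * inverse (h * inverse g)) * h" by (simp add: group_simps)
    show "x * inverse (h * inverse g) \<in> N" by (rule subgp_mult[OF assms that subgp_inv[OF assms N]])
  qed
  moreover have "x * h \<in> (\<lambda>x. x * g) ` N" if "x \<in> N" for x
  proof (rule image_eqI)
    show "x * h = (x * (h * inverse g)) * g" by (simp add: group_simps)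
    show "x * (h * inverse g) \<in> N" by (rule subgp_mult[OF assms that N])
  qed
  ultimately show "(\<lambda>x. x * g) ` N = (\<lambda>x. x * h) ` N" by blast
qed

lemma finite_indexI:
  assumes "subgp N" "finite (F ` G)" "\<And>g h. g \<in> G \<Longrightarrow> h \<in> G \<Longrightarrow> F g = F h \<Longrightarrow> h * inverse g \<in> N"
  shows "finite_index N G"
proof -
  let ?c = "\<lambda>g. (\<lambda>x. x * g) ` N"
  have eq: "?c g = ?c (inv_into G F (F g))" if "g \<in> G" for g
    unfolding coset_eq_iff[OF assms(1)]
    by (rule assms(3)) (use that in \<open>simp_all add: inv_into_into f_inv_into_f\<close>)
  have "?c ` G \<subseteq> (\<lambda>y. ?c (inv_into G F y)) ` F ` G"
  proof
    fix C assume "C \<in> ?c ` G"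
    then obtain g where "g \<in> G" "C = ?c g" by (rule imageE) blast
    then show "C \<in> (\<lambda>y. ?c (inv_into G F y)) ` F ` G"
      unfolding \<open>C = ?c g\<close> eq[OF \<open>g \<in> G\<close>] by (intro imageI)
  qed
  then show ?thesis unfolding finite_index_def by (rule finite_subset) (intro finite_imageI assms(2))
qed

lemma finite_index_Int:
  assumes "subgp N" "subgp M" "finite_index N G" "finite_index M G"
  shows "finite_index (N \<inter> M) G"
proof (rule finite_indexI)
  let ?F = "\<lambda>g. ((\<lambda>x. x * g) ` N, (\<lambda>x. x * g) ` M)"
  show "subgp (N \<inter> M)" using assms by (auto simp: subgp_def)
  have "?F ` G \<subseteq> ((\<lambda>g. (\<lambda>x. x * g) ` N) ` G) \<times> ((\<lambda>g. (\<lambda>x. x * g) ` M) ` G)" by auto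
  then show "finite (?F ` G)"
    by (rule finite_subset) (use assms in \<open>simp add: finite_index_def\<close>)
  fix g h assume "?F g = ?F h"
  then show "h * inverse g \<in> N \<inter> M"
    using coset_eq_iff[OF assms(1)] coset_eq_iff[OF assms(2)] by blast
qed

text \<open>The subgroup is the intersection N of the congruence subgroups for the terms of the
  series, so it acts unipotently on every lattice. Kolchin's step climbs from the trivial group N
  \<inter> Gs n up to N and gives each lattice a finite filtration with trivial action on the
  quotients. Once a term of the lower central series lies in \<open>Gs i\<close>, finitely many
  further commutators push it into \<open>Gs (Suc i)\<close>.\<close>

theorem virtually_nilpotent:
  assumes G: "subgp G" "nofree G" "fg G" and triv: "(res ^^ n) G = {1}"
  shows "\<exists>N. subgp N \<and> N \<subseteq> G \<and> finite_index N G \<and> (\<exists>m. lcs N m = {1})"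
proof -
  define Gs where "Gs i = (res ^^ i) G" for i
  have Gs: "subgp (Gs i)" "nofree (Gs i)" "fg (Gs i)" "Gs i \<subseteq> G" "normalizes G (Gs i)"
    "Gs (Suc i) = res (Gs i)" for i
    unfolding Gs_def by (intro res_series G)+ simp
  have "\<exists>S. normal_subgroup G (Gs i) S" for i
    using Gs(3)[of i] Gs(4,5)[of i] G(1,2) unfolding fg_def normal_subgroup_def by blast
  then obtain S where ns: "\<And>i. normal_subgroup G (Gs i) (S i)" by metis
  define N where "N k = {g\<in>G. \<forall>i<k. g \<in> congr G (Gs i)}" for k
  have sN: "subgp (N k) \<and> finite_index (N k) G" for k
  proof (induction k)
    case 0
    have "N 0 = G" by (simp add: N_def)
    moreover have "finite ((\<lambda>_. 0::nat) ` G)" by (rule finite_subset[of _ "{0}"]) auto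
    ultimately show ?case
      using G(1) finite_indexI[of G "\<lambda>_. 0::nat" G] by (simp add: subgp_closed)
  next
    case (Suc k)
    interpret normal_subgroup G "Gs k" "S k" by (rule ns)
    have "N (Suc k) = N k \<inter> congr G (Gs k)"
      by (auto simp: N_def less_Suc_eq)
    moreover have "finite_index (congr G (Gs k)) G"
      using congr_finite_index finite_indexI[OF subgp_congr] by metis
    moreover have "subgp (N k \<inter> congr G (Gs k))"
      using Suc subgp_congr by (auto simp: subgp_def)
    ultimately show ?case using finite_index_Int[OF _ subgp_congr] Suc by simp
  qed
  let ?N = "N n"
  have NG: "?N \<subseteq> G" by (auto simp: N_def)
  have Nn: "Gs n = {1}" using triv by (simp add: Gs_def)
  have sNG: "subgp (?N \<inter> Gs k)" for k using sN[of n] Gs(1)[of k] by (auto simp: subgp_def)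
  have norm: "normalizes ?N (?N \<inter> Gs k)" for k
    using sN[of n] Gs(5)[of k] NG by (auto simp: normalizes_def subgp_closed)
  have filt: "\<exists>j. (rel_fixed ?N (homZ (Gs i)) ^^ j) {\<lambda>_. 0} = homZ (Gs i)"
    if "i < n" for i
  proof -
    interpret normal_subgroup G "Gs i" "S i" by (rule ns)
    have Nc: "?N \<subseteq> congr G (Gs i)" using that by (auto simp: N_def)
    have "has_fixed (?N \<inter> Gs k)" if "k \<le> n" for k
      using that
    proof (induction k rule: inc_induct)
      case base
      have "?N \<inter> Gs n = {1}" using Nn sN[of n] subgp_one by auto
      then show ?case using has_fixed_trivial by simp
    next
      case (step k)
      show ?case
      proof (rule has_fixed_step[OF _ sNG _ _ _ step.IH])
        show "?N \<inter> Gs k \<subseteq> congr G (Gs i)" using Nc by blast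
        show "?N \<inter> Gs (Suc k) \<subseteq> ?N \<inter> Gs k" using Gs(6)[of k] res_subset by blast
        show "normalizes (?N \<inter> Gs k) (?N \<inter> Gs (Suc k))"
          by (rule normalizes_subset[OF norm]) simp
        fix g h assume "g \<in> ?N \<inter> Gs k" "h \<in> ?N \<inter> Gs k"
        then show "g * h * inverse g * inverse h \<in> ?N \<inter> Gs (Suc k)"
          using commutator_res[OF Gs(1)] Gs(6) sN[of n] by (auto simp: subgp_closed)
      qed
    qed
    from this[of 0] have "has_fixed ?N" using NG by (simp add: Gs_def Int_absorb2)
    from fixed_filtration[OF NG sN[THEN conjunct1] this] show ?thesis .
  qed
  have "\<exists>m. lcs ?N m \<subseteq> ?N \<inter> Gs i" if "i \<le> n" for i
    using that
  proof (induction i)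
    case 0
    then show ?case using NG by (intro exI[of _ 0]) (simp add: Gs_def)
  next
    case (Suc i)
    then obtain m where m: "lcs ?N m \<subseteq> ?N \<inter> Gs i" by auto
    obtain J where J: "(rel_fixed ?N (homZ (Gs i)) ^^ J) {\<lambda>_. 0} = homZ (Gs i)"
      using filt[of i] Suc.prems by auto
    let ?V = "\<lambda>j. (rel_fixed ?N (homZ (Gs i)) ^^ j) {\<lambda>_. 0}"
    \<comment> \<open>Commutation with \<open>?N\<close> costs one layer of the filtration: the
      value of c at the commutator of h and g is minus that of (g^(-1) - 1) c at h, and this vector
      lies one layer lower.\<close>
    have "lcs ?N (m + j) \<subseteq> {h \<in> ?N \<inter> Gs i. \<forall>c\<in>?V j. c h = 0}" for j
    proof (induction j)
      case 0
      have "c h = 0" if "c \<in> ?V 0" for c h using that by simp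
      then show ?case using m by auto
    next
      case (Suc j)
      have V: "?V (Suc j) \<subseteq> homZ (Gs i)" by (auto simp: rel_fixed_def)
      have "subgp {h \<in> ?N \<inter> Gs i. \<forall>c\<in>?V (Suc j). c h = 0}" (is "subgp ?B")
      proof (rule subgpI)
        have hom: "hom_on (Gs i) c" if "c \<in> ?V (Suc j)" for c using that V homZ_hom by blast
        show "1 \<in> ?B" using sNG[of i] hom_on_one[OF hom Gs(1)] by (simp add: subgp_def)
        fix a assume a: "a \<in> ?B"
        have "c (inverse a) = 0" if "c \<in> ?V (Suc j)" for c
        proof -
          have "c a = 0" "a \<in> Gs i" using a that by blast+
          then show ?thesis using hom_on_inv[OF hom[OF that] Gs(1)] by simp
        qed
        then show "inverse a \<in> ?B" using subgp_inv[OF sNG[of i], of a] a by blast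
        fix b assume b: "b \<in> ?B"
        have "c (a * b) = 0" if "c \<in> ?V (Suc j)" for c
        proof -
          have "c a = 0" "c b = 0" "a \<in> Gs i" "b \<in> Gs i" using a b that by blast+
          then show ?thesis using hom_on_mult[OF hom[OF that]] by simp
        qed
        then show "a * b \<in> ?B" using subgp_mult[OF sNG[of i], of a b] a b by blast
      qed
      moreover have "h * g * inverse h * inverse g \<in> ?B" if h: "h \<in> lcs ?N (m + j)" and g: "g \<in> ?N" for h g
      proof -
        have hB: "h \<in> ?N" "h \<in> Gs i" "\<And>c. c \<in> ?V j \<Longrightarrow> c h = 0" using Suc h by auto
        have gi: "inverse g \<in> ?N" using sN[of n] g by (simp add: subgp_inv)
        have ghi: "g * inverse h * inverse g \<in> ?N \<inter> Gs i"
          using normalizesD[OF norm g, of "inverse h" i] hB sNG[of i] by (simp add: subgp_def)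
        have gh: "g * h * inverse g \<in> Gs i"
          using normalizesD[OF norm g, of h i] hB by simp
        have "c (h * g * inverse h * inverse g) = 0" if c: "c \<in> ?V (Suc j)" for c
        proof -
          have hc: "hom_on (Gs i) c" using c V homZ_hom by blast
          have "c (h * g * inverse h * inverse g) = c h + c (inverse (g * h * inverse g))"
            using hom_on_mult[OF hc hB(2), of "g * inverse h * inverse g"] ghi by (simp add: group_simps)
          also have "c (inverse (g * h * inverse g)) = - c (g * h * inverse g)"
            by (rule hom_on_inv[OF hc Gs(1) gh])
          also have "c h + - c (g * h * inverse g) = - diff_act (inverse g) c h"
            by (simp add: diff_act_def act_def inv_inv)
          also have "diff_act (inverse g) c h = 0"
            using hB(3) c gi by (auto simp: rel_fixed_def)
          finally show ?thesis by simp
        qed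
        moreover have "h * g * inverse h * inverse g \<in> ?N \<inter> Gs i"
          using hB ghi sNG[of i] by (metis IntI mult.assoc subgp_mult)
        ultimately show ?thesis by simp
      qed
      ultimately show ?case
        unfolding add_Suc_right lcs.simps by (intro gen_least) blast+
    qed
    from this[of J] have "lcs ?N (m + J) \<subseteq> ?N \<inter> Gs (Suc i)"
      unfolding J Gs(6) res_def by blast
    then show ?case by blast
  qed
  then obtain m where "lcs ?N m \<subseteq> {1}" using Nn by blast
  moreover have "1 \<in> lcs ?N m" using sN[of n] by (cases m) (auto simp: subgp_one gen_one)
  ultimately have "lcs ?N m = {1}" by blast
  then show ?thesis using sN[of n] NG by blast
qed

section \<open>Transfer to \<open>Diff_plus\<close>\<close>

locale group_embedding = group G for G :: "('b, 'c) monoid_scheme" (structure) +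
  fixes \<phi> :: "'b \<Rightarrow> 'a :: group_mult"
  assumes \<phi>_mult: "x \<in> carrier G \<Longrightarrow> y \<in> carrier G \<Longrightarrow> \<phi> (x \<otimes> y) = \<phi> x * \<phi> y"
    and \<phi>_inj: "inj_on \<phi> (carrier G)"
begin

lemma \<phi>_one: "\<phi> \<one> = 1"
  using \<phi>_mult[of \<one> \<one>] left_cancel[of "\<phi> \<one>" "\<phi> \<one>" 1] by simp

lemma \<phi>_inv: "x \<in> carrier G \<Longrightarrow> \<phi> (inv x) = inverse (\<phi> x)"
  using \<phi>_mult[of x "inv x"] group_mult_class.inv_unique[of "\<phi> x" "\<phi> (inv x)"] by (simp add: \<phi>_one)

lemma \<phi>_eq_iff: "x \<in> carrier G \<Longrightarrow> y \<in> carrier G \<Longrightarrow> \<phi> x = \<phi> y \<longleftrightarrow> x = y"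
  using \<phi>_inj by (auto simp: inj_on_def)

lemma subgp_image: "subgp (\<phi> ` carrier G)"
proof (rule subgpI)
  show "1 \<in> \<phi> ` carrier G" using imageI[OF one_closed, of \<phi>] \<phi>_one by simp
  fix a assume "a \<in> \<phi> ` carrier G"
  then obtain x where x: "x \<in> carrier G" "a = \<phi> x" by blast
  show "inverse a \<in> \<phi> ` carrier G" by (rule image_eqI[of _ _ "inv x"]) (simp_all add: x \<phi>_inv)
  fix b assume "b \<in> \<phi> ` carrier G"
  then obtain y where y: "y \<in> carrier G" "b = \<phi> y" by blast
  show "a * b \<in> \<phi> ` carrier G" by (rule image_eqI[of _ _ "x \<otimes> y"]) (simp_all add: x y \<phi>_mult)
qed

lemma fg_image:
  assumes "finitely_generated G"
  shows "fg (\<phi> ` carrier G)"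
proof -
  obtain S where S: "finite S" "S \<subseteq> carrier G" "generate G S = carrier G"
    using assms by (auto simp: finitely_generated_def)
  have "\<phi> x \<in> gen (\<phi> ` S)" if "x \<in> generate G S" for x
    using that
  proof (induction rule: generate.induct)
    case one
    then show ?case by (simp add: \<phi>_one gen_one)
  next
    case (incl h)
    then show ?case by (simp add: gen_base)
  next
    case (inv h)
    then have "h \<in> carrier G" "\<phi> h \<in> gen (\<phi> ` S)" using S(2) by (auto intro: gen_base)
    then show ?case by (simp add: \<phi>_inv gen_inv)
  next
    case (eng h1 h2)
    then show ?case using generate_in_carrier[OF S(2)] by (simp add: \<phi>_mult gen_mult)
  qed
  then have "\<phi> ` carrier G \<subseteq> gen (\<phi> ` S)" using S(3) by blast
  moreover have "gen (\<phi> ` S) \<subseteq> \<phi> ` carrier G"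
    by (rule gen_least[OF subgp_image]) (use S in blast)
  ultimately show ?thesis using S(1) unfolding fg_def by blast
qed

lemma nofree_image:
  assumes "\<not> contains_free_semigroup G"
  shows "nofree (\<phi> ` carrier G)"
  unfolding nofree_def
proof (intro ballI)
  fix a b assume "a \<in> \<phi> ` carrier G" "b \<in> \<phi> ` carrier G"
  then obtain f g where fg: "f \<in> carrier G" "g \<in> carrier G" "a = \<phi> f" "b = \<phi> g" by blast
  have w: "eval_word G f g w \<in> carrier G \<and> \<phi> (eval_word G f g w) = word a b w" for w
    by (induction w) (use fg in \<open>auto simp: eval_word_def \<phi>_mult \<phi>_one\<close>)
  have "\<not> inj (eval_word G f g)" using assms fg by (auto simp: contains_free_semigroup_def)
  then obtain u v where "u \<noteq> v" "eval_word G f g u = eval_word G f g v" by (auto simp: inj_def)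
  then show "\<not> inj (word a b)" using w by (metis injD)
qed

text \<open>Right cosets of the preimage of \<open>N\<close> are mapped injectively to right cosets
  of \<open>N\<close>, which bounds the index. The lower central series of the preimage is carried
  into that of \<open>N\<close>, and injectivity of \<open>\<phi>\<close> brings the triviality of
  the last term back.\<close>

lemma almost_nilpotentI:
  assumes N: "subgp N" "N \<subseteq> \<phi> ` carrier G" "finite_index N (\<phi> ` carrier G)" "lcs N m = {1}"
  shows "almost_nilpotent G"
proof -
  define M where "M = {x \<in> carrier G. \<phi> x \<in> N}"
  have sM: "subgroup M G"
    by (rule subgroupI) (use N(1) in \<open>auto simp: M_def subgp_closed \<phi>_mult \<phi>_inv \<phi>_one intro: exI[of _ \<one>]\<close>)
  have img: "\<phi> ` M = N" using N(2) by (auto simp: M_def)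
  have coset: "\<phi> ` (M #> g) = (\<lambda>x. x * \<phi> g) ` N" if "g \<in> carrier G" for g
    unfolding img[symmetric] r_coset_def using that by (force simp: M_def \<phi>_mult image_image)
  have "(\<lambda>C. \<phi> ` C) ` (rcosets M) \<subseteq> (\<lambda>g. (\<lambda>x. x * g) ` N) ` \<phi> ` carrier G"
    using coset by (force simp: RCOSETS_def)
  then have "finite ((\<lambda>C. \<phi> ` C) ` (rcosets M))"
    using N(3) unfolding finite_index_def by (rule finite_subset)
  moreover have "inj_on (\<lambda>C. \<phi> ` C) (rcosets M)"
    by (rule inj_on_subset[OF inj_on_image_Pow[OF \<phi>_inj]])
      (use rcosets_part_G[OF sM] in blast)
  ultimately have fin: "finite (rcosets M)" by (rule finite_imageD)
  let ?M = "G\<lparr>carrier := M\<rparr>"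
  interpret M: group ?M by (rule subgroup.subgroup_is_group[OF sM is_group])
  have invM: "inv\<^bsub>?M\<^esub> x = inv x" if "x \<in> M" for x
    by (rule m_inv_consistent[OF sM that])
  have MG: "x \<in> carrier G" if "x \<in> M" for x using that by (simp add: M_def)
  have low: "lower_central ?M k \<subseteq> {x \<in> M. \<phi> x \<in> lcs N k}" for k
  proof (induction k)
    case 0
    show ?case by (auto simp: M_def)
  next
    case (Suc k)
    have comm: "h \<otimes> g \<otimes> inv\<^bsub>?M\<^esub> h \<otimes> inv\<^bsub>?M\<^esub> g \<in> M \<and>
        \<phi> (h \<otimes> g \<otimes> inv\<^bsub>?M\<^esub> h \<otimes> inv\<^bsub>?M\<^esub> g) \<in> lcs N (Suc k)"
      if "h \<in> lower_central ?M k" "g \<in> M" for h g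
    proof -
      have h: "h \<in> M" "\<phi> h \<in> lcs N k" using Suc that(1) by auto
      have "\<phi> (h \<otimes> g \<otimes> inv h \<otimes> inv g) = \<phi> h * \<phi> g * inverse (\<phi> h) * inverse (\<phi> g)"
        using MG h(1) that(2) by (simp add: \<phi>_mult \<phi>_inv)
      moreover have "\<phi> g \<in> N" using that(2) by (simp add: M_def)
      ultimately have "\<phi> (h \<otimes> g \<otimes> inv h \<otimes> inv g) \<in> lcs N (Suc k)"
        using h(2) by (auto intro!: gen_base)
      moreover have "h \<otimes> g \<otimes> inv h \<otimes> inv g \<in> M"
        using h(1) that(2) by (meson sM subgroup.m_closed subgroup.m_inv_closed)
      ultimately show ?thesis using invM h(1) that(2) by simp
    qed
    have "x \<in> M \<and> \<phi> x \<in> lcs N (Suc k)" if "x \<in> lower_central ?M (Suc k)" for x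
      using that unfolding lower_central.simps
    proof (induction rule: generate.induct)
      case one
      then show ?case using sM by (simp add: \<phi>_one gen_one subgroup.one_closed)
    next
      case (incl h)
      then show ?case using comm by auto
    next
      case (inv h)
      then have h: "h \<in> M" "\<phi> h \<in> lcs N (Suc k)" using comm by auto
      then show ?case
        using invM[OF h(1)] MG[OF h(1)] sM by (simp add: \<phi>_inv gen_inv subgroup.m_inv_closed)
    next
      case (eng h1 h2)
      then show ?case using sM MG by (simp add: \<phi>_mult gen_mult subgroup.m_closed)
    qed
    then show ?case by blast
  qed
  have "lower_central ?M m \<subseteq> {\<one>}"
  proof
    fix x assume "x \<in> lower_central ?M m"
    then have x: "x \<in> M" "\<phi> x = 1" using low[of m] N(4) by auto
    then show "x \<in> {\<one>}" using \<phi>_eq_iff[OF MG[OF x(1)] one_closed] \<phi>_one by simp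
  qed
  moreover have "\<one> \<in> lower_central ?M m"
    using M.one_closed generate.one[of ?M] by (cases m) auto
  ultimately have "nilpotent ?M" unfolding nilpotent_def by (intro exI[of _ m]) auto
  then show ?thesis unfolding almost_nilpotent_def using sM fin by blast
qed

end

section \<open>Extension by the identity\<close>

definition ext_homeo :: "(real \<Rightarrow> real) \<Rightarrow> homeo"
  where "ext_homeo f = Abs_homeo (\<lambda>x. if x \<in> {0..1} then f x else x)"

context
  fixes f :: "real \<Rightarrow> real"
  assumes bij: "bij_betw f {0..1} {0..1}" and mono: "strict_mono_on {0..1} f"
begin

lemma endpoints: "f 0 = 0" "f 1 = 1"
proof -
  have m: "f x \<le> f y" if "0 \<le> x" "x \<le> y" "y \<le> 1" for x y
    using strict_mono_on_leD[OF mono] that by simp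
  have "0 \<in> f ` {0..1}" "1 \<in> f ` {0..1}" using bij by (simp_all add: bij_betw_def)
  then obtain x y where "x \<in> {0..1}" "f x = 0" "y \<in> {0..1}" "f y = 1" by force
  moreover have "f 0 \<in> {0..1}" "f 1 \<in> {0..1}" using bij by (auto simp: bij_betw_def)
  ultimately show "f 0 = 0" "f 1 = 1" using m[of 0 x] m[of y 1] by auto
qed

lemma app_ext_homeo: "app (ext_homeo f) x = (if x \<in> {0..1} then f x else x)"
proof -
  let ?F = "\<lambda>x. if x \<in> {0..1} then f x else x"
  have rng: "0 \<le> f x" "f x \<le> 1" if "0 \<le> x" "x \<le> 1" for x
    using bij that by (auto simp: bij_betw_def)
  have "strict_mono ?F"
  proof (rule strict_monoI)
    fix x y :: real assume "x < y"
    then show "?F x < ?F y"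
      using strict_mono_onD[OF mono, of x y] rng[of x] rng[of y] by (auto simp: not_le)
  qed
  moreover have "surj ?F"
  proof (rule surjI)
    fix y
    show "?F (if y \<in> {0..1} then inv_into {0..1} f y else y) = y"
      using bij_betw_inv_into_right[OF bij, of y] inv_into_into[of y f "{0..1}"] bij
      by (auto simp: bij_betw_def)
  qed
  ultimately have "?F \<in> {f. bij f \<and> strict_mono f}"
    by (auto simp: bij_def strict_mono_imp_inj_on)
  then have "app (ext_homeo f) = ?F" unfolding ext_homeo_def by (rule Abs_homeo_inverse)
  then show ?thesis by simp
qed

end

lemma carrier_Diff_plus:
  assumes "f \<in> carrier (Diff_plus \<alpha>)"
  shows "f \<in> Bij {0..1}" "bij_betw f {0..1} {0..1}" "strict_mono_on {0..1} f" "f \<in> extensional {0..1}"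
    "C1_on {0..1} (inv_into {0..1} f)" "\<exists>f'. deriv_on {0..1} f f' \<and> holder_on \<alpha> {0..1} f'"
  using assms by (auto simp: Diff_plus_def C1_diffeos_def Bij_def)

lemma deriv_on_id: "deriv_on I (\<lambda>x. x) (\<lambda>_. 1)"
  by (auto simp: deriv_on_def)

text \<open>The inverse is of class C^1, so its derivative is bounded by some M, and the chain rule
  turns this into the lower bound 1 / M for the derivative of \<open>f\<close>.\<close>

lemma holder_diffeo_ext_homeo:
  assumes f: "f \<in> carrier (Diff_plus \<alpha>)"
  shows "holder_diffeo \<alpha> (ext_homeo f)"
proof -
  let ?I = "{0..1::real}"
  note c = carrier_Diff_plus[OF f]
  note ext = app_ext_homeo[OF c(2,3)]
  obtain f' where f': "deriv_on ?I f f'" "holder_on \<alpha> ?I f'" using c(6) by blast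
  obtain C where C: "C \<ge> 0" "\<And>x y. x \<in> ?I \<Longrightarrow> y \<in> ?I \<Longrightarrow> \<bar>f' x - f' y\<bar> \<le> C * \<bar>x - y\<bar> powr \<alpha>"
    using holder_on_nonneg[OF f'(2)] by blast
  obtain h' where h': "deriv_on ?I (inv_into ?I f) h'" "continuous_on ?I h'"
    using c(5) by (auto simp: C1_on_def)
  obtain M where M: "M > 0" "\<And>x. x \<in> ?I \<Longrightarrow> \<bar>h' x\<bar> \<le> M"
    using continuous_bounded[OF h'(2)] by blast
  have fI: "f \<in> ?I \<rightarrow> ?I" using c(2) by (auto simp: bij_betw_def)
  have "deriv_on ?I (\<lambda>x. inv_into ?I f (f x)) (\<lambda>x. h' (f x) * f' x)"
    by (rule deriv_on_compose[OF h'(1) f'(1) fI])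
  moreover have "inv_into ?I f (f x) = x" if "x \<in> ?I" for x
    by (rule bij_betw_inv_into_left[OF c(2) that])
  ultimately have "deriv_on ?I (\<lambda>x. x) (\<lambda>x. h' (f x) * f' x)"
    using deriv_on_cong[of ?I "\<lambda>x. inv_into ?I f (f x)" "\<lambda>x. x"] by simp
  then have prod: "h' (f x) * f' x = 1" if "x \<in> ?I" for x
    using deriv_on_unique[OF _ deriv_on_id that] by blast
  have lower: "1 / M \<le> \<bar>f' x\<bar>" if x: "x \<in> ?I" for x
  proof -
    have "1 = \<bar>h' (f x)\<bar> * \<bar>f' x\<bar>" using prod[OF x] by (simp add: abs_mult[symmetric])
    also have "\<dots> \<le> M * \<bar>f' x\<bar>"
      by (rule mult_right_mono[OF M(2)[OF funcset_mem[OF fI x]]]) simp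
    finally show ?thesis using M(1) by (simp add: field_simps)
  qed
  have "deriv_on ?I (app (ext_homeo f)) f'"
    using f'(1) deriv_on_cong[of ?I "app (ext_homeo f)" f] ext by simp
  moreover have "app (ext_homeo f) x = x" if "x \<notin> {0<..<1}" for x
    using that endpoints[OF c(2,3)] by (cases "x = 0 \<or> x = 1") (auto simp: ext)
  moreover have "1 / M > 0" using M(1) by simp
  ultimately show ?thesis
    unfolding holder_diffeo_def using C lower by blast
qed

lemma group_embedding_ext_homeo:
  assumes "\<alpha> > 0" "subgroup H (Diff_plus \<alpha>)"
  shows "group_embedding (Diff_plus \<alpha>\<lparr>carrier := H\<rparr>) ext_homeo"
proof -
  interpret D: group "Diff_plus \<alpha>" by (rule group_Diff_plus[OF assms(1)])
  have H: "f \<in> carrier (Diff_plus \<alpha>)" if "f \<in> H" for f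
    using that subgroup.subset[OF assms(2)] by blast
  have app: "app (ext_homeo f) x = (if x \<in> {0..1} then f x else x)" if "f \<in> H" for f x
    by (rule app_ext_homeo) (use carrier_Diff_plus[OF H[OF that]] in auto)
  interpret group "Diff_plus \<alpha>\<lparr>carrier := H\<rparr>"
    by (rule subgroup.subgroup_is_group[OF assms(2) D.is_group])
  show ?thesis
  proof unfold_locales
    fix f g assume fg: "f \<in> carrier (Diff_plus \<alpha>\<lparr>carrier := H\<rparr>)" "g \<in> carrier (Diff_plus \<alpha>\<lparr>carrier := H\<rparr>)"
    let ?m = "f \<otimes>\<^bsub>Diff_plus \<alpha>\<lparr>carrier := H\<rparr>\<^esub> g"
    have mH: "?m \<in> H" using m_closed[OF fg] by simp
    have m: "?m = compose {0..1} f g"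
      using carrier_Diff_plus(1)[OF H] fg by (simp add: Diff_plus_def BijGroup_def)
    have gI: "g x \<in> {0..1}" if "x \<in> {0..1}" for x
      using carrier_Diff_plus(2)[OF H, of g] fg that by (auto simp: bij_betw_def)
    show "ext_homeo ?m = ext_homeo f * ext_homeo g"
    proof (rule homeo_eqI)
      fix x
      show "app (ext_homeo ?m) x = app (ext_homeo f * ext_homeo g) x"
        unfolding app[OF mH] unfolding m using fg gI[of x] by (auto simp: app compose_def)
    qed
  next
    show "inj_on ext_homeo (carrier (Diff_plus \<alpha>\<lparr>carrier := H\<rparr>))"
    proof (rule inj_onI)
      fix f g assume fg: "f \<in> carrier (Diff_plus \<alpha>\<lparr>carrier := H\<rparr>)" "g \<in> carrier (Diff_plus \<alpha>\<lparr>carrier := H\<rparr>)"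
        and eq: "ext_homeo f = ext_homeo g"
      show "f = g"
      proof (rule extensionalityI)
        show "f \<in> extensional {0..1}" "g \<in> extensional {0..1}"
          using carrier_Diff_plus(4)[OF H] fg by simp_all
        fix x :: real assume "x \<in> {0..1}"
        then show "f x = g x" using app[of f x] app[of g x] fg eq by simp
      qed
    qed
  qed
qed

theorem mainTheorem4:
  fixes \<alpha> :: real and H :: "(real \<Rightarrow> real) set"
  assumes "\<alpha> > 0"
    and "subgroup H (Diff_plus \<alpha>)"
    and "finitely_generated (Diff_plus \<alpha>\<lparr>carrier := H\<rparr>)"
    and "\<not> contains_free_semigroup (Diff_plus \<alpha>\<lparr>carrier := H\<rparr>)"
  shows "almost_nilpotent (Diff_plus \<alpha>\<lparr>carrier := H\<rparr>)"
proof -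
  interpret group_embedding "Diff_plus \<alpha>\<lparr>carrier := H\<rparr>" ext_homeo
    by (rule group_embedding_ext_homeo[OF assms(1,2)])
  have "ext_homeo ` carrier (Diff_plus \<alpha>\<lparr>carrier := H\<rparr>) = ext_homeo ` H" by simp
  note G = subgp_image[unfolded this] nofree_image[OF assms(4), unfolded this] fg_image[OF assms(3), unfolded this]
  have "holder_diffeo \<alpha> g" if "g \<in> ext_homeo ` H" for g
    using that holder_diffeo_ext_homeo subgroup.subset[OF assms(2)] by blast
  then obtain n where "(res ^^ n) (ext_homeo ` H) = {1}"
    using res_series_trivial[OF assms(1) G] by blast
  from virtually_nilpotent[OF G this] obtain N m where
    "subgp N" "N \<subseteq> ext_homeo ` H" "finite_index N (ext_homeo ` H)" "lcs N m = {1}" by blast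
  then show ?thesis using almost_nilpotentI[of N m] by simp
qed

end
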